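(* Let $T$ be an $\omega$-Calderón–Zygmund operator on $\mathbb{R}^d$ with $\omega$ satisfying the Dini condition. (i) (Sufficiency) Suppose $1<p,q<\infty$, $\mu\in A_p$ and $\lambda\in A_q$. For every $b\in L^1_{\mathrm{loc}}(\mathbb{R}^d)$, $$\|[b,T]\|_{L^p(\mu)\to L^q(\lambda)}\le\big(\|T\|_{L^p(\mu)\to L^p(\mu)}+\|T\|_{L^q(\lambda)\to L^q(\lambda)}\big)\cdot\inf_c\|f\mapsto(b-c)f\|_{L^p(\mu)\to L^q(\lambda)},$$ where the infimum is over all constants $c$. (ii) (Non-necessity) Suppose $1<q<p<\infty$. Then there are $\mu\in A_p$, $\lambda\in A_q$ and $b\in L^1_{\mathrm{loc}}(\mathbb{R}^d)$ such that $$\inf_c\|f\mapsto(b-c)f\|_{L^p(\mu)\to L^q(\lambda)}=\infty\quad\text{and}\quad\|[b,T]\|_{L^p(\mu)\to L^q(\lambda)}<\infty.$$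
   Context: Cubes in $\mathbb{R}^d$ have sides parallel to the axes; $\langle f\rangle_Q:=\frac1{|Q|}\int_Q f\,dx$; $p'$ is the conjugate exponent of $p$. A weight is a locally integrable function $w:\mathbb{R}^d\to(0,\infty)$; $\|f\|_{L^p(w)}:=(\int|f|^pw\,dx)^{1/p}$. For $p\in(1,\infty)$, $[w]_{A_p}:=\sup_Q\langle w\rangle_Q\langle w^{-p'/p}\rangle_Q^{p/p'}$ (supremum over all cubes), and $w\in A_p$ means $w$ is a weight with $[w]_{A_p}<\infty$. A modulus of continuity is an increasing function $\omega:[0,\infty)\to[0,\infty)$ with $\lim_{t\to0}\omega(t)=0$; the Dini condition is $\int_0^1\omega(t)\frac{dt}{t}<\infty$. An $\omega$-Calderón–Zygmund kernel is a function $K:\{(x,y)\in\mathbb{R}^d\times\mathbb{R}^d:x\ne y\}\to\mathbb{C}$ such that, for some constant $C_K$, $|K(x,y)|\le C_K|x-y|^{-d}$ for $x\neq y$, and $|K(x,y)-K(x',y)|+|K(y,x)-K(y,x')|\le\frac1{|x-y|^d}\omega\big(\frac{|x-x'|}{|x-y|}\big)$ whenever $|x-x'|\le\frac12|x-y|$. An $\omega$-Calderón–Zygmund operator is a linear operator $T$, bounded on $L^{s}(\mathbb{R}^d)$ for some $s\in(1,\infty)$, for which there is an $\omega$-Calderón–Zygmund kernel $K$ with $Tf(x)=\int K(x,y)f(y)\,dy$ for all $f\in L^\infty_c$ (bounded, compactly supported) and $x\notin\operatorname{supp}f$. Under the Dini condition $T$ extends boundedly $L^1\to L^{1,\infty}$,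 and $T$ is bounded on $L^p(w)$ for $w\in A_p$, $1<p<\infty$. For $b\in L^1_{\mathrm{loc}}$ and $f\in L^\infty_c$, $[b,T]f:=b\,Tf-T(bf)$. The norm $\|[b,T]\|_{L^p(\mu)\to L^q(\lambda)}\in[0,\infty]$ is the least $N$ with $\|[b,T]f\|_{L^q(\lambda)}\le N\|f\|_{L^p(\mu)}$ for all $f\in L^\infty_c$ (and $\infty$ if there is none). The multiplication-operator norm $\|f\mapsto(b-c)f\|_{L^p(\mu)\to L^q(\lambda)}\in[0,\infty]$ is defined analogously, over $f\in L^p(\mu)$. *)

theory Defs
  imports "HOL-Analysis.Analysis"
begin

text \<open>
  The Euclidean space of dimension \<open>d\<close> is \<open>real ^ 'n\<close> with \<open>d = CARD('n)\<close>, carrying the complete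
  measure \<open>lebesgue\<close>. Elements of function spaces are represented by functions; identities
  between them are required almost everywhere only. Norms take values in \<open>ennreal\<close>.
\<close>

text \<open>Powers with exponent \<open>r > 0\<close> on \<open>[0,\<infinity>]\<close>.\<close>

definition epowr :: "ennreal \<Rightarrow> real \<Rightarrow> ennreal" where
  "epowr x r = (if x = top then top else ennreal (enn2real x powr r))"

definition conj_exponent :: "real \<Rightarrow> real" where
  "conj_exponent p = p / (p - 1)"

definition loc_integrable :: "(real ^ 'n \<Rightarrow> 'b::euclidean_space) \<Rightarrow> bool" where
  "loc_integrable f \<longleftrightarrow> (\<forall>S. compact S \<longrightarrow> f absolutely_integrable_on S)"

subsection \<open>Weights\<close>

definition weight :: "(real ^ 'n \<Rightarrow> real) \<Rightarrow> bool" where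
  "weight w \<longleftrightarrow> (\<forall>x. 0 < w x) \<and> loc_integrable w"

definition cubes :: "(real ^ 'n) set set" where
  "cubes = {cbox a (a + (\<chi> i. l)) | a l. 0 < l}"

text \<open>For nonnegative functions; the average may be infinite, as is needed for the second factor in
  the \<open>A\<^sub>p\<close> constant.\<close>

definition avg :: "(real ^ 'n) set \<Rightarrow> (real ^ 'n \<Rightarrow> real) \<Rightarrow> ennreal" where
  "avg Q f = (\<integral>\<^sup>+x\<in>Q. ennreal (f x) \<partial>lebesgue) / emeasure lebesgue Q"

definition Ap_const :: "real \<Rightarrow> (real ^ 'n \<Rightarrow> real) \<Rightarrow> ennreal" where
  "Ap_const p w = (SUP Q\<in>cubes. avg Q w *
     epowr (avg Q (\<lambda>x. w x powr (- (conj_exponent p / p)))) (p / conj_exponent p))"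

definition Ap_weights :: "real \<Rightarrow> (real ^ 'n \<Rightarrow> real) set" where
  "Ap_weights p = {w. weight w \<and> Ap_const p w < \<infinity>}"

subsection \<open>Weighted Lebesgue spaces and operator norms\<close>

definition Lp_norm :: "real \<Rightarrow> (real ^ 'n \<Rightarrow> real) \<Rightarrow> (real ^ 'n \<Rightarrow> complex) \<Rightarrow> ennreal" where
  "Lp_norm p w f = epowr (\<integral>\<^sup>+x. ennreal (cmod (f x) powr p * w x) \<partial>lebesgue) (1 / p)"

definition Lp_space :: "real \<Rightarrow> (real ^ 'n \<Rightarrow> real) \<Rightarrow> (real ^ 'n \<Rightarrow> complex) set" where
  "Lp_space p w = {f. f \<in> borel_measurable lebesgue \<and> Lp_norm p w f < \<infinity>}"

text \<open>Every class of essentially bounded functions with compact essential support has a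
  representative of the following kind.\<close>

definition Linf_c :: "(real ^ 'n \<Rightarrow> complex) set" where
  "Linf_c = {f. f \<in> borel_measurable lebesgue \<and> bounded (range f) \<and> compact (closure {x. f x \<noteq> 0})}"

text \<open>
  The operator \<open>U\<close> is tested on the functions in \<open>D\<close>; \<open>Inf {} = \<infinity>\<close>. With \<open>D = Linf_c\<close>, which is
  dense in \<open>L\<^sup>p(w)\<close> for every weight \<open>w\<close>, and \<open>U\<close> bounded in the norm of \<open>L\<^sup>p(w)\<close>, this is the norm
  of the bounded extension of \<open>U\<close> to all of \<open>L\<^sup>p(w)\<close>.
\<close>

definition op_norm ::
  "(real ^ 'n \<Rightarrow> complex) set \<Rightarrow> real \<Rightarrow> (real ^ 'n \<Rightarrow> real) \<Rightarrow> real \<Rightarrow> (real ^ 'n \<Rightarrow> real) \<Rightarrow>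
   ((real ^ 'n \<Rightarrow> complex) \<Rightarrow> real ^ 'n \<Rightarrow> complex) \<Rightarrow> ennreal" where
  "op_norm D p \<mu> q \<nu> U =
     Inf {ennreal N | N. 0 \<le> N \<and> (\<forall>f\<in>D. Lp_norm q \<nu> (U f) \<le> ennreal N * Lp_norm p \<mu> f)}"

definition mult_norm ::
  "real \<Rightarrow> (real ^ 'n \<Rightarrow> real) \<Rightarrow> real \<Rightarrow> (real ^ 'n \<Rightarrow> real) \<Rightarrow> (real ^ 'n \<Rightarrow> complex) \<Rightarrow> ennreal" where
  "mult_norm p \<mu> q \<nu> g = op_norm (Lp_space p \<mu>) p \<mu> q \<nu> (\<lambda>f x. g x * f x)"

subsection \<open>Calderon-Zygmund operators\<close>

definition modulus_of_continuity :: "(real \<Rightarrow> real) \<Rightarrow> bool" where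
  "modulus_of_continuity \<omega> \<longleftrightarrow>
     (\<forall>t\<ge>0. 0 \<le> \<omega> t) \<and> mono_on {0..} \<omega> \<and> (\<omega> \<longlongrightarrow> 0) (at 0 within {0..})"

definition dini :: "(real \<Rightarrow> real) \<Rightarrow> bool" where
  "dini \<omega> \<longleftrightarrow> (\<integral>\<^sup>+t\<in>{0<..1}. ennreal (\<omega> t / t) \<partial>lebesgue) < \<infinity>"

text \<open>Values of \<open>K\<close> on the diagonal are irrelevant.\<close>

definition cz_kernel :: "(real \<Rightarrow> real) \<Rightarrow> (real ^ 'n \<Rightarrow> real ^ 'n \<Rightarrow> complex) \<Rightarrow> bool" where
  "cz_kernel \<omega> K \<longleftrightarrow>
     (\<exists>C. \<forall>x y. x \<noteq> y \<longrightarrow> cmod (K x y) \<le> C / norm (x - y) ^ CARD('n)) \<and>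
     (\<forall>x x' y. x \<noteq> y \<and> norm (x - x') \<le> 1 / 2 * norm (x - y) \<longrightarrow>
        cmod (K x y - K x' y) + cmod (K y x - K y x')
          \<le> 1 / norm (x - y) ^ CARD('n) * \<omega> (norm (x - x') / norm (x - y)))"

definition linear_ae_on ::
  "(real ^ 'n \<Rightarrow> complex) set \<Rightarrow> ((real ^ 'n \<Rightarrow> complex) \<Rightarrow> real ^ 'n \<Rightarrow> complex) \<Rightarrow> bool" where
  "linear_ae_on D T \<longleftrightarrow>
     (\<forall>f\<in>D. \<forall>g\<in>D. AE x in lebesgue. T (\<lambda>y. f y + g y) x = T f x + T g x) \<and>
     (\<forall>f\<in>D. \<forall>c. AE x in lebesgue. T (\<lambda>y. c * f y) x = c * T f x)"

text \<open>Linearity and boundedness imply that \<open>T\<close> respects almost everywhere equality.\<close>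

definition bounded_on_Ls ::
  "real \<Rightarrow> ((real ^ 'n \<Rightarrow> complex) \<Rightarrow> real ^ 'n \<Rightarrow> complex) \<Rightarrow> bool" where
  "bounded_on_Ls s T \<longleftrightarrow>
     linear_ae_on (Lp_space s (\<lambda>_. 1)) T \<and>
     (\<forall>f\<in>Lp_space s (\<lambda>_. 1). T f \<in> borel_measurable lebesgue) \<and>
     (\<exists>C. \<forall>f\<in>Lp_space s (\<lambda>_. 1).
        Lp_norm s (\<lambda>_. 1) (T f) \<le> ennreal C * Lp_norm s (\<lambda>_. 1) f)"

definition cz_operator ::
  "(real \<Rightarrow> real) \<Rightarrow> ((real ^ 'n \<Rightarrow> complex) \<Rightarrow> real ^ 'n \<Rightarrow> complex) \<Rightarrow> bool" where
  "cz_operator \<omega> T \<longleftrightarrow>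
     (\<exists>s>1. bounded_on_Ls s T) \<and>
     (\<exists>K. cz_kernel \<omega> K \<and>
        (\<forall>f\<in>Linf_c. AE x in lebesgue. x \<notin> closure {y. f y \<noteq> 0} \<longrightarrow>
           T f x = (\<integral>y. K x y * f y \<partial>lebesgue)))"

subsection \<open>The extension to integrable functions and commutators\<close>

text \<open>Since \<open>Linf_c\<close> is dense in \<open>L\<^sup>1\<close>, a bounded extension \<open>S\<close> of \<open>T\<close> from \<open>L\<^sup>1\<close> to weak \<open>L\<^sup>1\<close> is unique
  up to null sets.\<close>

definition weak_L1_extension ::
  "((real ^ 'n \<Rightarrow> complex) \<Rightarrow> real ^ 'n \<Rightarrow> complex) \<Rightarrow>
   ((real ^ 'n \<Rightarrow> complex) \<Rightarrow> real ^ 'n \<Rightarrow> complex) \<Rightarrow> bool" where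
  "weak_L1_extension T S \<longleftrightarrow>
     (\<forall>f\<in>Linf_c. AE x in lebesgue. S f x = T f x) \<and>
     linear_ae_on (Lp_space 1 (\<lambda>_. 1)) S \<and>
     (\<forall>f\<in>Lp_space 1 (\<lambda>_. 1). S f \<in> borel_measurable lebesgue) \<and>
     (\<exists>C. \<forall>f\<in>Lp_space 1 (\<lambda>_. 1). \<forall>t>0.
        ennreal t * emeasure lebesgue {x. t < cmod (S f x)} \<le> ennreal C * Lp_norm 1 (\<lambda>_. 1) f)"

definition L1_ext ::
  "((real ^ 'n \<Rightarrow> complex) \<Rightarrow> real ^ 'n \<Rightarrow> complex) \<Rightarrow>
   ((real ^ 'n \<Rightarrow> complex) \<Rightarrow> real ^ 'n \<Rightarrow> complex)" where
  "L1_ext T = (SOME S. weak_L1_extension T S)"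

text \<open>For \<open>f\<close> in \<open>Linf_c\<close> and locally integrable \<open>b\<close>, the product \<open>b f\<close> is only known to be in \<open>L\<^sup>1\<close>.\<close>

definition commutator ::
  "(real ^ 'n \<Rightarrow> complex) \<Rightarrow> ((real ^ 'n \<Rightarrow> complex) \<Rightarrow> real ^ 'n \<Rightarrow> complex) \<Rightarrow>
   (real ^ 'n \<Rightarrow> complex) \<Rightarrow> real ^ 'n \<Rightarrow> complex" where
  "commutator b T f = (\<lambda>x. b x * T f x - L1_ext T (\<lambda>y. b y * f y) x)"

end

theory Submission
  imports Defs
begin

text \<open>
  The commutator is defined through the extension \<open>S\<close> of \<open>T\<close> to \<open>L\<^sup>1\<close>, whose existence is the weak
  (1,1) estimate. For dyadic step functions the stopping time of the Calderon-Zygmund decomposition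
  runs through finitely many cubes, so no differentiation theorem is needed; step functions are then
  dense in \<open>L\<^sup>1\<close> and \<open>L\<^sup>s\<close> simultaneously.

  (i) \<open>[b, T] f = (b - c) T f - S ((b - c) f)\<close>. The first term is bounded directly, the second one by
  truncating \<open>(b - c) f\<close> and Fatou's lemma. The finiteness of the weighted norms of \<open>T\<close> is never used:
  if one of them is infinite, only the case of a vanishing infimum is left, and then \<open>b\<close> is constant.

  (ii) Let \<open>\<mu> = 1\<close>, \<open>\<nu> = \<bar>x\<bar>\<^bsup>-d \<theta>\<^esup>\<close> with \<open>\<theta> = 1 - q / p\<close>, and let \<open>b\<close> be the indicator of the unit ball.
  Multiplication by a constant on a shell around the origin has norm comparable to a power of the
  logarithm of the ratio of the radii, so \<open>b - c\<close> is unbounded near \<open>0\<close> unless \<open>c = 1\<close>, and near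
  infinity unless \<open>c = 0\<close>. The commutator only sees the kernel across the unit sphere, where \<open>q < p\<close>
  leaves room to pay with a small power of the distance to the sphere.
\<close>

section \<open>Hoelder and Minkowski inequalities\<close>

text \<open>All norms live in [0,\<infinity>] with \<open>0 * top = 0\<close>, and this convention
  makes the degenerate cases of (i) delicate. The constant in (i) is exactly a sum of two norms.
  Splitting level sets in weak L1 loses a factor 2 each time, so weak L1 may only serve to identify
  a pointwise limit; the bound itself has to come from Fatou and from Minkowski with constant 1. The
  exponent \<theta> = 1 - q/p serves two purposes. On a shell, the function |x|^(-d/p) has p-th
  power |x|^(-d), and its q-th power times the weight |x|^(-d \<theta>) is again |x|^(-d); so the
  two norms are the powers 1/p and 1/q of one and the same logarithm. In the commutator estimate,
  q/p + \<theta> = 1 makes q/p and \<theta> a pair of Hoelder exponents: the share q/p carries f and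
  the share \<theta> carries the singularity at the unit sphere. For q = p nothing would be left for
  the singularity. Distances to a centre are measured by their d-th power, since in that variable
  Lebesgue measure becomes a multiple of length on the half-line.\<close>

lemma epowr_mono: "x \<le> y \<Longrightarrow> 0 < r \<Longrightarrow> epowr x r \<le> epowr y r"
  unfolding epowr_def
  by (auto intro!: ennreal_leI powr_mono2 enn2real_mono simp: top_unique less_top)

lemma epowr_ennreal [simp]: "0 \<le> x \<Longrightarrow> epowr (ennreal x) r = ennreal (x powr r)"
  by (simp add: epowr_def)

lemma epowr_top [simp]: "epowr top r = top"
  by (simp add: epowr_def)

lemma epowr_0 [simp]: "epowr 0 r = 0"
  by (simp add: epowr_def)

lemma epowr_1 [simp]: "epowr x 1 = x"
  by (cases x) (auto simp: epowr_def)

lemma epowr_eq_0_iff [simp]: "epowr x r = 0 \<longleftrightarrow> x = 0"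
  by (cases x) (auto simp: epowr_def)

lemma epowr_eq_top_iff [simp]: "epowr x r = top \<longleftrightarrow> x = top"
  by (cases x) (auto simp: epowr_def)

lemma epowr_less_top_iff [simp]: "epowr x r < top \<longleftrightarrow> x < top"
  by (simp add: less_top[symmetric])

lemma epowr_epowr: "epowr (epowr x a) b = epowr x (a * b)"
  by (cases x) (auto simp: powr_powr)

lemma epowr_mult: "epowr (x * y) r = epowr x r * epowr y r"
proof (cases x; cases y)
  fix a b assume "0 \<le> a" "x = ennreal a" "0 \<le> b" "y = ennreal b"
  then show ?thesis by (simp add: ennreal_mult'[symmetric] powr_mult)
qed (auto simp: ennreal_mult_top ennreal_top_mult)

lemma epowr_add: "epowr x a * epowr x b = epowr x (a + b)" if "0 < a" "0 < b"
  by (cases x) (auto simp: powr_add ennreal_mult' top_unique)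

lemma conj_exponent_gt_1: "1 < p \<Longrightarrow> 1 < conj_exponent p"
  by (simp add: conj_exponent_def)

lemma Lp_norm_le_iff:
  assumes "0 < p" "0 \<le> N"
  shows "Lp_norm p w f \<le> ennreal N \<longleftrightarrow>
    (\<integral>\<^sup>+x. ennreal (cmod (f x) powr p * w x) \<partial>lebesgue) \<le> ennreal (N powr p)"
    (is "_ \<longleftrightarrow> ?I \<le> _")
proof
  assume "Lp_norm p w f \<le> ennreal N"
  then have "epowr (epowr ?I (1/p)) p \<le> epowr (ennreal N) p"
    unfolding Lp_norm_def using assms by (intro epowr_mono)
  with assms show "?I \<le> ennreal (N powr p)" by (simp add: epowr_epowr)
next
  assume "?I \<le> ennreal (N powr p)"
  then have "epowr ?I (1/p) \<le> epowr (ennreal (N powr p)) (1/p)"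
    using assms by (intro epowr_mono) auto
  with assms show "Lp_norm p w f \<le> ennreal N" by (simp add: Lp_norm_def powr_powr)
qed

text \<open>Convexity of \<open>t powr p\<close> between the points \<open>x / a\<close> and
  \<open>y / b\<close> with weights \<open>a / (a + b)\<close> and \<open>b / (a + b)\<close>. If
  one of the points is 0, only \<open>t powr p \<le> t\<close> for the weight
  \<open>t \<le> 1\<close> of the other one is left.\<close>

lemma powr_convex_nonneg:
  fixes a b x y p :: real
  assumes "1 \<le> p" "0 < a" "0 < b" "0 \<le> x" "0 \<le> y"
  shows "((x + y) / (a + b)) powr p \<le> a / (a + b) * (x / a) powr p + b / (a + b) * (y / b) powr p"
proof -
  have le1: "t powr p \<le> t" if "0 \<le> t" "t \<le> 1" for t :: real
    using powr_mono'[of 1 p t] that assms by simp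
  consider "x = 0" | "y = 0" | "0 < x" "0 < y" using assms by linarith
  then show ?thesis
  proof cases
    case 1
    have "(y / (a + b)) powr p = (b / (a + b) * (y / b)) powr p" using assms by simp
    also have "\<dots> = (b / (a + b)) powr p * (y / b) powr p" using assms by (subst powr_mult) auto
    also have "\<dots> \<le> b / (a + b) * (y / b) powr p"
      using assms by (intro mult_right_mono le1) auto
    finally show ?thesis using 1 by simp
  next
    case 2
    have "(x / (a + b)) powr p = (a / (a + b) * (x / a)) powr p" using assms by simp
    also have "\<dots> = (a / (a + b)) powr p * (x / a) powr p" using assms by (subst powr_mult) auto
    also have "\<dots> \<le> a / (a + b) * (x / a) powr p"
      using assms by (intro mult_right_mono le1) auto
    finally show ?thesis using 2 by simp
  next
    case 3
    define t where "t = b / (a + b)"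
    have t: "0 \<le> t" "t \<le> 1" "a / (a + b) = 1 - t"
      using assms by (auto simp: t_def field_simps)
    have "(1 - t) * (x / a) + t * (y / b) = (x + y) / (a + b)"
      using assms unfolding t(3)[symmetric] by (simp add: t_def add_divide_distrib)
    moreover have "((1 - t) * (x / a) + t * (y / b)) powr p \<le> (1 - t) * (x / a) powr p + t * (y / b) powr p"
      using convex_onD[OF powr_convex[OF assms(1)], of t "x/a" "y/b"] t assms 3 by simp
    ultimately show ?thesis unfolding t(3) t_def[symmetric] by simp
  qed
qed

text \<open>By convexity instead of duality: for positive upper bounds a and b of the two norms, f +
  g is a + b times a convex combination of f / a and g / b. Upper bounds in place of the norms admit
  the norm 0, at the price of the epsilon at the end.\<close>

lemma Lp_norm_triangle:
  assumes p: "1 \<le> p" and w: "\<And>x. 0 \<le> w x"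
    and [measurable]: "w \<in> borel_measurable lebesgue" "f \<in> borel_measurable lebesgue" "g \<in> borel_measurable lebesgue"
  shows "Lp_norm p w (\<lambda>x. f x + g x) \<le> Lp_norm p w f + Lp_norm p w g"
proof -
  have key: "Lp_norm p w (\<lambda>x. f x + g x) \<le> ennreal (a + b)"
    if ab: "0 < a" "0 < b" "Lp_norm p w f \<le> ennreal a" "Lp_norm p w g \<le> ennreal b" for a b
  proof -
    have F: "(\<integral>\<^sup>+x. ennreal (cmod (f x) powr p * w x) \<partial>lebesgue) \<le> ennreal (a powr p)"
      using Lp_norm_le_iff[of p a w f] ab p by simp
    have G: "(\<integral>\<^sup>+x. ennreal (cmod (g x) powr p * w x) \<partial>lebesgue) \<le> ennreal (b powr p)"
      using Lp_norm_le_iff[of p b w g] ab p by simp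
    define A where "A = (a + b) powr p * (a / (a + b)) / a powr p"
    define B where "B = (a + b) powr p * (b / (a + b)) / b powr p"
    have nn: "0 \<le> A" "0 \<le> B" using ab by (auto simp: A_def B_def)
    have pt: "cmod (f x + g x) powr p * w x \<le> A * (cmod (f x) powr p * w x) + B * (cmod (g x) powr p * w x)" for x
    proof -
      have "cmod (f x + g x) powr p \<le> (cmod (f x) + cmod (g x)) powr p"
        using p by (intro powr_mono2 norm_triangle_ineq) auto
      also have "\<dots> = (a + b) powr p * ((cmod (f x) + cmod (g x)) / (a + b)) powr p"
        using ab by (simp add: powr_divide)
      also have "\<dots> \<le> (a + b) powr p * (a / (a + b) * (cmod (f x) / a) powr p + b / (a + b) * (cmod (g x) / b) powr p)"
        by (intro mult_left_mono powr_convex_nonneg) (use p ab in auto)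
      also have "\<dots> = A * cmod (f x) powr p + B * cmod (g x) powr p"
        using ab by (simp add: A_def B_def powr_divide algebra_simps)
      finally have "cmod (f x + g x) powr p \<le> A * cmod (f x) powr p + B * cmod (g x) powr p" .
      from mult_right_mono[OF this w[of x]] show ?thesis by (simp add: algebra_simps)
    qed
    have "(\<integral>\<^sup>+x. ennreal (cmod (f x + g x) powr p * w x) \<partial>lebesgue)
      \<le> (\<integral>\<^sup>+x. ennreal A * ennreal (cmod (f x) powr p * w x) + ennreal B * ennreal (cmod (g x) powr p * w x) \<partial>lebesgue)"
      using pt nn w by (intro nn_integral_mono)
         (simp add: ennreal_mult'[symmetric] ennreal_plus[symmetric] del: ennreal_plus)
    also have "\<dots> = ennreal A * (\<integral>\<^sup>+x. ennreal (cmod (f x) powr p * w x) \<partial>lebesgue)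
       + ennreal B * (\<integral>\<^sup>+x. ennreal (cmod (g x) powr p * w x) \<partial>lebesgue)"
      by (subst nn_integral_add) (auto simp: nn_integral_cmult)
    also have "\<dots> \<le> ennreal A * ennreal (a powr p) + ennreal B * ennreal (b powr p)"
      using F G by (intro add_mono mult_left_mono) auto
    also have "\<dots> = ennreal (A * a powr p + B * b powr p)"
      using nn by (simp add: ennreal_mult')
    also have "A * a powr p + B * b powr p = (a + b) powr p * (a / (a + b)) + (a + b) powr p * (b / (a + b))"
      using ab by (simp add: A_def B_def)
    also have "\<dots> = (a + b) powr p * ((a + b) / (a + b))"
      unfolding add_divide_distrib by (simp only: distrib_left)
    also have "\<dots> = (a + b) powr p" using ab by simp
    finally show ?thesis using Lp_norm_le_iff[of p "a + b" w] ab p by simp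
  qed
  show ?thesis
  proof (cases "Lp_norm p w f = top \<or> Lp_norm p w g = top")
    case False
    then obtain a b where ab: "Lp_norm p w f = ennreal a" "Lp_norm p w g = ennreal b" "0 \<le> a" "0 \<le> b"
      by (metis ennreal_cases)
    show ?thesis
    proof (rule ennreal_le_epsilon)
      fix e :: real assume "0 < e"
      have "Lp_norm p w (\<lambda>x. f x + g x) \<le> ennreal ((a + e/2) + (b + e/2))"
        by (rule key) (use ab \<open>0 < e\<close> in auto)
      also have "\<dots> = Lp_norm p w f + Lp_norm p w g + ennreal e"
        using ab \<open>0 < e\<close> by (simp flip: ennreal_plus add: algebra_simps)
      finally show "Lp_norm p w (\<lambda>x. f x + g x) \<le> Lp_norm p w f + Lp_norm p w g + ennreal e" .
    qed
  qed auto
qed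

lemma epowr_measurable [measurable]:
  assumes [measurable]: "f \<in> borel_measurable M"
  shows "(\<lambda>x. epowr (f x) r) \<in> borel_measurable M"
  unfolding epowr_def by measurable

lemma Holder_nn_integral:
  fixes u v :: "'a \<Rightarrow> ennreal"
  assumes \<alpha>: "0 < \<alpha>" "0 < \<beta>" "\<alpha> + \<beta> = 1"
    and [measurable]: "u \<in> borel_measurable M" "v \<in> borel_measurable M"
  shows "(\<integral>\<^sup>+x. epowr (u x) \<alpha> * epowr (v x) \<beta> \<partial>M) \<le> epowr (\<integral>\<^sup>+x. u x \<partial>M) \<alpha> * epowr (\<integral>\<^sup>+x. v x \<partial>M) \<beta>"
    (is "?I \<le> epowr ?U _ * epowr ?V _")
proof -
  have zero: "?I = 0" if "?U = 0 \<or> ?V = 0"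
  proof -
    from that have "(AE x in M. u x = 0) \<or> (AE x in M. v x = 0)"
      by (auto simp: nn_integral_0_iff_AE)
    then have "AE x in M. epowr (u x) \<alpha> * epowr (v x) \<beta> = 0"
      by (auto elim!: eventually_mono)
    then show ?thesis by (subst nn_integral_0_iff_AE) auto
  qed
  consider "?U = 0 \<or> ?V = 0" | "?U \<noteq> 0" "?V \<noteq> 0" "?U = top \<or> ?V = top" | "?U \<noteq> 0" "?V \<noteq> 0" "?U \<noteq> top" "?V \<noteq> top"
    by blast
  then show ?thesis
  proof cases
    case 1 then show ?thesis using zero by simp
  next
    case 2
    then have "epowr ?U \<alpha> * epowr ?V \<beta> = top" by (auto simp: ennreal_mult_eq_top_iff)
    then show ?thesis by simp
  next
    case 3
    define a b where "a = enn2real ?U" and "b = enn2real ?V"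
    have ab: "?U = ennreal a" "?V = ennreal b" "0 < a" "0 < b"
      using 3 by (auto simp: a_def b_def enn2real_positive_iff zero_less_iff_neq_zero less_top)
    \<comment> \<open>\<open>A * u + B * v\<close> is
      \<open>a powr \<alpha> * b powr \<beta>\<close> times the AM-GM bound
      \<open>\<alpha> * (u / a) + \<beta> * (v / b)\<close>, and the latter integrates to
      \<open>\<alpha> + \<beta> = 1\<close>.\<close>
    define A where "A = a powr \<alpha> * b powr \<beta> * \<alpha> / a"
    define B where "B = a powr \<alpha> * b powr \<beta> * \<beta> / b"
    have pos: "0 < A" "0 < B" using ab \<alpha> by (auto simp: A_def B_def)
    have pt: "epowr (u x) \<alpha> * epowr (v x) \<beta> \<le> ennreal A * u x + ennreal B * v x" for x
    proof (cases "u x = top \<or> v x = top")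
      case True
      then have "ennreal A * u x + ennreal B * v x = top" using pos by (auto simp: ennreal_mult_top)
      then show ?thesis by (metis top_greatest)
    next
      case False
      then obtain y z where yz: "u x = ennreal y" "v x = ennreal z" "0 \<le> y" "0 \<le> z"
        by (cases "u x"; cases "v x") auto
      have "y powr \<alpha> * z powr \<beta> \<le> A * y + B * z"
      proof (cases "y = 0 \<or> z = 0")
        case True
        then show ?thesis using yz pos \<alpha> by auto
      next
        case False
        then have "(y / a) powr \<alpha> * (z / b) powr \<beta> \<le> \<alpha> * (y / a) + \<beta> * (z / b)"
          using yz ab \<alpha> by (intro Youngs_inequality_0) auto
        then have "a powr \<alpha> * b powr \<beta> * ((y / a) powr \<alpha> * (z / b) powr \<beta>) \<le> a powr \<alpha> * b powr \<beta> * (\<alpha> * (y / a) + \<beta> * (z / b))"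
          by (intro mult_left_mono) auto
        moreover have "a powr \<alpha> * b powr \<beta> * ((y / a) powr \<alpha> * (z / b) powr \<beta>) = y powr \<alpha> * z powr \<beta>"
          using ab yz by (simp add: powr_divide)
        moreover have "a powr \<alpha> * b powr \<beta> * (\<alpha> * (y / a) + \<beta> * (z / b)) = A * y + B * z"
          by (simp add: A_def B_def algebra_simps)
        ultimately show ?thesis by simp
      qed
      then show ?thesis using yz pos
        by (simp add: ennreal_mult[symmetric] ennreal_plus[symmetric] del: ennreal_plus)
    qed
    have "?I \<le> (\<integral>\<^sup>+x. ennreal A * u x + ennreal B * v x \<partial>M)" by (intro nn_integral_mono pt)
    also have "\<dots> = ennreal A * ?U + ennreal B * ?V"
      by (subst nn_integral_add) (auto simp: nn_integral_cmult)
    also have "\<dots> = ennreal (A * a + B * b)"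
      using ab pos by (simp add: ennreal_mult)
    also have "A * a + B * b = a powr \<alpha> * b powr \<beta> * (\<alpha> + \<beta>)"
      using ab by (simp add: A_def B_def algebra_simps)
    finally show ?thesis using ab \<alpha> by (simp add: ennreal_mult)
  qed
qed

lemma norm_integral_le_nn_integral:
  fixes f :: "'a \<Rightarrow> 'b::{banach, second_countable_topology}"
  shows "ennreal (norm (integral\<^sup>L M f)) \<le> (\<integral>\<^sup>+x. ennreal (norm (f x)) \<partial>M)"
  by (cases "integrable M f") (auto intro: integral_norm_bound_ennreal simp: not_integrable_integral_eq)

section \<open>Radial integrals\<close>

text \<open>A ball of radius r has volume proportional to r^d, so taking the d-th power of the
  distance as variable absorbs the Jacobian of polar coordinates. Both measures are compared on
  half-lines, a generator closed under intersection.\<close>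

lemma distr_norm_power:
  fixes c :: "real ^ 'n"
  shows "distr lborel borel (\<lambda>x. norm (x - c) ^ CARD('n)) =
    density lborel (\<lambda>u. ennreal (unit_ball_vol (real CARD('n))) * indicator {0<..} u)"
    (is "?M = ?N")
proof -
  let ?V = "unit_ball_vol (real CARD('n))"
  let ?E = "range (\<lambda>a::real. {..a})"
  have M: "emeasure ?M {..a} = ennreal (?V * max 0 a)" for a :: real
  proof -
    have "emeasure ?M {..a} = emeasure lborel {x::real^'n. norm (x - c) ^ CARD('n) \<le> a}"
      by (subst emeasure_distr) (auto simp: vimage_def)
    also have "\<dots> = ennreal (?V * max 0 a)"
    proof (cases "a < 0")
      case True
      then have "{x::real^'n. norm (x - c) ^ CARD('n) \<le> a} = {}"
        by (auto simp: not_le intro: less_le_trans)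
      with True show ?thesis by simp
    next
      case False
      then have *: "norm (x - c) ^ CARD('n) \<le> a \<longleftrightarrow> norm (x - c) \<le> root CARD('n) a" for x
        using real_root_le_iff[of "CARD('n)" "norm (x - c) ^ CARD('n)" a]
        by (simp add: real_root_power_cancel)
      have "{x::real^'n. norm (x - c) ^ CARD('n) \<le> a} = cball c (root CARD('n) a)"
        unfolding * by (simp add: set_eq_iff mem_cball dist_norm norm_minus_commute[of c])
      then show ?thesis using False by (simp add: emeasure_cball)
    qed
    finally show ?thesis .
  qed
  have N: "emeasure ?N {..a} = ennreal (?V * max 0 a)" for a :: real
  proof -
    have "emeasure ?N {..a} = (\<integral>\<^sup>+u. ennreal ?V * indicator {0<..a} u \<partial>lborel)"
      by (subst emeasure_density) (auto intro!: nn_integral_cong simp: indicator_def)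
    also have "\<dots> = ennreal ?V * emeasure lborel {0<..a}"
      by (subst nn_integral_cmult_indicator) auto
    also have "\<dots> = ennreal (?V * max 0 a)"
      by (cases "0 \<le> a") (auto simp: ennreal_mult')
    finally show ?thesis .
  qed
  show ?thesis
  proof (rule measure_eqI_generator_eq[where E = ?E and \<Omega> = UNIV and A = "\<lambda>i. {..real i}"])
    show "Int_stable ?E"
      by (auto simp: Int_stable_def)
    show "sets ?M = sigma_sets UNIV ?E" by (simp add: borel_eq_atMost)
    show "sets ?N = sigma_sets UNIV ?E" using sets_density by (simp add: borel_eq_atMost)
    show "(\<Union>i. {..real i}) = UNIV"
      using real_arch_simple by auto
  qed (auto simp: M N)
qed

lemma nn_integral_radial:
  fixes c :: "real ^ 'n"
  assumes [measurable]: "\<phi> \<in> borel_measurable borel"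
  shows "(\<integral>\<^sup>+x. \<phi> (norm (x - c) ^ CARD('n)) \<partial>lebesgue) =
    ennreal (unit_ball_vol (real CARD('n))) * (\<integral>\<^sup>+u. \<phi> u * indicator {0<..} u \<partial>lborel)"
proof -
  have "(\<integral>\<^sup>+x. \<phi> (norm (x - c) ^ CARD('n)) \<partial>lebesgue) =
     (\<integral>\<^sup>+u. \<phi> u \<partial>distr lborel borel (\<lambda>x. norm (x - c) ^ CARD('n)))"
    by (subst nn_integral_distr) (auto simp: nn_integral_completion)
  also have "\<dots> = (\<integral>\<^sup>+u. ennreal (unit_ball_vol (real CARD('n))) * (\<phi> u * indicator {0<..} u) \<partial>lborel)"
    unfolding distr_norm_power
    by (subst nn_integral_density) (auto simp: ac_simps)
  also have "\<dots> = ennreal (unit_ball_vol (real CARD('n))) * (\<integral>\<^sup>+u. \<phi> u * indicator {0<..} u \<partial>lborel)"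
    by (rule nn_integral_cmult) simp
  finally show ?thesis .
qed

lemma nn_integral_norm_powr_ball:
  fixes c :: "real ^ 'n"
  assumes "-1 < e" "0 \<le> R"
  shows "(\<integral>\<^sup>+x. ennreal ((norm (x - c) ^ CARD('n)) powr e) * indicator {x. norm (x - c) ^ CARD('n) \<le> R} x \<partial>lebesgue)
     = ennreal (unit_ball_vol (real CARD('n)) * R powr (e + 1) / (e + 1))"
proof -
  have "(\<integral>\<^sup>+x. ennreal ((norm (x - c) ^ CARD('n)) powr e) * indicator {x. norm (x - c) ^ CARD('n) \<le> R} x \<partial>lebesgue) =
    (\<integral>\<^sup>+x. (\<lambda>u. ennreal (u powr e) * indicator {..R} u) (norm (x - c) ^ CARD('n)) \<partial>lebesgue)"
    by (intro nn_integral_cong) (auto simp: indicator_def)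
  also have "\<dots> = ennreal (unit_ball_vol (real CARD('n))) * (\<integral>\<^sup>+u. ennreal (u powr e) * indicator {..R} u * indicator {0<..} u \<partial>lborel)"
    by (rule nn_integral_radial) simp
  also have "(\<integral>\<^sup>+u. ennreal (u powr e) * indicator {..R} u * indicator {0<..} u \<partial>lborel) =
    (\<integral>\<^sup>+u. ennreal (u powr e) * indicator {0..R} u \<partial>lborel)"
    by (intro nn_integral_cong) (auto simp: indicator_def)
  also have "\<dots> = ennreal (R powr (e + 1) / (e + 1))"
    by (rule nn_integral_has_integral_lebesgue'[OF _ has_integral_powr_from_0]) (use assms in auto)
  finally show ?thesis using assms by (simp add: ennreal_mult'[symmetric])
qed

lemma nn_integral_norm_powr_outside:
  fixes c :: "real ^ 'n"
  assumes "e < -1" "0 < R"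
  shows "(\<integral>\<^sup>+x. ennreal ((norm (x - c) ^ CARD('n)) powr e) * indicator {x. R \<le> norm (x - c) ^ CARD('n)} x \<partial>lebesgue)
     = ennreal (unit_ball_vol (real CARD('n)) * R powr (e + 1) / (- e - 1))"
proof -
  have "(\<integral>\<^sup>+x. ennreal ((norm (x - c) ^ CARD('n)) powr e) * indicator {x. R \<le> norm (x - c) ^ CARD('n)} x \<partial>lebesgue) =
    (\<integral>\<^sup>+x. (\<lambda>u. ennreal (u powr e) * indicator {R..} u) (norm (x - c) ^ CARD('n)) \<partial>lebesgue)"
    by (intro nn_integral_cong) (auto simp: indicator_def)
  also have "\<dots> = ennreal (unit_ball_vol (real CARD('n))) * (\<integral>\<^sup>+u. ennreal (u powr e) * indicator {R..} u * indicator {0<..} u \<partial>lborel)"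
    by (rule nn_integral_radial) simp
  also have "(\<integral>\<^sup>+u. ennreal (u powr e) * indicator {R..} u * indicator {0<..} u \<partial>lborel) =
    (\<integral>\<^sup>+u. ennreal (u powr e) * indicator {R..} u \<partial>lborel)"
    using assms by (intro nn_integral_cong) (auto simp: indicator_def)
  also have "\<dots> = ennreal (- (R powr (e + 1)) / (e + 1))"
    by (rule nn_integral_has_integral_lebesgue'[OF _ has_integral_powr_to_inf]) (use assms in auto)
  also have "- (R powr (e + 1)) / (e + 1) = R powr (e + 1) / (- e - 1)"
    using assms by (simp add: field_simps)
  finally show ?thesis using assms by (simp add: ennreal_mult'[symmetric])
qed

lemma nn_integral_norm_inverse_shell:
  assumes "0 < s" "s \<le> t"
  shows "(\<integral>\<^sup>+x. ennreal (1 / (norm (x::real^'n) ^ CARD('n))) * indicator {x. s \<le> norm x ^ CARD('n) \<and> norm x ^ CARD('n) \<le> t} x \<partial>lebesgue)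
     = ennreal (unit_ball_vol (real CARD('n)) * (ln t - ln s))"
proof -
  have "(\<integral>\<^sup>+x. ennreal (1 / (norm (x::real^'n) ^ CARD('n))) * indicator {x. s \<le> norm x ^ CARD('n) \<and> norm x ^ CARD('n) \<le> t} x \<partial>lebesgue) =
    (\<integral>\<^sup>+x. (\<lambda>u. ennreal (1 / u) * indicator {s..t} u) (norm (x - (0::real^'n)) ^ CARD('n)) \<partial>lebesgue)"
    by (intro nn_integral_cong) (auto simp: indicator_def)
  also have "\<dots> = ennreal (unit_ball_vol (real CARD('n))) * (\<integral>\<^sup>+u. ennreal (1 / u) * indicator {s..t} u * indicator {0<..} u \<partial>lborel)"
    by (rule nn_integral_radial) simp
  also have "(\<integral>\<^sup>+u. ennreal (1 / u) * indicator {s..t} u * indicator {0<..} u \<partial>lborel) =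
    (\<integral>\<^sup>+u. ennreal (1 / u) * indicator {s..t} u \<partial>lborel)"
    using assms by (intro nn_integral_cong) (auto simp: indicator_def)
  also have "\<dots> = ennreal (ln t - ln s)"
    by (rule nn_integral_FTC_Icc) (use assms in \<open>auto intro!: derivative_eq_intros\<close>)
  finally show ?thesis by (simp add: ennreal_mult')
qed

text \<open>In the variable \<open>u\<close>, the d-th power of the norm, the unit sphere is the
  single point 1, and the exponent -1/2 is above the critical -1. Reflection reduces both sides of
  that point to the same integral.\<close>

lemma nn_integral_norm_sphere_singularity:
  assumes "0 < R"
  shows "(\<integral>\<^sup>+x. ennreal (\<bar>norm (x::real^'n) ^ CARD('n) - 1\<bar> powr (-1/2)) * indicator {x. norm x ^ CARD('n) \<le> R} x \<partial>lebesgue) < top"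
proof -
  let ?f = "\<lambda>v::real. ennreal (\<bar>v\<bar> powr (-1/2)) * indicator {-(R+1)..R+1} v"
  let ?g = "\<lambda>v::real. ennreal (v powr (-1/2)) * indicator {0..R+1} v"
  have g: "(\<integral>\<^sup>+u. ?g u \<partial>lborel) = ennreal ((R+1) powr (1/2) / (1/2))"
    using nn_integral_has_integral_lebesgue'[OF _ has_integral_powr_from_0[of "-1/2" "R+1"]] assms by simp
  have g': "(\<integral>\<^sup>+u. ?g (- u) \<partial>lborel) = (\<integral>\<^sup>+u. ?g u \<partial>lborel)"
    by (subst lborel_distr_uminus[symmetric], subst nn_integral_distr) auto
  have "(\<integral>\<^sup>+x. ennreal (\<bar>norm (x::real^'n) ^ CARD('n) - 1\<bar> powr (-1/2)) * indicator {x. norm x ^ CARD('n) \<le> R} x \<partial>lebesgue) =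
    (\<integral>\<^sup>+x. (\<lambda>u. ennreal (\<bar>u - 1\<bar> powr (-1/2)) * indicator {..R} u) (norm (x - (0::real^'n)) ^ CARD('n)) \<partial>lebesgue)"
    by (intro nn_integral_cong) (auto simp: indicator_def)
  also have "\<dots> = ennreal (unit_ball_vol (real CARD('n))) * (\<integral>\<^sup>+u. ennreal (\<bar>u - 1\<bar> powr (-1/2)) * indicator {..R} u * indicator {0<..} u \<partial>lborel)"
    by (rule nn_integral_radial) simp
  also have "\<dots> < top"
  proof -
    have "(\<integral>\<^sup>+u. ennreal (\<bar>u - 1\<bar> powr (-1/2)) * indicator {..R} u * indicator {0<..} u \<partial>lborel) \<le>
       (\<integral>\<^sup>+u. ?f (-1 + u) \<partial>lborel)"
      using assms by (intro nn_integral_mono) (auto simp: indicator_def)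
    also have "\<dots> = (\<integral>\<^sup>+u. ?f u \<partial>lborel)"
      by (subst (2) lborel_distr_plus[symmetric, of "-1"], subst nn_integral_distr) auto
    also have "\<dots> \<le> (\<integral>\<^sup>+u. ?g u + ?g (- u) \<partial>lborel)"
      by (intro nn_integral_mono) (auto simp: indicator_def abs_if)
    also have "\<dots> = (\<integral>\<^sup>+u. ?g u \<partial>lborel) + (\<integral>\<^sup>+u. ?g (-u) \<partial>lborel)"
      by (rule nn_integral_add) auto
    also have "\<dots> < top" unfolding g' g by simp
    finally show ?thesis by (simp add: ennreal_mult_less_top)
  qed
  finally show ?thesis .
qed

section \<open>The Dini condition and sums over dyadic shells\<close>

lemma real_dyadic_interval:
  fixes y :: real
  assumes "1 \<le> y"
  obtains k :: nat where "2 ^ k \<le> y" "y < 2 ^ Suc k"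
proof -
  have "\<exists>n. y < 2 ^ n" using real_arch_pow[of 2 y] by auto
  define n where "n = (LEAST n. y < 2 ^ n)"
  have n: "y < 2 ^ n" unfolding n_def by (rule LeastI_ex) fact
  have "n \<noteq> 0" using n assms by (intro notI) simp
  then obtain k where k: "n = Suc k" by (cases n) auto
  have "\<not> y < 2 ^ k" using not_less_Least[of k "\<lambda>n. y < 2 ^ n"] k unfolding n_def by simp
  with n k that[of k] show ?thesis by auto
qed

lemma ennreal_le_suminf: "f k \<le> (\<Sum>k. f k)" for f :: "nat \<Rightarrow> ennreal"
  using sum_le_suminf[of f "{k}"] by (simp add: summableI)

lemma modulus_of_continuity_nonneg: "modulus_of_continuity \<omega> \<Longrightarrow> 0 \<le> t \<Longrightarrow> 0 \<le> \<omega> t"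
  by (simp add: modulus_of_continuity_def)

lemma modulus_of_continuity_mono: "modulus_of_continuity \<omega> \<Longrightarrow> 0 \<le> s \<Longrightarrow> s \<le> t \<Longrightarrow> \<omega> s \<le> \<omega> t"
  by (auto simp: modulus_of_continuity_def intro: mono_onD)

text \<open>On the interval from 2^(-k-1) to 2^(-k), monotonicity gives
  \<open>\<omega> t / t\<close> at least 2^k times the value of \<open>\<omega>\<close> at the left
  end. The length 2^(-k-1) turns this into half of the k-th term, and the intervals are
  disjoint.\<close>

lemma dini_sum:
  assumes \<omega>: "modulus_of_continuity \<omega>"
  shows "(\<Sum>k. ennreal (\<omega> ((1/2) ^ Suc k))) \<le> 2 * (\<integral>\<^sup>+t\<in>{0<..1}. ennreal (\<omega> t / t) \<partial>lebesgue)"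
proof -
  note nn = modulus_of_continuity_nonneg[OF \<omega>] and mono = modulus_of_continuity_mono[OF \<omega>]
  let ?I = "\<lambda>k::nat. {(1/2) ^ Suc k<..(1/2::real) ^ k}"
  let ?c = "\<lambda>k::nat. ennreal (\<omega> ((1/2) ^ Suc k) * 2 ^ k)"
  have disj: "disjoint_family ?I"
  unfolding disjoint_family_on_def
  proof (intro ballI impI)
    have aux: "?I i \<inter> ?I j = {}" if "i < j" for i j
    proof -
      have "(1/2::real) ^ j \<le> (1/2) ^ Suc i" using that by (intro power_decreasing) auto
      then show ?thesis by auto
    qed
    fix i j :: nat assume "i \<noteq> j"
    then show "?I i \<inter> ?I j = {}" using aux[of i j] aux[of j i] by (cases "i < j") (auto simp: Int_commute)
  qed
  have pt: "(\<Sum>k. ?c k * indicator (?I k) t) \<le> ennreal (\<omega> t / t) * indicator {0<..1} t" for t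
  proof (cases "\<exists>k. t \<in> ?I k")
    case True
    then obtain k where k: "t \<in> ?I k" by blast
    have "0 < (1/2::real) ^ Suc k" by simp
    with k have t0: "0 < t" by auto
    have "(1/2::real) ^ k \<le> 1" by (simp add: power_le_one)
    with k have t1: "t \<le> 1" by auto
    have "\<omega> ((1/2) ^ Suc k) * 2 ^ k \<le> \<omega> t * (1 / t)"
    proof (rule mult_mono)
      show "\<omega> ((1/2) ^ Suc k) \<le> \<omega> t" using k by (intro mono) auto
      show "2 ^ k \<le> 1 / t" using k t0 by (simp add: field_simps power_divide)
    qed (use nn t0 in auto)
    moreover have "(\<Sum>k. ?c k * indicator (?I k) t) = ?c k"
      by (rule suminf_cmult_indicator[OF disj k])
    ultimately show ?thesis using t0 t1 by (simp add: ennreal_leI)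
  next
    case False
    then show ?thesis by simp
  qed
  have "(\<Sum>k. ennreal (\<omega> ((1/2) ^ Suc k))) = (\<Sum>k. 2 * (\<integral>\<^sup>+t. ?c k * indicator (?I k) t \<partial>lebesgue))"
  proof (intro suminf_cong)
    fix k
    have "(\<integral>\<^sup>+t. ?c k * indicator (?I k) t \<partial>lebesgue) = ?c k * ennreal ((1/2) ^ k - (1/2) ^ Suc k)"
      by (subst nn_integral_cmult_indicator) (auto simp: power_decreasing)
    also have "\<dots> = ennreal (\<omega> ((1/2) ^ Suc k) / 2)"
      using nn[of "(1/2) ^ Suc k"] by (simp add: ennreal_mult'[symmetric] field_simps power_divide)
    finally show "ennreal (\<omega> ((1/2) ^ Suc k)) = 2 * (\<integral>\<^sup>+t. ?c k * indicator (?I k) t \<partial>lebesgue)"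
      using nn[of "(1/2) ^ Suc k"] by (simp add: ennreal_mult'[symmetric] flip: ennreal_numeral)
  qed
  also have "\<dots> = 2 * (\<Sum>k. \<integral>\<^sup>+t. ?c k * indicator (?I k) t \<partial>lebesgue)"
    by simp
  also have "\<dots> = 2 * (\<integral>\<^sup>+t. (\<Sum>k. ?c k * indicator (?I k) t) \<partial>lebesgue)"
    by (subst nn_integral_suminf) (auto intro!: borel_measurable_times_ennreal borel_measurable_indicator)
  also have "\<dots> \<le> 2 * (\<integral>\<^sup>+t\<in>{0<..1}. ennreal (\<omega> t / t) \<partial>lebesgue)"
    by (intro mult_left_mono nn_integral_mono pt) auto
  finally show ?thesis .
qed

text \<open>On the k-th shell the distance to \<open>c\<close> lies between 2^(k+1) r and 2^(k+2) r.
  The size of the integrand is governed by the inner radius and the volume by the outer one; their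
  quotient leaves 2^d times the value of \<open>\<omega>\<close> at 2^(-k-1), independently of
  \<open>r\<close> and \<open>c\<close>. The last factor 2 is that of
  \<open>dini_sum\<close>.\<close>

lemma nn_integral_modulus_outside_ball:
  fixes c :: "real ^ 'n"
  assumes \<omega>: "modulus_of_continuity \<omega>" and r: "0 < r"
  shows "(\<integral>\<^sup>+x. ennreal (1 / norm (x - c) ^ CARD('n) * \<omega> (r / norm (x - c))) * indicator {x. 2 * r \<le> norm (x - c)} x \<partial>lebesgue)
    \<le> ennreal (unit_ball_vol (real CARD('n)) * 2 ^ CARD('n) * 2) * (\<integral>\<^sup>+t\<in>{0<..1}. ennreal (\<omega> t / t) \<partial>lebesgue)"
proof -
  note nn = modulus_of_continuity_nonneg[OF \<omega>] and mono = modulus_of_continuity_mono[OF \<omega>]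
  let ?V = "unit_ball_vol (real CARD('n))"
  let ?A = "\<lambda>k::nat. cball c (2 ^ (k+2) * r)"
  let ?c = "\<lambda>k::nat. 1 / (2 ^ (k+1) * r) ^ CARD('n) * \<omega> ((1/2) ^ Suc k)"
  have [measurable]: "?A k \<in> sets lebesgue" for k by simp
  have "(\<lambda>x. ennreal (?c k) * indicator (?A k) x) \<in> borel_measurable lebesgue" for k
    by measurable
  note [simp] = this[simplified]
  have pt: "ennreal (1 / norm (x - c) ^ CARD('n) * \<omega> (r / norm (x - c))) * indicator {x. 2 * r \<le> norm (x - c)} x
     \<le> (\<Sum>k. ennreal (?c k) * indicator (?A k) x)" for x
  proof (cases "2 * r \<le> norm (x - c)")
    case True
    then have "1 \<le> norm (x - c) / (2 * r)" using r by simp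
    then obtain k where k: "2 ^ k \<le> norm (x - c) / (2 * r)" "norm (x - c) / (2 * r) < 2 ^ Suc k"
      by (rule real_dyadic_interval)
    have k1: "2 ^ (k+1) * r \<le> norm (x - c)" using k r by (simp add: field_simps)
    have k2: "norm (x - c) \<le> 2 ^ (k+2) * r" using k r by (simp add: field_simps)
    have pos: "0 < 2 ^ (k+1) * r" "0 < norm (x - c)" using r True by auto
    have "1 / norm (x - c) ^ CARD('n) * \<omega> (r / norm (x - c)) \<le> ?c k"
    proof (rule mult_mono)
      show "1 / norm (x - c) ^ CARD('n) \<le> 1 / (2 ^ (k+1) * r) ^ CARD('n)"
        using k1 pos r by (intro divide_left_mono power_mono mult_pos_pos zero_less_power) auto
      show "\<omega> (r / norm (x - c)) \<le> \<omega> ((1/2) ^ Suc k)"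
        using k1 pos r by (intro mono) (auto simp: field_simps power_divide)
    qed (use nn r in auto)
    then have "ennreal (1 / norm (x - c) ^ CARD('n) * \<omega> (r / norm (x - c))) * indicator {x. 2 * r \<le> norm (x - c)} x
       \<le> ennreal (?c k) * indicator (?A k) x"
      using True k2 by (simp add: indicator_def mem_cball dist_norm norm_minus_commute[of c] ennreal_leI)
    also have "\<dots> \<le> (\<Sum>k. ennreal (?c k) * indicator (?A k) x)"
      by (rule ennreal_le_suminf)
    finally show ?thesis .
  qed simp
  have "(\<integral>\<^sup>+x. ennreal (1 / norm (x - c) ^ CARD('n) * \<omega> (r / norm (x - c))) * indicator {x. 2 * r \<le> norm (x - c)} x \<partial>lebesgue)
    \<le> (\<integral>\<^sup>+x. (\<Sum>k. ennreal (?c k) * indicator (?A k) x) \<partial>lebesgue)"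
    by (intro nn_integral_mono pt)
  also have "\<dots> = (\<Sum>k. \<integral>\<^sup>+x. ennreal (?c k) * indicator (?A k) x \<partial>lebesgue)"
    by (subst nn_integral_suminf) simp_all
  also have "\<dots> = (\<Sum>k. ennreal (?V * 2 ^ CARD('n)) * ennreal (\<omega> ((1/2) ^ Suc k)))"
  proof (intro suminf_cong)
    fix k
    have "(\<integral>\<^sup>+x. ennreal (?c k) * indicator (?A k) x \<partial>lebesgue) = ennreal (?c k) * emeasure lebesgue (?A k)"
      by (subst nn_integral_cmult_indicator) auto
    also have "emeasure lebesgue (?A k) = ennreal (?V * (2 ^ (k+2) * r) ^ CARD('n))"
      using r by (simp add: emeasure_cball)
    also have "ennreal (?c k) * ennreal (?V * (2 ^ (k+2) * r) ^ CARD('n)) = ennreal (?c k * (?V * (2 ^ (k+2) * r) ^ CARD('n)))"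
    proof (rule ennreal_mult[symmetric])
      show "0 \<le> ?c k" using r by (intro mult_nonneg_nonneg nn) auto
      show "0 \<le> ?V * (2 ^ (k+2) * r) ^ CARD('n)" using r by (intro mult_nonneg_nonneg) auto
    qed
    also have "?c k * (?V * (2 ^ (k+2) * r) ^ CARD('n)) = ?V * 2 ^ CARD('n) * \<omega> ((1/2) ^ Suc k)"
    proof -
      have "(2 ^ (k+2) * r) ^ CARD('n) = 2 ^ CARD('n) * (2 ^ (k+1) * r) ^ CARD('n)"
      proof -
        have "2 ^ (k+2) * r = 2 * (2 ^ (k+1) * r)" by simp
        then show ?thesis by (simp only: power_mult_distrib)
      qed
      moreover have "(2 ^ (k+1) * r) ^ CARD('n) \<noteq> 0" using r by simp
      ultimately show ?thesis by simp
    qed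
    finally show "(\<integral>\<^sup>+x. ennreal (?c k) * indicator (?A k) x \<partial>lebesgue) = ennreal (?V * 2 ^ CARD('n)) * ennreal (\<omega> ((1/2) ^ Suc k))"
      by (simp add: ennreal_mult')
  qed
  also have "\<dots> = ennreal (?V * 2 ^ CARD('n)) * (\<Sum>k. ennreal (\<omega> ((1/2) ^ Suc k)))"
    by simp
  also have "\<dots> \<le> ennreal (?V * 2 ^ CARD('n)) * (2 * (\<integral>\<^sup>+t\<in>{0<..1}. ennreal (\<omega> t / t) \<partial>lebesgue))"
    by (intro mult_left_mono dini_sum \<omega>) auto
  also have "\<dots> = ennreal (?V * 2 ^ CARD('n) * 2) * (\<integral>\<^sup>+t\<in>{0<..1}. ennreal (\<omega> t / t) \<partial>lebesgue)"
    by (simp add: ennreal_mult' mult.assoc)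
  finally show ?thesis .
qed

section \<open>Calderon-Zygmund decomposition of dyadic step functions\<close>

text \<open>The half-open cube of side h 2^j around \<open>x\<close> in the dyadic grid. As a fibre
  of the floor map it is an equivalence class, so two cells of one level coincide or are disjoint.
  Levels count upwards from the finest mesh \<open>h\<close>: a larger \<open>j\<close> is a larger
  cube.\<close>

definition dyadic_cell :: "real \<Rightarrow> nat \<Rightarrow> real ^ 'n \<Rightarrow> (real ^ 'n) set" where
  "dyadic_cell h j x = {y. \<forall>i. \<lfloor>y $ i / (h * 2 ^ j)\<rfloor> = \<lfloor>x $ i / (h * 2 ^ j)\<rfloor>}"

lemma dyadic_cell_self [simp]: "x \<in> dyadic_cell h j x"
  by (simp add: dyadic_cell_def)

lemma dyadic_cell_eq: "y \<in> dyadic_cell h j x \<Longrightarrow> dyadic_cell h j y = dyadic_cell h j x"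
  by (simp add: dyadic_cell_def)

text \<open>Halving commutes with the floor up to \<open>div 2\<close>, so the index at level j
  determines the index at level j + 1.\<close>

lemma dyadic_cell_Suc: "dyadic_cell h j x \<subseteq> dyadic_cell h (Suc j) x"
proof
  fix y assume y: "y \<in> dyadic_cell h j x"
  have half: "\<lfloor>t / (h * 2 ^ Suc j)\<rfloor> = \<lfloor>t / (h * 2 ^ j)\<rfloor> div 2" for t
    using floor_divide_real_eq_div[of 2 "t / (h * 2 ^ j)"] by (simp add: ac_simps)
  from y show "y \<in> dyadic_cell h (Suc j) x"
    unfolding dyadic_cell_def half by simp
qed

lemma dyadic_cell_mono:
  assumes "i \<le> j" shows "dyadic_cell h i x \<subseteq> dyadic_cell h j x"
  using assms by (induction rule: dec_induct) (use dyadic_cell_Suc in blast)+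

lemma dyadic_cell_conv:
  assumes "0 < h"
  shows "dyadic_cell h j x = {y. \<forall>i. of_int \<lfloor>x $ i / (h * 2 ^ j)\<rfloor> * (h * 2 ^ j) \<le> y $ i \<and>
    y $ i < (of_int \<lfloor>x $ i / (h * 2 ^ j)\<rfloor> + 1) * (h * 2 ^ j)}"
  using assms by (auto simp: dyadic_cell_def floor_eq_iff field_simps)

lemma dyadic_cell_borel:
  fixes x :: "real ^ 'n"
  assumes "0 < h" shows "dyadic_cell h j x \<in> sets borel"
  unfolding dyadic_cell_conv[OF assms] by measurable

lemma dyadic_cell_lebesgue [measurable]:
  fixes x :: "real ^ 'n"
  assumes "0 < h" shows "dyadic_cell h j x \<in> sets lebesgue"
  by (rule sets_completionI_sets) (simp add: dyadic_cell_borel[OF assms])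

text \<open>The half-open cube lies between an open and a closed box of the same volume.\<close>

lemma emeasure_dyadic_cell:
  fixes x :: "real ^ 'n"
  assumes "0 < h"
  shows "emeasure lebesgue (dyadic_cell h j x) = ennreal ((h * 2 ^ j) ^ CARD('n))"
proof -
  define s where "s = h * 2 ^ j"
  have s: "0 < s" using assms by (simp add: s_def)
  define a :: "real ^ 'n" where "a = (\<chi> i. of_int \<lfloor>x $ i / s\<rfloor> * s)"
  define b :: "real ^ 'n" where "b = (\<chi> i. (of_int \<lfloor>x $ i / s\<rfloor> + 1) * s)"
  have ab: "\<forall>i\<in>Basis. a \<bullet> i \<le> b \<bullet> i"
    using s by (auto simp: Basis_vec_def a_def b_def inner_axis field_simps)
  have prod: "(\<Prod>i\<in>Basis. (b - a) \<bullet> i) = s ^ CARD('n)"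
  proof -
    have "(\<Prod>i\<in>Basis. (b - a) \<bullet> i) = (\<Prod>i\<in>(Basis :: (real^'n) set). s)"
      by (intro prod.cong) (auto simp: Basis_vec_def a_def b_def inner_axis field_simps)
    then show ?thesis by simp
  qed
  have "box a b \<subseteq> dyadic_cell h j x"
    unfolding dyadic_cell_conv[OF assms] s_def[symmetric]
    by (auto simp: mem_box_cart a_def b_def intro: less_imp_le)
  moreover have "dyadic_cell h j x \<subseteq> cbox a b"
    unfolding dyadic_cell_conv[OF assms] s_def[symmetric]
    by (simp add: subset_iff mem_box_cart a_def b_def less_le)
  ultimately have "emeasure lborel (box a b) \<le> emeasure lborel (dyadic_cell h j x)"
    "emeasure lborel (dyadic_cell h j x) \<le> emeasure lborel (cbox a b)"
    using dyadic_cell_borel[OF assms] by (auto intro!: emeasure_mono)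
  moreover have "emeasure lborel (box a b) = ennreal (s ^ CARD('n))"
    "emeasure lborel (cbox a b) = ennreal (s ^ CARD('n))"
    using ab prod by (auto simp: emeasure_lborel_box emeasure_lborel_cbox_eq)
  ultimately have "emeasure lborel (dyadic_cell h j x) = ennreal (s ^ CARD('n))" by simp
  then show ?thesis using dyadic_cell_borel[OF assms, of j x] by (simp add: s_def)
qed

lemma dyadic_cell_dist:
  fixes x :: "real ^ 'n"
  assumes "0 < h" "y \<in> dyadic_cell h j x"
  shows "norm (y - x) \<le> real CARD('n) * (h * 2 ^ j)"
proof -
  define s where "s = h * 2 ^ j"
  have s: "0 < s" using assms by (simp add: s_def)
  have "\<bar>(y - x) $ i\<bar> \<le> s" for i
  proof -
    have "\<lfloor>y $ i / s\<rfloor> = \<lfloor>x $ i / s\<rfloor>" using assms by (simp add: dyadic_cell_def s_def)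
    then have "\<bar>y $ i / s - x $ i / s\<bar> \<le> 1" by linarith
    then have "\<bar>y $ i - x $ i\<bar> / s \<le> 1" using s by (simp add: diff_divide_distrib[symmetric])
    then show ?thesis using s by simp
  qed
  then have "(\<Sum>i\<in>UNIV. \<bar>(y - x) $ i\<bar>) \<le> (\<Sum>i\<in>(UNIV::'n set). s)" by (intro sum_mono)
  then show ?thesis using norm_le_l1_cart[of "y - x"] by (simp add: s_def)
qed

abbreviation L1_norm :: "(real ^ 'n \<Rightarrow> complex) \<Rightarrow> ennreal" where
  "L1_norm f \<equiv> \<integral>\<^sup>+x. ennreal (cmod (f x)) \<partial>lebesgue"

abbreviation level_measure :: "(real ^ 'n \<Rightarrow> complex) \<Rightarrow> real \<Rightarrow> ennreal" where
  "level_measure u t \<equiv> emeasure lebesgue {x. t < cmod (u x)}"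

lemma Linf_cI:
  assumes "f \<in> borel_measurable lebesgue" "\<And>x. cmod (f x) \<le> B" "\<And>x. x \<notin> S \<Longrightarrow> f x = 0" "bounded S"
  shows "f \<in> Linf_c"
proof -
  have "{x. f x \<noteq> 0} \<subseteq> S" using assms by auto
  then have "bounded {x. f x \<noteq> 0}" using assms bounded_subset by blast
  then show ?thesis using assms unfolding Linf_c_def
    by (auto simp: compact_closure bounded_iff)
qed

lemma Linf_cE:
  assumes "f \<in> Linf_c"
  obtains B R where "f \<in> borel_measurable lebesgue" "0 < B" "0 < R" "\<And>x. cmod (f x) \<le> B"
    "\<And>x. R < norm x \<Longrightarrow> f x = 0"
proof -
  from assms obtain B where B: "0 < B" "\<And>x. cmod (f x) \<le> B"
    unfolding Linf_c_def by (auto simp: bounded_pos)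
  from assms have "bounded (closure {x. f x \<noteq> 0})"
    unfolding Linf_c_def by (simp add: compact_imp_bounded)
  then have "bounded {x. f x \<noteq> 0}"
    using bounded_subset[OF _ closure_subset] by metis
  then obtain R where R: "0 < R" "\<And>x. f x \<noteq> 0 \<Longrightarrow> norm x \<le> R"
    by (auto simp: bounded_pos)
  have "f x = 0" if "R < norm x" for x using R(2)[of x] that by force
  with B R that assms show ?thesis by (auto simp: Linf_c_def)
qed

lemma Linf_c_nn_integral_finite:
  fixes f :: "real ^ 'n \<Rightarrow> complex"
  assumes "f \<in> Linf_c" shows "L1_norm f < top"
proof -
  from Linf_cE[OF assms] obtain B R where *: "f \<in> borel_measurable lebesgue" "0 < B" "0 < R"
    "\<And>x. cmod (f x) \<le> B" "\<And>x. R < norm x \<Longrightarrow> f x = 0" by metis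
  have "L1_norm f \<le> (\<integral>\<^sup>+x. ennreal B * indicator (cball (0::real^'n) R) x \<partial>lebesgue)"
    using * by (intro nn_integral_mono) (auto simp: indicator_def ennreal_leI not_le)
  also have "\<dots> = ennreal B * emeasure lebesgue (cball (0::real^'n) R)"
    by (subst nn_integral_cmult_indicator) auto
  also have "\<dots> < top"
    using * by (simp add: ennreal_mult_less_top emeasure_cball)
  finally show ?thesis .
qed

lemma Linf_c_integrable:
  assumes "f \<in> Linf_c" shows "integrable lebesgue f"
  using assms Linf_c_nn_integral_finite[OF assms] by (intro integrableI_bounded) (auto simp: Linf_c_def)

text \<open>Around each point the coarsest cell on which the mean of |f| exceeds \<alpha> is
  selected. Its parent no longer exceeds \<alpha>, which gives the upper bound with the volume ratio
  2^d. A point without such a cell has mean at most \<alpha> on its finest cell, where f is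
  constant, hence |f| is at most \<alpha> there. Finiteness holds because each selected cell carries
  mass at least \<alpha> h^d.\<close>

lemma stopping_cells:
  fixes f :: "real ^ 'n \<Rightarrow> complex"
  assumes h: "0 < h" and f: "f \<in> Linf_c" and \<alpha>: "0 < \<alpha>"
    and step: "\<forall>x. \<forall>y\<in>dyadic_cell h 0 x. f y = f x"
  obtains P lev where "finite P"
    "\<And>p q. p \<in> P \<Longrightarrow> q \<in> P \<Longrightarrow> p \<noteq> q \<Longrightarrow> dyadic_cell h (lev p) p \<inter> dyadic_cell h (lev q) q = {}"
    "\<And>p. p \<in> P \<Longrightarrow> ennreal (\<alpha> * (h * 2 ^ lev p) ^ CARD('n)) \<le>
       (\<integral>\<^sup>+x\<in>dyadic_cell h (lev p) p. ennreal (cmod (f x)) \<partial>lebesgue)"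
    "\<And>p. p \<in> P \<Longrightarrow> (\<integral>\<^sup>+x\<in>dyadic_cell h (lev p) p. ennreal (cmod (f x)) \<partial>lebesgue) \<le>
       ennreal (2 ^ CARD('n) * \<alpha> * (h * 2 ^ lev p) ^ CARD('n))"
    "\<And>x. x \<notin> (\<Union>p\<in>P. dyadic_cell h (lev p) p) \<Longrightarrow> cmod (f x) \<le> \<alpha>"
proof -
  have fm [measurable]: "f \<in> borel_measurable lebesgue" using f by (simp add: Linf_c_def)
  have [measurable]: "dyadic_cell h j x \<in> sets lebesgue" for j and x :: "real^'n" using h by simp
  define \<nu> where "\<nu> A = (\<integral>\<^sup>+x\<in>A. ennreal (cmod (f x)) \<partial>lebesgue)" for A
  define vol where "vol j = (h * 2 ^ j) ^ CARD('n)" for j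
  have vol: "0 < vol j" "vol 0 \<le> vol j" for j
    using h by (auto simp: vol_def power_mult_distrib)
  have \<nu>_mono: "\<nu> A \<le> \<nu> B" if "A \<subseteq> B" for A B
    unfolding \<nu>_def using that by (intro nn_integral_mono) (auto simp: indicator_def)
  have \<nu>_fin: "\<nu> UNIV < top"
    unfolding \<nu>_def using Linf_c_nn_integral_finite[OF f] by simp
  define big where "big j x \<longleftrightarrow> ennreal (\<alpha> * vol j) < \<nu> (dyadic_cell h j x)" for j x
  obtain N where N: "\<nu> UNIV = ennreal N" "0 \<le> N" using \<nu>_fin by (cases "\<nu> UNIV") auto
  \<comment> \<open>From level \<open>J\<close> on, \<alpha> times the volume of a cell exceeds the
    total mass \<open>N\<close>, so a coarsest exceeding cell exists. The volume grows at least like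
    2^j because the dimension is at least 1.\<close>
  obtain J where J: "N / (\<alpha> * h ^ CARD('n)) < 2 ^ J" using real_arch_pow[of 2] by auto
  have not_big: "\<not> big j x" if "J \<le> j" for j x
  proof -
    have "N < \<alpha> * h ^ CARD('n) * 2 ^ J"
      using J \<alpha> h by (simp add: field_simps)
    also have "\<dots> \<le> \<alpha> * h ^ CARD('n) * (2 ^ j) ^ CARD('n)"
    proof (intro mult_left_mono)
      have "(2::real) ^ J \<le> 2 ^ j" using that by simp
      also have "\<dots> \<le> (2 ^ j) ^ CARD('n)" by (intro self_le_power) auto
      finally show "(2::real) ^ J \<le> (2 ^ j) ^ CARD('n)" .
    qed (use \<alpha> h in auto)
    finally have "\<nu> UNIV \<le> ennreal (\<alpha> * vol j)"
      unfolding N vol_def by (intro ennreal_leI) (simp add: power_mult_distrib)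
    then show ?thesis unfolding big_def using \<nu>_mono[of "dyadic_cell h j x" UNIV]
      by (metis not_less order_trans subset_UNIV)
  qed
  define S where "S = {x. \<exists>j. big j x}"
  define lev where "lev x = (GREATEST j. big j x)" for x
  have bound: "j \<le> J" if "big j x" for j x using not_big[of j x] that by (meson linear)
  have lev_big: "big (lev x) x" if "x \<in> S" for x
    unfolding lev_def using that bound GreatestI_ex_nat[of "\<lambda>j. big j x" J] by (auto simp: S_def)
  have lev_le: "j \<le> lev x" if "big j x" for j x
    unfolding lev_def using that bound Greatest_le_nat[of "\<lambda>j. big j x" j J] by auto
  let ?Q = "\<lambda>x. dyadic_cell h (lev x) x"
  \<comment> \<open>A point of the selected cell of \<open>x\<close> shares with \<open>x\<close>
    all cells from level \<open>lev x\<close> on, hence also the last exceeding one. So two selected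
    cells that meet are equal.\<close>
  have cong: "y \<in> S \<and> lev y = lev x \<and> ?Q y = ?Q x" if x: "x \<in> S" and y: "y \<in> ?Q x" for x y
  proof -
    have eq: "dyadic_cell h j y = dyadic_cell h j x" if "lev x \<le> j" for j
      using dyadic_cell_mono[OF that, of h x] y by (intro dyadic_cell_eq) auto
    have big: "big (lev x) y" using lev_big[OF x] eq by (simp add: big_def)
    then have "lev x \<le> lev y" by (rule lev_le)
    moreover have "y \<in> S" using big by (auto simp: S_def)
    moreover have "lev y \<le> lev x"
    proof (rule ccontr)
      assume *: "\<not> lev y \<le> lev x"
      then have "big (lev y) x" using lev_big[OF \<open>y \<in> S\<close>] eq[of "lev y"] by (simp add: big_def)
      from lev_le[OF this] * show False by simp
    qed
    ultimately have "y \<in> S" "lev y = lev x" by auto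
    then show ?thesis using eq[of "lev x"] by simp
  qed
  have disj: "?Q x \<inter> ?Q y = {}" if "x \<in> S" "y \<in> S" "?Q x \<noteq> ?Q y" for x y
    using cong that by blast
  \<comment> \<open>\<open>P\<close> contains one centre for each selected cell, so that cells can
    be indexed by points without repetition.\<close>
  obtain P where P: "P \<subseteq> S" "inj_on ?Q P" "?Q ` S = ?Q ` P"
    using subset_image_inj[of "?Q ` S" ?Q S] by auto
  have disjP: "?Q p \<inter> ?Q q = {}" if "p \<in> P" "q \<in> P" "p \<noteq> q" for p q
    using disj[of p q] P that by (auto dest: inj_onD)
  have cover: "(\<Union>p\<in>P. ?Q p) = S"
  proof -
    have "(\<Union>p\<in>P. ?Q p) = (\<Union>p\<in>S. ?Q p)" using P(3) by simp
    also have "\<dots> = S"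
    proof (intro equalityI subsetI)
      fix y assume "y \<in> (\<Union>p\<in>S. ?Q p)"
      then obtain x where "x \<in> S" "y \<in> ?Q x" by blast
      then show "y \<in> S" using cong[of x y] by blast
    next
      fix y assume "y \<in> S"
      then show "y \<in> (\<Union>p\<in>S. ?Q p)" by (rule UN_I) simp
    qed
    finally show ?thesis .
  qed
  have lower: "ennreal (\<alpha> * vol (lev p)) \<le> \<nu> (?Q p)" if "p \<in> P" for p
    using lev_big[of p] P that by (auto simp: big_def)
  have "finite P"
  proof (rule ccontr)
    assume "infinite P"
    \<comment> \<open>More cells than the total mass can supply with mass
      \<open>\<alpha> * vol 0\<close> each.\<close>
    define n where "n = Suc (nat \<lceil>N / (\<alpha> * vol 0)\<rceil>)"
    obtain F where F: "finite F" "card F = n" "F \<subseteq> P"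
      using infinite_arbitrarily_large[OF \<open>infinite P\<close>] by metis
    have "ennreal (real n * (\<alpha> * vol 0)) = (\<Sum>p\<in>F. ennreal (\<alpha> * vol 0))"
      using F \<alpha> vol[of 0] by (simp add: ennreal_mult' ennreal_of_nat_eq_real_of_nat)
    also have "\<dots> \<le> (\<Sum>p\<in>F. \<nu> (?Q p))"
    proof (rule sum_mono)
      fix p assume "p \<in> F"
      then have "p \<in> P" using F by auto
      have "ennreal (\<alpha> * vol 0) \<le> ennreal (\<alpha> * vol (lev p))" using vol \<alpha> by (intro ennreal_leI) auto
      also have "\<dots> \<le> \<nu> (?Q p)" by (rule lower) fact
      finally show "ennreal (\<alpha> * vol 0) \<le> \<nu> (?Q p)" .
    qed
    also have "\<dots> = (\<integral>\<^sup>+x. (\<Sum>p\<in>F. ennreal (cmod (f x)) * indicator (?Q p) x) \<partial>lebesgue)"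
      unfolding \<nu>_def by (subst nn_integral_sum) auto
    also have "\<dots> \<le> L1_norm f"
    proof (intro nn_integral_mono)
      fix x
      have "(\<Sum>p\<in>F. indicator (?Q p) x) = (indicator (\<Union>p\<in>F. ?Q p) x :: ennreal)"
        using F disjP by (subst indicator_UN_disjoint) (auto simp: disjoint_family_on_def subset_iff)
      also have "\<dots> \<le> 1" by (auto simp: indicator_def)
      finally show "(\<Sum>p\<in>F. ennreal (cmod (f x)) * indicator (?Q p) x) \<le> ennreal (cmod (f x))"
        unfolding sum_distrib_left[symmetric] using mult_left_mono by fastforce
    qed
    also have "\<dots> = ennreal N" using N by (simp add: \<nu>_def)
    finally have "real n * (\<alpha> * vol 0) \<le> N" using N by simp
    then have "real n \<le> N / (\<alpha> * vol 0)" using \<alpha> vol[of 0] by (simp add: field_simps)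
    then show False unfolding n_def by linarith
  qed
  show thesis
  proof (rule that[of P lev])
    show "finite P" by fact
    fix p assume p: "p \<in> P"
    show "ennreal (\<alpha> * (h * 2 ^ lev p) ^ CARD('n)) \<le> (\<integral>\<^sup>+x\<in>?Q p. ennreal (cmod (f x)) \<partial>lebesgue)"
      using lower[OF p] by (simp add: \<nu>_def vol_def)
    have "\<not> big (Suc (lev p)) p" using lev_le[of "Suc (lev p)" p] by auto
    then have "\<nu> (dyadic_cell h (Suc (lev p)) p) \<le> ennreal (\<alpha> * vol (Suc (lev p)))"
      by (simp add: big_def not_less)
    then have "\<nu> (?Q p) \<le> ennreal (\<alpha> * vol (Suc (lev p)))"
      using \<nu>_mono[OF dyadic_cell_Suc] order_trans by blast
    also have "\<alpha> * vol (Suc (lev p)) = 2 ^ CARD('n) * \<alpha> * (h * 2 ^ lev p) ^ CARD('n)"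
      by (simp add: vol_def power_mult_distrib)
    finally show "(\<integral>\<^sup>+x\<in>?Q p. ennreal (cmod (f x)) \<partial>lebesgue) \<le> ennreal (2 ^ CARD('n) * \<alpha> * (h * 2 ^ lev p) ^ CARD('n))"
      by (simp add: \<nu>_def)
  next
    fix x assume "x \<notin> (\<Union>p\<in>P. ?Q p)"
    then have "\<not> big 0 x" by (auto simp: cover S_def)
    then have "\<nu> (dyadic_cell h 0 x) \<le> ennreal (\<alpha> * vol 0)" by (simp add: big_def not_less)
    moreover have "\<nu> (dyadic_cell h 0 x) = (\<integral>\<^sup>+y. ennreal (cmod (f x)) * indicator (dyadic_cell h 0 x) y \<partial>lebesgue)"
      unfolding \<nu>_def by (intro nn_integral_cong) (auto simp: indicator_def step)
    moreover have "\<dots> = ennreal (cmod (f x) * vol 0)"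
      using h by (subst nn_integral_cmult_indicator) (auto simp: emeasure_dyadic_cell vol_def ennreal_mult' simp del: emeasure_completion)
    ultimately have "cmod (f x) * vol 0 \<le> \<alpha> * vol 0"
      using \<alpha> vol[of 0] by simp
    then show "cmod (f x) \<le> \<alpha>" using vol[of 0] by simp
  qed (use disjP in auto)
qed

lemma Linf_c_measurable [measurable_dest]: "f \<in> Linf_c \<Longrightarrow> f \<in> borel_measurable lebesgue"
  by (simp add: Linf_c_def)

lemma Linf_c_zero [simp]: "(\<lambda>x. 0) \<in> Linf_c"
  by (rule Linf_cI[where B = 0 and S = "{}"]) auto

lemma Linf_c_mult:
  assumes f: "f \<in> Linf_c" and [measurable]: "g \<in> borel_measurable lebesgue" and g: "\<And>x. cmod (g x) \<le> B"
  shows "(\<lambda>x. g x * f x) \<in> Linf_c"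
proof -
  from Linf_cE[OF f] obtain B' R where *: "f \<in> borel_measurable lebesgue" "0 < B'" "0 < R"
    "\<And>x. cmod (f x) \<le> B'" "\<And>x. R < norm x \<Longrightarrow> f x = 0" by metis
  note [measurable] = *(1)
  show ?thesis
  proof (rule Linf_cI[where S = "cball 0 R"])
    show "(\<lambda>x. g x * f x) \<in> borel_measurable lebesgue" by measurable
    fix x
    have "0 \<le> B" using g[of x] norm_ge_zero order_trans by blast
    then show "cmod (g x * f x) \<le> B * B'" using * g by (auto simp: norm_mult intro!: mult_mono)
  qed (use * in auto)
qed

lemma Linf_c_cmult: "f \<in> Linf_c \<Longrightarrow> (\<lambda>x. c * f x) \<in> Linf_c"
  by (rule Linf_c_mult[where B = "cmod c"]) auto

lemma Linf_c_add:
  assumes f: "f \<in> Linf_c" and g: "g \<in> Linf_c"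
  shows "(\<lambda>x. f x + g x) \<in> Linf_c"
proof -
  from Linf_cE[OF f] obtain B R where 1: "f \<in> borel_measurable lebesgue" "0 < B" "0 < R"
    "\<And>x. cmod (f x) \<le> B" "\<And>x. R < norm x \<Longrightarrow> f x = 0" by metis
  from Linf_cE[OF g] obtain B' R' where 2: "g \<in> borel_measurable lebesgue" "0 < B'" "0 < R'"
    "\<And>x. cmod (g x) \<le> B'" "\<And>x. R' < norm x \<Longrightarrow> g x = 0" by metis
  note [measurable] = 1(1) 2(1)
  show ?thesis
  proof (rule Linf_cI[where S = "cball 0 (max R R')"])
    show "(\<lambda>x. f x + g x) \<in> borel_measurable lebesgue" by measurable
    fix x
    show "cmod (f x + g x) \<le> B + B'" using 1(4)[of x] 2(4)[of x] norm_triangle_ineq[of "f x" "g x"] by linarith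
  qed (use 1 2 in auto)
qed

lemma Linf_c_diff:
  assumes "f \<in> Linf_c" "g \<in> Linf_c"
  shows "(\<lambda>x. f x - g x) \<in> Linf_c"
  using Linf_c_add[OF assms(1) Linf_c_cmult[OF assms(2), of "-1"]] by simp

lemma Linf_c_sum:
  assumes "finite P" "\<And>p. p \<in> P \<Longrightarrow> b p \<in> Linf_c"
  shows "(\<lambda>x. \<Sum>p\<in>P. b p x) \<in> Linf_c"
  using assms by (induction P rule: finite_induct) (auto intro: Linf_c_add)

text \<open>The good part replaces f on each stopping cell by its mean, and the bad parts are what
  remains on the single cells. A cell of side l lies in the ball of radius d l around its index
  point, so the doubled ball has volume V (2 d)^d times that of the cell, V being the volume of the
  unit ball: this is the constant in the last conclusion.\<close>

lemma CZ_decomposition: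
  fixes f :: "real ^ 'n \<Rightarrow> complex"
  assumes h: "0 < h" and f: "f \<in> Linf_c" and \<alpha>: "0 < \<alpha>"
    and step: "\<forall>x. \<forall>y\<in>dyadic_cell h 0 x. f y = f x"
  obtains P r b g where "finite P" "g \<in> Linf_c" "\<And>x. cmod (g x) \<le> 2 ^ CARD('n) * \<alpha>"
    "L1_norm g \<le> L1_norm f"
    "\<And>p. p \<in> P \<Longrightarrow> b p \<in> Linf_c" "\<And>p x. p \<in> P \<Longrightarrow> x \<notin> cball p (r p) \<Longrightarrow> b p x = 0"
    "\<And>p. p \<in> P \<Longrightarrow> 0 < r p" "\<And>p. p \<in> P \<Longrightarrow> integral\<^sup>L lebesgue (b p) = 0"
    "(\<Sum>p\<in>P. L1_norm (b p)) \<le> 2 * L1_norm f"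
    "\<And>x. f x = g x + (\<Sum>p\<in>P. b p x)"
    "ennreal \<alpha> * (\<Sum>p\<in>P. emeasure lebesgue (cball p (2 * r p))) \<le>
       ennreal (unit_ball_vol (real CARD('n)) * (2 * real CARD('n)) ^ CARD('n)) * L1_norm f"
proof -
  note fm [measurable] = Linf_c_measurable[OF f]
  have [measurable]: "dyadic_cell h j x \<in> sets lebesgue" for j and x :: "real^'n"
    using h by (rule dyadic_cell_lebesgue)
  obtain P lev where P: "finite P"
    and disj: "\<And>p q. p \<in> P \<Longrightarrow> q \<in> P \<Longrightarrow> p \<noteq> q \<Longrightarrow> dyadic_cell h (lev p) p \<inter> dyadic_cell h (lev q) q = {}"
    and lower: "\<And>p. p \<in> P \<Longrightarrow> ennreal (\<alpha> * (h * 2 ^ lev p) ^ CARD('n)) \<le>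
       (\<integral>\<^sup>+x\<in>dyadic_cell h (lev p) p. ennreal (cmod (f x)) \<partial>lebesgue)"
    and upper: "\<And>p. p \<in> P \<Longrightarrow> (\<integral>\<^sup>+x\<in>dyadic_cell h (lev p) p. ennreal (cmod (f x)) \<partial>lebesgue) \<le>
       ennreal (2 ^ CARD('n) * \<alpha> * (h * 2 ^ lev p) ^ CARD('n))"
    and off: "\<And>x. x \<notin> (\<Union>p\<in>P. dyadic_cell h (lev p) p) \<Longrightarrow> cmod (f x) \<le> \<alpha>"
    by (rule stopping_cells[OF h f \<alpha> step]) (rule that; assumption)
  define Q where "Q p = dyadic_cell h (lev p) p" for p
  define vol where "vol p = (h * 2 ^ lev p) ^ CARD('n)" for p
  define \<nu> where "\<nu> p = (\<integral>\<^sup>+x\<in>Q p. ennreal (cmod (f x)) \<partial>lebesgue)" for p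
  define m where "m p = (\<integral>x. indicator (Q p) x *\<^sub>R f x \<partial>lebesgue) / complex_of_real (vol p)" for p
  define b where "b p x = indicator (Q p) x *\<^sub>R (f x - m p)" for p x
  define g where "g x = f x - (\<Sum>p\<in>P. b p x)" for x
  define r where "r p = real CARD('n) * (h * 2 ^ lev p)" for p
  let ?F = "L1_norm f"
  have [measurable]: "Q p \<in> sets lebesgue" for p by (simp add: Q_def)
  have vol: "0 < vol p" for p using h by (simp add: vol_def)
  have emQ: "emeasure lebesgue (Q p) = ennreal (vol p)" for p
    unfolding Q_def vol_def by (rule emeasure_dyadic_cell[OF h])
  have r: "0 < r p" for p using h by (simp add: r_def)
  have Qsub: "Q p \<subseteq> cball p (r p)" for p
    using dyadic_cell_dist[OF h, of _ "lev p" p] by (auto simp: Q_def r_def dist_norm norm_minus_commute[of p])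
  \<comment> \<open>Averaging does not increase mass. This one bound yields the height of the good
    part on the cells, its L1 bound, and the factor 2 for the bad parts.\<close>
  have m\<nu>: "ennreal (cmod (m p) * vol p) \<le> \<nu> p" for p
  proof -
    have "cmod (m p) * vol p = cmod (\<integral>x. indicator (Q p) x *\<^sub>R f x \<partial>lebesgue)"
      using vol[of p] by (simp add: m_def norm_divide)
    also have "ennreal \<dots> \<le> (L1_norm (\<lambda>x. indicator (Q p) x *\<^sub>R f x))"
      by (rule norm_integral_le_nn_integral)
    also have "\<dots> = \<nu> p" unfolding \<nu>_def by (intro nn_integral_cong) (auto simp: indicator_def)
    finally show ?thesis .
  qed
  have m_le: "cmod (m p) \<le> 2 ^ CARD('n) * \<alpha>" if "p \<in> P" for p
  proof -
    have "ennreal (cmod (m p) * vol p) \<le> ennreal (2 ^ CARD('n) * \<alpha> * vol p)"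
      using m\<nu>[of p] upper[OF that] by (simp add: \<nu>_def Q_def vol_def)
    then show ?thesis using vol[of p] \<alpha> by (subst (asm) ennreal_le_iff) auto
  qed
  have b_other: "b q x = 0" if "p \<in> P" "q \<in> P" "x \<in> Q p" "q \<noteq> p" for p q x
    using disj[of p q] that by (auto simp: b_def Q_def indicator_def)
  have g_in: "g x = m p" if "p \<in> P" "x \<in> Q p" for x p
  proof -
    have "(\<Sum>q\<in>P. b q x) = (\<Sum>q\<in>{p}. b q x)"
      using P that b_other[OF that(1) _ that(2)] by (intro sum.mono_neutral_right) auto
    then show ?thesis using that by (simp add: g_def b_def)
  qed
  have g_out: "g x = f x" if "x \<notin> (\<Union>p\<in>P. Q p)" for x
    using that by (simp add: g_def b_def indicator_def)
  have g_le: "cmod (g x) \<le> 2 ^ CARD('n) * \<alpha>" for x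
  proof (cases "x \<in> (\<Union>p\<in>P. Q p)")
    case True
    then show ?thesis using g_in m_le by fastforce
  next
    case False
    then have "cmod (g x) \<le> \<alpha>" using off[of x] by (simp add: g_out Q_def)
    also have "\<alpha> \<le> 2 ^ CARD('n) * \<alpha>" using \<alpha> one_le_power[of "2::real" "CARD('n)"] by simp
    finally show ?thesis .
  qed
  have b: "b p \<in> Linf_c" for p
  proof -
    from Linf_cE[OF f] obtain B where B: "\<And>x. cmod (f x) \<le> B" by metis
    show ?thesis
    proof (rule Linf_cI[where S = "cball p (r p)"])
      show "b p \<in> borel_measurable lebesgue" unfolding b_def by measurable
      fix x
      show "cmod (b p x) \<le> B + cmod (m p)"
        using B[of x] norm_triangle_ineq4[of "f x" "m p"] order_trans[OF norm_ge_zero B[of x]]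
        unfolding b_def by (cases "x \<in> Q p") simp_all
      show "b p x = 0" if "x \<notin> cball p (r p)" using Qsub[of p] that by (auto simp: b_def indicator_def)
    qed simp
  qed
  have ind: "(\<Sum>p\<in>P. indicator (Q p) x) = (indicator (\<Union>p\<in>P. Q p) x :: ennreal)" for x
    using P disj by (subst indicator_UN_disjoint) (auto simp: disjoint_family_on_def Q_def)
  have sum\<nu>: "(\<integral>\<^sup>+x. ennreal (cmod (f x)) * indicator (\<Union>p\<in>P. Q p) x \<partial>lebesgue) = (\<Sum>p\<in>P. \<nu> p)"
    unfolding ind[symmetric] sum_distrib_left \<nu>_def by (rule nn_integral_sum) measurable
  have \<nu>_le: "(\<Sum>p\<in>P. \<nu> p) \<le> ?F"
    unfolding sum\<nu>[symmetric] by (intro nn_integral_mono) (auto simp: indicator_def)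
  show thesis
  proof (rule that[of P g b r])
    show "finite P" by fact
    show "g \<in> Linf_c" unfolding g_def by (intro Linf_c_diff f Linf_c_sum P b)
    show "cmod (g x) \<le> 2 ^ CARD('n) * \<alpha>" for x by (rule g_le)
    show "f x = g x + (\<Sum>p\<in>P. b p x)" for x by (simp add: g_def)
    show "b p \<in> Linf_c" "0 < r p" for p by (rule b, rule r)
    show "b p x = 0" if "x \<notin> cball p (r p)" for p x
      using Qsub[of p] that by (auto simp: b_def indicator_def)
    show "integral\<^sup>L lebesgue (b p) = 0" for p
    proof -
      have i1: "integrable lebesgue (\<lambda>x. indicator (Q p) x *\<^sub>R f x)"
        by (intro integrable_mult_indicator Linf_c_integrable f) simp
      have i2: "integrable lebesgue (\<lambda>x. indicator (Q p) x *\<^sub>R m p)"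
        by (intro integrable_scaleR_left) (simp add: emQ del: emeasure_completion)
      have "b p = (\<lambda>x. indicator (Q p) x *\<^sub>R f x - indicator (Q p) x *\<^sub>R m p)"
        by (auto simp: b_def scaleR_diff_right)
      then have "integral\<^sup>L lebesgue (b p) = (\<integral>x. indicator (Q p) x *\<^sub>R f x \<partial>lebesgue) - (\<integral>x. indicator (Q p) x *\<^sub>R m p \<partial>lebesgue)"
        using i1 i2 by simp
      also have "(\<integral>x. indicator (Q p) x *\<^sub>R m p \<partial>lebesgue) = vol p *\<^sub>R m p"
        using vol[of p] by (simp add: measure_def emQ del: emeasure_completion measure_completion)
      finally show ?thesis using vol[of p] by (simp add: m_def scaleR_conv_of_real)
    qed
    show "L1_norm g \<le> ?F"
    proof -
      have "L1_norm g \<le>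
        (\<integral>\<^sup>+x. ennreal (cmod (f x)) * indicator (- (\<Union>p\<in>P. Q p)) x + (\<Sum>p\<in>P. ennreal (cmod (m p)) * indicator (Q p) x) \<partial>lebesgue)"
      proof (intro nn_integral_mono)
        fix x
        show "ennreal (cmod (g x)) \<le> ennreal (cmod (f x)) * indicator (- (\<Union>p\<in>P. Q p)) x + (\<Sum>p\<in>P. ennreal (cmod (m p)) * indicator (Q p) x)"
        proof (cases "x \<in> (\<Union>p\<in>P. Q p)")
          case True
          then obtain p where p: "p \<in> P" "x \<in> Q p" by blast
          have "ennreal (cmod (g x)) \<le> (\<Sum>p\<in>{p}. ennreal (cmod (m p)) * indicator (Q p) x)"
            using p by (simp add: g_in)
          also have "\<dots> \<le> (\<Sum>p\<in>P. ennreal (cmod (m p)) * indicator (Q p) x)"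
            using p P by (intro sum_mono2) auto
          finally show ?thesis by (simp add: add_increasing)
        qed (simp add: g_out)
      qed
      also have "\<dots> = (\<integral>\<^sup>+x. ennreal (cmod (f x)) * indicator (- (\<Union>p\<in>P. Q p)) x \<partial>lebesgue) +
          (\<integral>\<^sup>+x. (\<Sum>p\<in>P. ennreal (cmod (m p)) * indicator (Q p) x) \<partial>lebesgue)"
        using P by (intro nn_integral_add) measurable
      also have "(\<integral>\<^sup>+x. (\<Sum>p\<in>P. ennreal (cmod (m p)) * indicator (Q p) x) \<partial>lebesgue) =
          (\<Sum>p\<in>P. \<integral>\<^sup>+x. ennreal (cmod (m p)) * indicator (Q p) x \<partial>lebesgue)"
        by (rule nn_integral_sum) measurable
      also have "\<dots> = (\<Sum>p\<in>P. ennreal (cmod (m p)) * emeasure lebesgue (Q p))"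
        by (intro sum.cong refl nn_integral_cmult_indicator) measurable
      also have "(\<Sum>p\<in>P. ennreal (cmod (m p)) * emeasure lebesgue (Q p)) \<le> (\<Sum>p\<in>P. \<nu> p)"
        using m\<nu> by (intro sum_mono) (simp add: emQ ennreal_mult' del: emeasure_completion)
      also have "(\<integral>\<^sup>+x. ennreal (cmod (f x)) * indicator (- (\<Union>p\<in>P. Q p)) x \<partial>lebesgue) + (\<Sum>p\<in>P. \<nu> p)
        = (\<integral>\<^sup>+x. ennreal (cmod (f x)) * indicator (- (\<Union>p\<in>P. Q p)) x + ennreal (cmod (f x)) * indicator (\<Union>p\<in>P. Q p) x \<partial>lebesgue)"
        unfolding sum\<nu>[symmetric] using P by (subst nn_integral_add) auto
      also have "\<dots> = ?F" by (intro nn_integral_cong) (auto simp: indicator_def)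
      finally show ?thesis by (simp add: add_left_mono)
    qed
    show "(\<Sum>p\<in>P. L1_norm (b p)) \<le> 2 * ?F"
    proof -
      have "L1_norm (b p) \<le> 2 * \<nu> p" for p
      proof -
        have "L1_norm (b p) \<le> (\<integral>\<^sup>+x. ennreal (cmod (f x)) * indicator (Q p) x + ennreal (cmod (m p)) * indicator (Q p) x \<partial>lebesgue)"
          by (intro nn_integral_mono) (auto simp: b_def indicator_def ennreal_plus[symmetric] norm_triangle_ineq4 simp del: ennreal_plus)
        also have "\<dots> = \<nu> p + ennreal (cmod (m p)) * emeasure lebesgue (Q p)"
          unfolding \<nu>_def by (subst nn_integral_add) (auto simp: nn_integral_cmult_indicator simp del: emeasure_completion)
        also have "\<dots> \<le> \<nu> p + \<nu> p"
          using m\<nu>[of p] by (intro add_left_mono) (simp add: emQ ennreal_mult' del: emeasure_completion)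
        finally show ?thesis by (simp add: mult_2)
      qed
      then have "(\<Sum>p\<in>P. L1_norm (b p)) \<le> (\<Sum>p\<in>P. 2 * \<nu> p)"
        by (intro sum_mono)
      also have "\<dots> \<le> 2 * ?F" unfolding sum_distrib_left[symmetric] using \<nu>_le by (intro mult_left_mono) auto
      finally show ?thesis .
    qed
    let ?C = "unit_ball_vol (real CARD('n)) * (2 * real CARD('n)) ^ CARD('n)"
    have "ennreal \<alpha> * emeasure lebesgue (cball p (2 * r p)) \<le> ennreal ?C * \<nu> p" if "p \<in> P" for p
    proof -
      have "emeasure lebesgue (cball p (2 * r p)) = ennreal (unit_ball_vol (real CARD('n)) * (2 * r p) ^ CARD('n))"
        using r[of p] by (simp add: emeasure_cball)
      also have "unit_ball_vol (real CARD('n)) * (2 * r p) ^ CARD('n) = ?C * vol p"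
        by (simp add: r_def vol_def power_mult_distrib)
      finally have "ennreal \<alpha> * emeasure lebesgue (cball p (2 * r p)) = ennreal ?C * ennreal (\<alpha> * vol p)"
        using \<alpha> vol[of p] by (simp add: ennreal_mult[symmetric] ac_simps del: emeasure_completion)
      also have "\<dots> \<le> ennreal ?C * \<nu> p"
        using lower[OF that] by (intro mult_left_mono) (auto simp: \<nu>_def Q_def vol_def)
      finally show ?thesis .
    qed
    then have "ennreal \<alpha> * (\<Sum>p\<in>P. emeasure lebesgue (cball p (2 * r p))) \<le> (\<Sum>p\<in>P. ennreal ?C * \<nu> p)"
      unfolding sum_distrib_left by (intro sum_mono)
    also have "\<dots> \<le> ennreal ?C * ?F"
      unfolding sum_distrib_left[symmetric] using \<nu>_le by (intro mult_left_mono) auto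
    finally show "ennreal \<alpha> * (\<Sum>p\<in>P. emeasure lebesgue (cball p (2 * r p))) \<le> ennreal ?C * ?F" .
  qed
qed

section \<open>The weak-type estimate and the extension to integrable functions\<close>

lemma Lp_norm_1: "Lp_norm 1 (\<lambda>_. 1) f = L1_norm f"
  by (simp add: Lp_norm_def)

lemma Linf_c_nn_integral_powr_finite:
  fixes f :: "real ^ 'n \<Rightarrow> complex"
  assumes f: "f \<in> Linf_c" and p: "0 < p" and w: "weight w"
  shows "(\<integral>\<^sup>+x. ennreal (cmod (f x) powr p * w x) \<partial>lebesgue) < top"
proof -
  from Linf_cE[OF f] obtain B R where *: "f \<in> borel_measurable lebesgue" "0 < B" "0 < R"
    "\<And>x. cmod (f x) \<le> B" "\<And>x. R < norm x \<Longrightarrow> f x = 0" by metis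
  have w0: "0 < w x" for x using w by (simp add: weight_def)
  have wi: "w absolutely_integrable_on cball 0 R"
    using w by (simp add: weight_def loc_integrable_def)
  then have wi': "integrable lebesgue (\<lambda>x. indicator (cball 0 R) x *\<^sub>R w x)"
    by (simp add: set_integrable_def)
  have "(\<integral>\<^sup>+x. ennreal (cmod (f x) powr p * w x) \<partial>lebesgue) \<le>
    (\<integral>\<^sup>+x. ennreal (B powr p) * ennreal (norm (indicator (cball 0 R) x *\<^sub>R w x)) \<partial>lebesgue)"
  proof (intro nn_integral_mono)
    fix x
    show "ennreal (cmod (f x) powr p * w x) \<le> ennreal (B powr p) * ennreal (norm (indicator (cball 0 R) x *\<^sub>R w x))"
    proof (cases "norm x \<le> R")
      case True
      then show ?thesis using *(4)[of x] w0[of x] p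
        by (simp add: ennreal_mult'[symmetric] ennreal_leI mult_right_mono powr_mono2)
    qed (use * p in auto)
  qed
  also have "\<dots> = ennreal (B powr p) * (\<integral>\<^sup>+x. ennreal (norm (indicator (cball 0 R) x *\<^sub>R w x)) \<partial>lebesgue)"
    using wi' by (intro nn_integral_cmult) (auto dest: borel_measurable_integrable)
  also have "\<dots> < top"
    using wi' by (simp add: ennreal_mult_less_top integrable_iff_bounded)
  finally show ?thesis .
qed

lemma weight_1: "weight (\<lambda>_::real^'n. 1)"
  by (auto simp: weight_def loc_integrable_def intro!: absolutely_integrable_on_const lmeasurable_compact)

lemma Linf_c_Lp_norm_finite:
  fixes f :: "real ^ 'n \<Rightarrow> complex"
  assumes "f \<in> Linf_c" "0 < p" "weight w"
  shows "Lp_norm p w f < top"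
  using Linf_c_nn_integral_powr_finite[OF assms] by (simp add: Lp_norm_def)

lemma Linf_c_subset_Lp_space:
  fixes f :: "real ^ 'n \<Rightarrow> complex"
  assumes "f \<in> Linf_c" "0 < p" "weight w"
  shows "f \<in> Lp_space p w"
  using assms Linf_c_Lp_norm_finite[OF assms] by (simp add: Lp_space_def Linf_c_measurable)

lemma emeasure_Markov:
  assumes "A \<in> sets M" "\<And>x. x \<in> A \<Longrightarrow> c \<le> \<phi> x"
  shows "c * emeasure M A \<le> (\<integral>\<^sup>+x. \<phi> x \<partial>M)"
proof -
  have "c * emeasure M A = (\<integral>\<^sup>+x. c * indicator A x \<partial>M)"
    using assms by (simp add: nn_integral_cmult_indicator)
  also have "\<dots> \<le> (\<integral>\<^sup>+x. \<phi> x \<partial>M)"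
    using assms by (intro nn_integral_mono) (auto simp: indicator_def)
  finally show ?thesis .
qed

text \<open>The existential quantifiers of \<open>cz_operator\<close> are opened once: kernel and
  exponent \<open>s\<close> become parameters, so that all constants below refer to the same
  choice.\<close>

locale dini_cz_operator =
  fixes T :: "(real ^ 'n \<Rightarrow> complex) \<Rightarrow> real ^ 'n \<Rightarrow> complex"
    and \<omega> :: "real \<Rightarrow> real" and K :: "real ^ 'n \<Rightarrow> real ^ 'n \<Rightarrow> complex" and s :: real
  assumes \<omega>: "modulus_of_continuity \<omega>" and dini: "dini \<omega>" and s: "1 < s"
    and bounded: "bounded_on_Ls s T" and kernel: "cz_kernel \<omega> K"
    and representation: "\<And>f. f \<in> Linf_c \<Longrightarrow>
      AE x in lebesgue. x \<notin> closure {y. f y \<noteq> 0} \<longrightarrow> T f x = (\<integral>y. K x y * f y \<partial>lebesgue)"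
begin

lemma T_measurable [measurable]: "f \<in> Linf_c \<Longrightarrow> T f \<in> borel_measurable lebesgue"
  using bounded Linf_c_subset_Lp_space[of f s "\<lambda>_. 1"] s weight_1 by (auto simp: bounded_on_Ls_def)

lemma Linf_c_in_Ls: "f \<in> Linf_c \<Longrightarrow> f \<in> Lp_space s (\<lambda>_. 1)"
  using Linf_c_subset_Lp_space[of f s "\<lambda>_. 1"] s weight_1 by simp

lemma T_add:
  assumes "f \<in> Linf_c" "g \<in> Linf_c"
  shows "AE x in lebesgue. T (\<lambda>y. f y + g y) x = T f x + T g x"
  using bounded assms[THEN Linf_c_in_Ls]
  unfolding bounded_on_Ls_def linear_ae_on_def by blast

lemma T_cmult:
  assumes "f \<in> Linf_c"
  shows "AE x in lebesgue. T (\<lambda>y. c * f y) x = c * T f x"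
  using bounded assms[THEN Linf_c_in_Ls]
  unfolding bounded_on_Ls_def linear_ae_on_def by blast

lemma T_zero: "AE x in lebesgue. T (\<lambda>y. 0) x = 0"
  using T_cmult[of "\<lambda>_. 0" 0] by simp

lemma T_diff:
  assumes "f \<in> Linf_c" "g \<in> Linf_c"
  shows "AE x in lebesgue. T (\<lambda>y. f y - g y) x = T f x - T g x"
  using T_add[OF assms(1) Linf_c_cmult[OF assms(2), of "-1"]] T_cmult[OF assms(2), of "-1"]
  by (simp, eventually_elim) simp

lemma T_sum:
  assumes "finite P" "\<And>p. p \<in> P \<Longrightarrow> b p \<in> Linf_c"
  shows "AE x in lebesgue. T (\<lambda>y. \<Sum>p\<in>P. b p y) x = (\<Sum>p\<in>P. T (b p) x)"
  using assms
proof (induction P rule: finite_induct)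
  case empty
  then show ?case using T_zero by simp
next
  case (insert p P)
  have "AE x in lebesgue. T (\<lambda>y. \<Sum>p\<in>P. b p y) x = (\<Sum>p\<in>P. T (b p) x)"
    using insert by auto
  moreover have "AE x in lebesgue. T (\<lambda>y. b p y + (\<Sum>p\<in>P. b p y)) x = T (b p) x + T (\<lambda>y. \<Sum>p\<in>P. b p y) x"
    using insert by (intro T_add Linf_c_sum) auto
  ultimately show ?case
  proof eventually_elim
    case (elim x)
    then show ?case using insert.hyps by simp
  qed
qed

lemma T_Ls_bound:
  obtains C where "0 < C" "\<And>f. f \<in> Linf_c \<Longrightarrow>
    (\<integral>\<^sup>+x. ennreal (cmod (T f x) powr s) \<partial>lebesgue) \<le> ennreal C * (\<integral>\<^sup>+x. ennreal (cmod (f x) powr s) \<partial>lebesgue)"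
proof -
  obtain C where C: "\<And>f. f \<in> Lp_space s (\<lambda>_. 1) \<Longrightarrow> Lp_norm s (\<lambda>_. 1) (T f) \<le> ennreal C * Lp_norm s (\<lambda>_. 1) f"
    using bounded unfolding bounded_on_Ls_def by blast
  \<comment> \<open>The given constant may be 0 or negative, where \<open>ennreal C\<close> is 0;
    the maximum makes it positive.\<close>
  define C' where "C' = max 1 C"
  have "(\<integral>\<^sup>+x. ennreal (cmod (T f x) powr s) \<partial>lebesgue) \<le> ennreal (C' powr s) * (\<integral>\<^sup>+x. ennreal (cmod (f x) powr s) \<partial>lebesgue)"
    if "f \<in> Linf_c" for f
  proof -
    have "Lp_norm s (\<lambda>_. 1) (T f) \<le> ennreal C * Lp_norm s (\<lambda>_. 1) f"
      using C Linf_c_subset_Lp_space[OF that _ weight_1] s by simp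
    also have "\<dots> \<le> ennreal C' * Lp_norm s (\<lambda>_. 1) f"
      by (intro mult_right_mono ennreal_leI) (auto simp: C'_def)
    finally have "epowr (Lp_norm s (\<lambda>_. 1) (T f)) s \<le> epowr (ennreal C' * Lp_norm s (\<lambda>_. 1) f) s"
      using s by (intro epowr_mono) auto
    then show ?thesis using s by (simp add: Lp_norm_def epowr_mult epowr_epowr C'_def)
  qed
  then show thesis using that[of "C' powr s"] by (simp add: C'_def)
qed

text \<open>The constant of Hoermander's condition for the kernel: a bound for the integral of the
  kernel difference outside a doubled ball, uniform over all balls. The Dini condition makes
  \<open>enn2real\<close> harmless.\<close>

definition dini_const :: real where
  "dini_const = enn2real (ennreal (unit_ball_vol (real CARD('n)) * 2 ^ CARD('n) * 2) * (\<integral>\<^sup>+t\<in>{0<..1}. ennreal (\<omega> t / t) \<partial>lebesgue))"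

lemma dini_const: "0 \<le> dini_const"
  "ennreal dini_const = ennreal (unit_ball_vol (real CARD('n)) * 2 ^ CARD('n) * 2) * (\<integral>\<^sup>+t\<in>{0<..1}. ennreal (\<omega> t / t) \<partial>lebesgue)"
  using dini by (auto simp: dini_const_def dini_def ennreal_mult_less_top)

text \<open>The vanishing mean allows \<open>K x c\<close> to be subtracted from
  \<open>K x y\<close>. Smoothness of the kernel in the second variable then leaves the function
  integrated in \<open>nn_integral_modulus_outside_ball\<close>, times the L1 norm of
  \<open>b\<close>.\<close>

lemma T_mean_zero_outside:
  assumes b: "b \<in> Linf_c" and supp: "\<And>x. x \<notin> cball c r \<Longrightarrow> b x = 0" and r: "0 < r"
    and mean: "integral\<^sup>L lebesgue b = 0"
  shows "(\<integral>\<^sup>+x. ennreal (cmod (T b x)) * indicator (- cball c (2 * r)) x \<partial>lebesgue)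
    \<le> ennreal dini_const * L1_norm b"
proof -
  let ?B = "L1_norm b"
  let ?k = "\<lambda>x. 1 / norm (x - c) ^ CARD('n) * \<omega> (r / norm (x - c))"
  note [measurable] = Linf_c_measurable[OF b]
  have bint: "integrable lebesgue b" by (rule Linf_c_integrable[OF b])
  have "{y. b y \<noteq> 0} \<subseteq> cball c r" using supp by blast
  then have clos: "closure {y. b y \<noteq> 0} \<subseteq> cball c r" by (rule closure_minimal) simp
  \<comment> \<open>Measurability of \<open>K\<close> is not needed, as the integral of a non-integrable function is \<open>0\<close>.\<close>
  have bound: "ennreal (cmod (\<integral>y. K x y * b y \<partial>lebesgue)) \<le> ennreal (?k x) * ?B" if x: "x \<notin> cball c (2 * r)" for x
  proof (cases "integrable lebesgue (\<lambda>y. K x y * b y)")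
    case True
    have xc: "2 * r < norm (c - x)" using x by (simp add: dist_norm)
    have "(\<integral>y. K x y * b y \<partial>lebesgue) = (\<integral>y. K x y * b y \<partial>lebesgue) - (\<integral>y. K x c * b y \<partial>lebesgue)"
      using mean bint by simp
    also have "\<dots> = (\<integral>y. K x y * b y - K x c * b y \<partial>lebesgue)"
      using True bint by simp
    finally have "ennreal (cmod (\<integral>y. K x y * b y \<partial>lebesgue)) \<le> (\<integral>\<^sup>+y. ennreal (cmod (K x y * b y - K x c * b y)) \<partial>lebesgue)"
      using norm_integral_le_nn_integral[of lebesgue "\<lambda>y. K x y * b y - K x c * b y"] by simp
    also have "\<dots> \<le> (\<integral>\<^sup>+y. ennreal (?k x) * ennreal (cmod (b y)) \<partial>lebesgue)"
    proof (intro nn_integral_mono)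
      fix y
      show "ennreal (cmod (K x y * b y - K x c * b y)) \<le> ennreal (?k x) * ennreal (cmod (b y))"
      proof (cases "y \<in> cball c r")
        case y: True
        have yc: "norm (c - y) \<le> r" using y by (simp add: dist_norm)
        \<comment> \<open>Here the doubling of the ball is used: \<open>y\<close> is at most half as
          far from \<open>c\<close> as \<open>x\<close> is. Of the two kernel differences controlled
          below, the one with \<open>x\<close> as first argument is kept.\<close>
        have "c \<noteq> x \<and> norm (c - y) \<le> 1 / 2 * norm (c - x)" using xc yc r by auto
        then have "cmod (K c x - K y x) + cmod (K x c - K x y) \<le> 1 / norm (c - x) ^ CARD('n) * \<omega> (norm (c - y) / norm (c - x))"
          using kernel unfolding cz_kernel_def by blast
        also have "\<dots> \<le> 1 / norm (c - x) ^ CARD('n) * \<omega> (r / norm (c - x))"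
          using yc by (intro mult_left_mono modulus_of_continuity_mono[OF \<omega>] divide_right_mono) auto
        finally have "cmod (K x y - K x c) \<le> ?k x"
          using norm_ge_zero[of "K c x - K y x"] unfolding norm_minus_commute[of "K x y"] norm_minus_commute[of x c] by linarith
        then have "cmod (K x y - K x c) * cmod (b y) \<le> ?k x * cmod (b y)"
          by (rule mult_right_mono) simp
        then have "ennreal (cmod (K x y * b y - K x c * b y)) \<le> ennreal (?k x * cmod (b y))"
          by (intro ennreal_leI) (simp add: left_diff_distrib[symmetric] norm_mult)
        also have "\<dots> = ennreal (?k x) * ennreal (cmod (b y))"
          by (rule ennreal_mult'') simp
        finally show ?thesis .
      qed (simp add: supp)
    qed
    also have "\<dots> = ennreal (?k x) * ?B" by (rule nn_integral_cmult) measurable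
    finally show ?thesis .
  qed (simp add: not_integrable_integral_eq)
  have "(\<integral>\<^sup>+x. ennreal (cmod (T b x)) * indicator (- cball c (2 * r)) x \<partial>lebesgue)
     \<le> (\<integral>\<^sup>+x. (ennreal (?k x) * indicator {x. 2 * r \<le> norm (x - c)} x) * ?B \<partial>lebesgue)"
  proof (intro nn_integral_mono_AE)
    show "AE x in lebesgue. ennreal (cmod (T b x)) * indicator (- cball c (2 * r)) x \<le> (ennreal (?k x) * indicator {x. 2 * r \<le> norm (x - c)} x) * ?B"
      using representation[OF b]
    proof eventually_elim
      fix x assume *: "x \<notin> closure {y. b y \<noteq> 0} \<longrightarrow> T b x = (\<integral>y. K x y * b y \<partial>lebesgue)"
      show "ennreal (cmod (T b x)) * indicator (- cball c (2 * r)) x \<le> (ennreal (?k x) * indicator {x. 2 * r \<le> norm (x - c)} x) * ?B"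
      proof (cases "x \<in> cball c (2 * r)")
        case False
        then have "2 * r < norm (x - c)" by (simp add: dist_norm norm_minus_commute)
        moreover have "x \<notin> cball c r" using False r by auto
        ultimately show ?thesis using * clos bound[OF False] False by auto
      qed simp
    qed
  qed
  also have "\<dots> = (\<integral>\<^sup>+x. ennreal (?k x) * indicator {x. 2 * r \<le> norm (x - c)} x \<partial>lebesgue) * ?B"
  proof (rule nn_integral_multc)
    \<comment> \<open>Continued by a constant to the left of 0, the modulus is monotone on the whole
      line and therefore Borel; its arguments here are nonnegative.\<close>
    have "mono_on {0..} \<omega>" using \<omega> by (simp add: modulus_of_continuity_def)
    then have [measurable]: "(\<lambda>t. \<omega> (max 0 t)) \<in> borel_measurable borel"
      by (intro borel_measurable_mono) (auto simp: mono_def intro: mono_onD)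
    have "(\<lambda>x. ennreal (?k x) * indicator {x. 2 * r \<le> norm (x - c)} x) =
       (\<lambda>x. ennreal (1 / norm (x - c) ^ CARD('n) * \<omega> (max 0 (r / norm (x - c)))) * indicator {x. 2 * r \<le> norm (x - c)} x)"
      using r by (intro ext) (simp add: max_def)
    also have "\<dots> \<in> borel_measurable borel" by measurable
    finally show "(\<lambda>x. ennreal (?k x) * indicator {x. 2 * r \<le> norm (x - c)} x) \<in> borel_measurable lebesgue"
      by (simp add: measurable_completion)
  qed
  also have "\<dots> \<le> ennreal dini_const * ?B"
    unfolding dini_const(2) by (intro mult_right_mono nn_integral_modulus_outside_ball \<omega> r) simp
  finally show ?thesis .
qed

end

lemma sets_level_lebesgue:
  "u \<in> borel_measurable lebesgue \<Longrightarrow> {x. t < cmod (u x)} \<in> sets lebesgue"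
proof -
  assume [measurable]: "u \<in> borel_measurable lebesgue"
  have "{x \<in> space lebesgue. t < cmod (u x)} \<in> sets lebesgue" by measurable
  then show ?thesis by simp
qed

section \<open>Approximation by dyadic step functions\<close>

definition sample :: "real \<Rightarrow> real ^ 'n \<Rightarrow> real ^ 'n" where
  "sample h x = (\<chi> i. of_int \<lfloor>x $ i / h\<rfloor> * h)"

lemma sample_cell: "y \<in> dyadic_cell h 0 x \<Longrightarrow> sample h y = sample h x"
  by (simp add: sample_def dyadic_cell_def)

lemma sample_measurable [measurable]: "sample h \<in> borel_measurable borel"
proof (subst borel_measurable_euclidean_space, intro ballI)
  fix b :: "real ^ 'n" assume "b \<in> Basis"
  then obtain i where "b = axis i 1" by (auto simp: Basis_vec_def)
  then have "(\<lambda>x. sample h x \<bullet> b) = (\<lambda>x. of_int \<lfloor>x $ i / h\<rfloor> * h)"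
    by (auto simp: sample_def inner_axis)
  also have "\<dots> \<in> borel_measurable borel" by measurable
  finally show "(\<lambda>x. sample h x \<bullet> b) \<in> borel_measurable borel" .
qed

lemma norm_sample:
  fixes x :: "real ^ 'n"
  assumes "0 < h" shows "norm (sample h x - x) \<le> real CARD('n) * h"
proof -
  have "\<bar>(sample h x - x) $ i\<bar> \<le> h" for i
  proof -
    have "of_int \<lfloor>x $ i / h\<rfloor> \<le> x $ i / h" "x $ i / h < of_int \<lfloor>x $ i / h\<rfloor> + 1" by linarith+
    then have "of_int \<lfloor>x $ i / h\<rfloor> * h \<le> x $ i" "x $ i < (of_int \<lfloor>x $ i / h\<rfloor> + 1) * h"
      using assms by (simp_all only: pos_le_divide_eq pos_divide_less_eq)
    then show ?thesis by (simp add: sample_def algebra_simps)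
  qed
  then have "(\<Sum>i\<in>UNIV. \<bar>(sample h x - x) $ i\<bar>) \<le> (\<Sum>i\<in>(UNIV::'n set). h)" by (intro sum_mono)
  then show ?thesis using norm_le_l1_cart[of "sample h x - x"] by simp
qed

text \<open>Start from continuous functions converging to f almost everywhere, clip their values to
  the bound of f, and sample them on a grid so fine that uniform continuity costs at most 1 / (n +
  1). The result is uniformly bounded and lives in a fixed ball, so dominated convergence gives all
  exponents p at once with the same sequence.\<close>

lemma Linf_c_step_approximation:
  fixes f :: "real ^ 'n \<Rightarrow> complex"
  assumes f: "f \<in> Linf_c"
  obtains F H where "\<And>n. F n \<in> Linf_c" "\<And>n. 0 < H n" "\<And>n. \<forall>x. \<forall>y\<in>dyadic_cell (H n) 0 x. F n y = F n x"
    "\<And>p. 1 \<le> p \<Longrightarrow> (\<lambda>n. \<integral>\<^sup>+x. ennreal (cmod (F n x - f x) powr p) \<partial>lebesgue) \<longlonglongrightarrow> 0"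
proof -
  from Linf_cE[OF f] obtain B R where fm [measurable]: "f \<in> borel_measurable lebesgue" and BR: "0 < B" "0 < R"
    and fB: "\<And>x. cmod (f x) \<le> B" and fR: "\<And>x. R < norm x \<Longrightarrow> f x = 0" by metis
  let ?d = "real CARD('n)"
  have "f measurable_on UNIV" by (rule lebesgue_measurable_imp_measurable_on) auto
  then obtain N g where N: "negligible N" and g: "\<And>n. continuous_on UNIV (g n)"
    and lim: "\<And>x. x \<notin> N \<Longrightarrow> (\<lambda>n. g n x) \<longlonglongrightarrow> f x"
    unfolding measurable_on_def by auto
  \<comment> \<open>The nearest-point retraction onto a disc containing all values of f: it is
    continuous and fixes f, so clipping keeps the limit.\<close>
  define clip where "clip = closest_point (cball (0::complex) B)"
  have clip_cont: "continuous_on UNIV clip"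
    unfolding clip_def by (rule continuous_on_closest_point) (use BR in auto)
  have clip_B: "cmod (clip z) \<le> B" for z
    using closest_point_in_set[of "cball (0::complex) B" z] BR by (simp add: clip_def)
  have clip_id: "clip z = z" if "cmod z \<le> B" for z
    unfolding clip_def by (rule closest_point_self) (use that in simp)
  define \<phi> where "\<phi> n x = clip (g n x)" for n x
  have \<phi>_cont: "continuous_on UNIV (\<phi> n)" for n
    unfolding \<phi>_def using continuous_on_compose2[OF clip_cont g[of n]] by simp
  have \<phi>_lim: "(\<lambda>n. \<phi> n x) \<longlonglongrightarrow> f x" if "x \<notin> N" for x
  proof -
    have "(\<lambda>n. clip (g n x)) \<longlonglongrightarrow> clip (f x)"
      using clip_cont lim[OF that] by (intro isCont_tendsto_compose[of _ clip]) (auto simp: continuous_on_eq_continuous_at)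
    then show ?thesis by (simp add: \<phi>_def clip_id fB)
  qed
  have "\<exists>h. 0 < h \<and> h \<le> 1 \<and> (\<forall>x. norm x \<le> R + 2 * ?d \<longrightarrow> cmod (\<phi> n (sample h x) - \<phi> n x) \<le> 1 / Suc n)" for n
  proof -
    have "uniformly_continuous_on (cball 0 (R + 3 * ?d)) (\<phi> n)"
      by (rule compact_uniformly_continuous[OF continuous_on_subset[OF \<phi>_cont]]) auto
    then obtain \<delta> where \<delta>: "0 < \<delta>" "\<And>x x'. x \<in> cball 0 (R + 3 * ?d) \<Longrightarrow> x' \<in> cball 0 (R + 3 * ?d) \<Longrightarrow> dist x' x < \<delta> \<Longrightarrow> dist (\<phi> n x') (\<phi> n x) < 1 / Suc n"
      unfolding uniformly_continuous_on_def by (metis of_nat_0_less_iff zero_less_Suc zero_less_divide_1_iff)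
    define h where "h = min 1 (\<delta> / (2 * ?d))"
    have h: "0 < h" "h \<le> 1" "?d * h < \<delta>"
      using \<delta> by (auto simp: h_def min_def field_simps)
    have "cmod (\<phi> n (sample h x) - \<phi> n x) \<le> 1 / Suc n" if "norm x \<le> R + 2 * ?d" for x
    proof -
      have 1: "norm (sample h x - x) \<le> ?d * h" by (rule norm_sample[OF h(1)])
      also have "?d * h \<le> ?d" using h by simp
      finally have "norm (sample h x) \<le> R + 3 * ?d"
        using that norm_triangle_ineq[of "sample h x - x" x] by simp
      then show ?thesis using \<delta>(2)[of x "sample h x"] 1 h that by (simp add: dist_norm less_imp_le)
    qed
    with h show ?thesis by blast
  qed
  then obtain H where H: "\<And>n. 0 < H n" "\<And>n. H n \<le> 1"
    "\<And>n x. norm x \<le> R + 2 * ?d \<Longrightarrow> cmod (\<phi> n (sample (H n) x) - \<phi> n x) \<le> 1 / Suc n" by metis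
  have close: "norm (sample (H n) x - x) \<le> ?d" for n and x :: "real ^ 'n"
  proof -
    have "?d * H n \<le> ?d" using H(2)[of n] by simp
    then show ?thesis using norm_sample[OF H(1)[of n], of x] by linarith
  qed
  \<comment> \<open>The cut-off tests the sample point and not \<open>x\<close>, so
    \<open>F n\<close> stays constant on cells. Sampling moves a point by at most d, since the mesh
    is at most 1: hence the support lies within radius R + 2 d, and points with norm at most R are
    never cut.\<close>
  define F where "F n x = (if norm (sample (H n) x) \<le> R + ?d then \<phi> n (sample (H n) x) else 0)" for n x
  have F_out: "F n x = 0" if "R + 2 * ?d < norm x" for n x
    using close[of n x] that norm_triangle_ineq2[of x "sample (H n) x"] by (auto simp: F_def norm_minus_commute)
  have F_B: "cmod (F n x) \<le> B" for n x using clip_B BR by (simp add: F_def \<phi>_def)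
  have F_meas: "F n \<in> borel_measurable lebesgue" for n
  proof -
    have [measurable]: "\<phi> n \<in> borel_measurable borel" using \<phi>_cont by (rule borel_measurable_continuous_onI)
    have "F n \<in> borel_measurable borel" unfolding F_def by measurable
    then show ?thesis by (simp add: measurable_completion)
  qed
  note [measurable] = F_meas
  have F_lim: "(\<lambda>n. F n x) \<longlonglongrightarrow> f x" if "x \<notin> N" for x
  proof -
    have le: "norm (F n x - f x) \<le> 1 / Suc n + cmod (\<phi> n x - f x)" for n
    proof (cases "norm (sample (H n) x) \<le> R + ?d")
      case True
      then have "norm x \<le> R + 2 * ?d"
        using close[of n x] norm_triangle_ineq2[of x "sample (H n) x"] by (simp add: norm_minus_commute)
      from H(3)[OF this, of n] True show ?thesis
        using norm_triangle_ineq[of "\<phi> n (sample (H n) x) - \<phi> n x" "\<phi> n x - f x"] by (simp add: F_def)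
    next
      case False
      then have "R < norm x"
        using close[of n x] norm_triangle_ineq2[of "sample (H n) x" x] by simp
      then show ?thesis using False by (simp add: F_def fR)
    qed
    have "(\<lambda>n. 1 / Suc n + cmod (\<phi> n x - f x)) \<longlonglongrightarrow> 0 + cmod (f x - f x)"
      by (intro tendsto_intros \<phi>_lim that LIMSEQ_Suc[OF lim_1_over_n])
    then have "(\<lambda>n. 1 / Suc n + cmod (\<phi> n x - f x)) \<longlonglongrightarrow> 0" by simp
    then have "(\<lambda>n. F n x - f x) \<longlonglongrightarrow> 0"
      by (rule Lim_null_comparison[OF always_eventually[OF allI[OF le]]])
    then show ?thesis by (simp add: LIM_zero_iff)
  qed
  show thesis
  proof (rule that[of F H])
    show "F n \<in> Linf_c" for n
      by (rule Linf_cI[where B = B and S = "cball 0 (R + 2 * ?d)"]) (auto simp: F_B F_out)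
    show "0 < H n" for n by fact
    show "\<forall>x. \<forall>y\<in>dyadic_cell (H n) 0 x. F n y = F n x" for n
      using sample_cell by (metis F_def)
    fix p :: real assume p: "1 \<le> p"
    let ?w = "\<lambda>x. ennreal ((2 * B) powr p) * indicator (cball 0 (R + 2 * ?d)) x"
    have "(\<lambda>n. \<integral>\<^sup>+x. ennreal (cmod (F n x - f x) powr p) \<partial>lebesgue) \<longlonglongrightarrow> (\<integral>\<^sup>+x. 0 \<partial>(lebesgue :: (real^'n) measure))"
    proof (rule nn_integral_dominated_convergence[where w = ?w])
      show "?w \<in> borel_measurable lebesgue"
        by (intro borel_measurable_times_ennreal borel_measurable_indicator) auto
      show "(\<integral>\<^sup>+x. ?w x \<partial>lebesgue) < \<infinity>"
        by (subst nn_integral_cmult_indicator) (use BR in \<open>auto simp: emeasure_cball ennreal_mult_less_top\<close>)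
      show "AE x in lebesgue. ennreal (cmod (F n x - f x) powr p) \<le> ?w x" for n
      proof (intro AE_I2)
        fix x
        show "ennreal (cmod (F n x - f x) powr p) \<le> ?w x"
        proof (cases "norm x \<le> R + 2 * ?d")
          case True
          have "cmod (F n x - f x) \<le> 2 * B"
            using norm_triangle_ineq4[of "F n x" "f x"] F_B[of n x] fB[of x] by linarith
          then have "cmod (F n x - f x) powr p \<le> (2 * B) powr p" using p by (intro powr_mono2) auto
          then show ?thesis using True by (simp add: ennreal_leI)
        next
          case False
          then have "R + 2 * ?d < norm x" "R < norm x" by auto
          then show ?thesis using p by (simp add: F_out fR)
        qed
      qed
      have "AE x in lebesgue. x \<notin> N"
        using N by (simp add: negligible_iff_null_sets AE_not_in)
      then show "AE x in lebesgue. (\<lambda>n. ennreal (cmod (F n x - f x) powr p)) \<longlonglongrightarrow> 0"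
      proof eventually_elim
        case (elim x)
        have "(\<lambda>n. cmod (F n x - f x) powr p) \<longlonglongrightarrow> cmod (f x - f x) powr p"
          using p by (intro tendsto_powr' tendsto_intros F_lim elim) auto
        then have "(\<lambda>n. ennreal (cmod (F n x - f x) powr p)) \<longlonglongrightarrow> ennreal 0"
          using p by (intro tendsto_ennrealI) simp
        then show ?case by simp
      qed
    qed measurable
    then show "(\<lambda>n. \<integral>\<^sup>+x. ennreal (cmod (F n x - f x) powr p) \<partial>lebesgue) \<longlonglongrightarrow> 0" by simp
  qed
qed

context dini_cz_operator
begin

text \<open>The decomposition is taken at height \<open>t\<close> itself. The good part is handled
  by Chebyshev in L^s, where |g|^s is at most (2^d t)^(s-1) |g|; the doubled balls by their total
  volume; the bad parts off the doubled balls by Chebyshev in L1. The constant is independent of the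
  mesh \<open>h\<close>, as the passage to general functions requires.\<close>

lemma weak_type_step:
  obtains C where "0 \<le> C" "\<And>h f t. 0 < h \<Longrightarrow> f \<in> Linf_c \<Longrightarrow> \<forall>x. \<forall>y\<in>dyadic_cell h 0 x. f y = f x \<Longrightarrow> 0 < t \<Longrightarrow>
    ennreal t * level_measure (T f) t \<le> ennreal C * L1_norm f"
proof -
  obtain Cs where Cs: "0 < Cs" and Ls: "\<And>f. f \<in> Linf_c \<Longrightarrow>
    (\<integral>\<^sup>+x. ennreal (cmod (T f x) powr s) \<partial>lebesgue) \<le> ennreal Cs * (\<integral>\<^sup>+x. ennreal (cmod (f x) powr s) \<partial>lebesgue)"
    by (rule T_Ls_bound) (rule that; assumption)
  \<comment> \<open>\<open>C1\<close> combines the L^s bound, the level t / 2 and the height 2^d t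
    of the good part; \<open>C2\<close> is the volume constant of the decomposition. In
    \<open>C3\<close> one factor 2 comes from the level t / 2 and the other from the total mass of
    the bad parts.\<close>
  define C1 where "C1 = Cs * 2 powr s * (2 ^ CARD('n)) powr (s - 1)"
  define C2 where "C2 = unit_ball_vol (real CARD('n)) * (2 * real CARD('n)) ^ CARD('n)"
  define C3 where "C3 = 4 * dini_const"
  have nn: "0 \<le> C1" "0 \<le> C2" "0 \<le> C3"
    using Cs dini_const by (auto simp: C1_def C2_def C3_def)
  show thesis
  proof (rule that[of "C1 + C2 + C3"])
    show "0 \<le> C1 + C2 + C3" using nn by simp
    fix h :: real and f :: "real^'n \<Rightarrow> complex" and t :: real
    assume h: "0 < h" and f: "f \<in> Linf_c" and step: "\<forall>x. \<forall>y\<in>dyadic_cell h 0 x. f y = f x" and t: "0 < t"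
    let ?F = "L1_norm f"
    obtain P r b g where P: "finite P" and g: "g \<in> Linf_c" and g_le: "\<And>x. cmod (g x) \<le> 2 ^ CARD('n) * t"
      and gF: "L1_norm g \<le> ?F"
      and b: "\<And>p. p \<in> P \<Longrightarrow> b p \<in> Linf_c" and supp: "\<And>p x. p \<in> P \<Longrightarrow> x \<notin> cball p (r p) \<Longrightarrow> b p x = 0"
      and r: "\<And>p. p \<in> P \<Longrightarrow> 0 < r p" and mean: "\<And>p. p \<in> P \<Longrightarrow> integral\<^sup>L lebesgue (b p) = 0"
      and bF: "(\<Sum>p\<in>P. L1_norm (b p)) \<le> 2 * ?F"
      and dec: "\<And>x. f x = g x + (\<Sum>p\<in>P. b p x)"
      and vol: "ennreal t * (\<Sum>p\<in>P. emeasure lebesgue (cball p (2 * r p))) \<le> ennreal C2 * ?F"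
      by (rule CZ_decomposition[OF h f t step, folded C2_def]) (rule that; assumption)
    note [measurable] = Linf_c_measurable[OF g] T_measurable[OF g] T_measurable[OF f]
    have bmeas [measurable]: "T (b p) \<in> borel_measurable lebesgue" if "p \<in> P" for p using T_measurable[OF b[OF that]] .
    define A1 where "A1 = {x. t / 2 < cmod (T g x)}"
    define U where "U = (\<Union>p\<in>P. cball p (2 * r p))"
    \<comment> \<open>Each bad part is counted only off its own doubled ball, where its integral is
      controlled; off the union \<open>U\<close> this is the full sum.\<close>
    define \<sigma> where "\<sigma> x = (\<Sum>p\<in>P. ennreal (cmod (T (b p) x)) * indicator (- cball p (2 * r p)) x)" for x
    define A3 where "A3 = {x. ennreal (t / 2) < \<sigma> x}"
    have cb: "- cball p (2 * r p) \<in> sets lebesgue" for p :: "real ^ 'n" by (simp add: lborelD)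
    have \<sigma>m [measurable]: "\<sigma> \<in> borel_measurable lebesgue"
      unfolding \<sigma>_def using cb by (intro borel_measurable_sum borel_measurable_times_ennreal borel_measurable_indicator) auto
    have A1m: "A1 \<in> sets lebesgue" unfolding A1_def by (intro sets_level_lebesgue) measurable
    have A3m: "A3 \<in> sets lebesgue"
    proof -
      have "{x \<in> space lebesgue. ennreal (t / 2) < \<sigma> x} \<in> sets lebesgue" by measurable
      then show ?thesis by (simp add: A3_def)
    qed
    have Um: "U \<in> sets lebesgue" unfolding U_def using P by (intro sets.finite_UN) (auto simp: lborelD)
    have E1: "ennreal t * emeasure lebesgue A1 \<le> ennreal C1 * ?F"
    proof -
      have "ennreal ((t/2) powr s) * emeasure lebesgue A1 \<le> (\<integral>\<^sup>+x. ennreal (cmod (T g x) powr s) \<partial>lebesgue)"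
        using A1m t s by (intro emeasure_Markov) (auto simp: A1_def intro!: ennreal_leI powr_mono2)
      also have "\<dots> \<le> ennreal Cs * (\<integral>\<^sup>+x. ennreal (cmod (g x) powr s) \<partial>lebesgue)" by (rule Ls[OF g])
      also have "(\<integral>\<^sup>+x. ennreal (cmod (g x) powr s) \<partial>lebesgue) \<le> (\<integral>\<^sup>+x. ennreal ((2 ^ CARD('n) * t) powr (s - 1)) * ennreal (cmod (g x)) \<partial>lebesgue)"
      proof (intro nn_integral_mono)
        fix x
        have "cmod (g x) powr s = cmod (g x) powr (s - 1) * cmod (g x) powr 1"
          unfolding powr_add[symmetric] by simp
        also have "\<dots> \<le> (2 ^ CARD('n) * t) powr (s - 1) * cmod (g x)"
          using g_le[of x] s by (intro mult_mono powr_mono2) auto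
        finally show "ennreal (cmod (g x) powr s) \<le> ennreal ((2 ^ CARD('n) * t) powr (s - 1)) * ennreal (cmod (g x))"
          by (simp add: ennreal_mult'[symmetric] ennreal_leI)
      qed
      also have "\<dots> = ennreal ((2 ^ CARD('n) * t) powr (s - 1)) * L1_norm g"
        by (rule nn_integral_cmult) measurable
      also have "\<dots> \<le> ennreal ((2 ^ CARD('n) * t) powr (s - 1)) * ?F"
        by (intro mult_left_mono gF) simp
      finally have "ennreal ((t/2) powr s) * emeasure lebesgue A1 \<le> ennreal Cs * (ennreal ((2 ^ CARD('n) * t) powr (s - 1)) * ?F)"
        by (simp add: mult_left_mono)
      then have "ennreal (t / (t/2) powr s) * (ennreal ((t/2) powr s) * emeasure lebesgue A1) \<le>
         ennreal (t / (t/2) powr s) * (ennreal Cs * (ennreal ((2 ^ CARD('n) * t) powr (s - 1)) * ?F))"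
        by (rule mult_left_mono) simp
      moreover have "ennreal (t / (t/2) powr s) * (ennreal ((t/2) powr s) * emeasure lebesgue A1) = ennreal t * emeasure lebesgue A1"
        unfolding mult.assoc[symmetric] using t by (subst ennreal_mult[symmetric]) auto
      moreover have "ennreal (t / (t/2) powr s) * (ennreal Cs * (ennreal ((2 ^ CARD('n) * t) powr (s - 1)) * ?F)) = ennreal C1 * ?F"
      proof -
        have "t / (t/2) powr s * (Cs * (2 ^ CARD('n) * t) powr (s - 1)) = C1"
          using t s by (simp add: C1_def powr_mult powr_divide powr_diff field_simps)
        then show ?thesis using t Cs unfolding mult.assoc[symmetric]
          by (simp add: ennreal_mult[symmetric] mult.assoc)
      qed
      ultimately show ?thesis by simp
    qed
    have E2: "ennreal t * emeasure lebesgue U \<le> ennreal C2 * ?F"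
    proof -
      have "emeasure lebesgue U \<le> (\<Sum>p\<in>P. emeasure lebesgue (cball p (2 * r p)))"
        unfolding U_def using P by (intro emeasure_subadditive_finite) (auto simp: lborelD)
      then have "ennreal t * emeasure lebesgue U \<le> ennreal t * (\<Sum>p\<in>P. emeasure lebesgue (cball p (2 * r p)))"
        by (rule mult_left_mono) simp
      with vol show ?thesis by (rule order_trans[rotated])
    qed
    have E3: "ennreal t * emeasure lebesgue A3 \<le> ennreal C3 * ?F"
    proof -
      have "ennreal (t/2) * emeasure lebesgue A3 \<le> (\<integral>\<^sup>+x. \<sigma> x \<partial>lebesgue)"
        using A3m by (intro emeasure_Markov) (auto simp: A3_def)
      also have "\<dots> = (\<Sum>p\<in>P. \<integral>\<^sup>+x. ennreal (cmod (T (b p) x)) * indicator (- cball p (2 * r p)) x \<partial>lebesgue)"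
        unfolding \<sigma>_def using cb by (intro nn_integral_sum borel_measurable_times_ennreal borel_measurable_indicator) auto
      also have "\<dots> \<le> (\<Sum>p\<in>P. ennreal dini_const * L1_norm (b p))"
        using b supp r mean by (intro sum_mono T_mean_zero_outside) auto
      also have "\<dots> \<le> ennreal dini_const * (2 * ?F)"
        unfolding sum_distrib_left[symmetric] by (intro mult_left_mono bF) simp
      finally have "2 * (ennreal (t/2) * emeasure lebesgue A3) \<le> 2 * (ennreal dini_const * (2 * ?F))"
        by (rule mult_left_mono) simp
      moreover have "2 * (ennreal (t/2) * emeasure lebesgue A3) = ennreal t * emeasure lebesgue A3"
        unfolding mult.assoc[symmetric] using t by (simp add: ennreal_mult'[symmetric] flip: ennreal_numeral)
      moreover have "2 * (ennreal dini_const * (2 * ?F)) = ennreal C3 * ?F"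
      proof -
        have "2 * (ennreal dini_const * (2 * ?F)) = (2 * 2) * ennreal dini_const * ?F" by (simp only: ac_simps)
        also have "(2 * 2) * ennreal dini_const = ennreal C3"
          using dini_const(1) by (simp add: C3_def ennreal_mult')
        finally show ?thesis .
      qed
      ultimately show ?thesis by simp
    qed
    have Tf: "AE x in lebesgue. T f x = T g x + (\<Sum>p\<in>P. T (b p) x)"
    proof -
      have bsum: "(\<lambda>x. \<Sum>p\<in>P. b p x) \<in> Linf_c" using P b by (rule Linf_c_sum)
      have bsumT: "AE x in lebesgue. T (\<lambda>x. \<Sum>p\<in>P. b p x) x = (\<Sum>p\<in>P. T (b p) x)"
        using P b by (rule T_sum)
      have feq: "f = (\<lambda>x. g x + (\<Sum>p\<in>P. b p x))" using dec by auto
      show ?thesis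
        using T_add[OF g bsum] bsumT unfolding feq[symmetric] by eventually_elim simp
    qed
    have "level_measure (T f) t \<le> emeasure lebesgue (A1 \<union> U \<union> A3)"
    proof (rule emeasure_mono_AE)
      show "AE x in lebesgue. x \<in> {x. t < cmod (T f x)} \<longrightarrow> x \<in> A1 \<union> U \<union> A3"
        using Tf
      proof eventually_elim
        case (elim x)
        show ?case
        proof (intro impI, rule ccontr)
          assume x: "x \<in> {x. t < cmod (T f x)}" "x \<notin> A1 \<union> U \<union> A3"
          then have 1: "cmod (T g x) \<le> t / 2" by (simp add: A1_def)
          have "\<sigma> x = (\<Sum>p\<in>P. ennreal (cmod (T (b p) x)))"
            unfolding \<sigma>_def using x by (intro sum.cong) (auto simp: U_def indicator_def)
          also have "\<dots> = ennreal (\<Sum>p\<in>P. cmod (T (b p) x))" by (rule sum_ennreal) simp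
          finally have "(\<Sum>p\<in>P. cmod (T (b p) x)) \<le> t / 2" using x t by (simp add: A3_def not_less)
          then have "cmod (\<Sum>p\<in>P. T (b p) x) \<le> t / 2"
            using norm_sum[of "\<lambda>p. T (b p) x" P] by linarith
          then have "cmod (T f x) \<le> t"
            using 1 norm_triangle_ineq[of "T g x" "\<Sum>p\<in>P. T (b p) x"] unfolding elim by linarith
          with x show False by simp
        qed
      qed
    qed (use A1m Um A3m in auto)
    also have "\<dots> \<le> emeasure lebesgue A1 + emeasure lebesgue U + emeasure lebesgue A3"
      using A1m Um A3m by (intro order_trans[OF emeasure_subadditive] add_mono order_refl emeasure_subadditive) auto
    finally have "ennreal t * level_measure (T f) t \<le> ennreal t * (emeasure lebesgue A1 + emeasure lebesgue U + emeasure lebesgue A3)"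
      by (rule mult_left_mono) simp
    also have "\<dots> \<le> ennreal C1 * ?F + ennreal C2 * ?F + ennreal C3 * ?F"
      unfolding distrib_left by (intro add_mono E1 E2 E3)
    also have "\<dots> = ennreal (C1 + C2 + C3) * ?F"
      using nn by (simp add: ennreal_plus distrib_right)
    finally show "ennreal t * level_measure (T f) t \<le> ennreal (C1 + C2 + C3) * ?F" .
  qed
qed

end

text \<open>Borel-Cantelli: the exceptional sets have summable measures.\<close>

lemma AE_eventually_small:
  fixes v :: "nat \<Rightarrow> 'a \<Rightarrow> complex"
  assumes [measurable]: "\<And>k. v k \<in> borel_measurable M"
    and D: "\<And>k. emeasure M {x \<in> space M. (1/2) ^ k < cmod (v k x)} \<le> ennreal (D * (1/2) ^ k)"
  shows "AE x in M. eventually (\<lambda>k. cmod (v k x) \<le> (1/2) ^ k) sequentially"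
proof -
  define A where "A k = {x \<in> space M. (1/2) ^ k < cmod (v k x)}" for k
  have [measurable]: "A k \<in> sets M" for k unfolding A_def by measurable
  have fin: "emeasure M (A k) < \<infinity>" for k
    using D[of k] unfolding A_def[symmetric] by (simp add: le_less_trans[OF _ ennreal_less_top])
  have le: "measure M (A k) \<le> max 0 D * (1/2) ^ k" for k
  proof -
    have "emeasure M (A k) \<le> ennreal (max 0 D * (1/2) ^ k)"
      using D[of k] unfolding A_def[symmetric]
      by (rule order_trans) (intro ennreal_leI mult_right_mono, auto)
    then show ?thesis unfolding measure_def by (intro enn2real_leI) auto
  qed
  have "summable (\<lambda>k. measure M (A k))"
    by (rule summable_comparison_test'[where g = "\<lambda>k. max 0 D * (1/2) ^ k" and N = 0]) (use le in auto)
  then have "AE x in M. eventually (\<lambda>k. x \<in> space M - A k) sequentially"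
    using fin by (intro borel_cantelli_AE1) auto
  then show ?thesis
    by eventually_elim (auto simp: A_def not_less elim!: eventually_mono)
qed

text \<open>The increments are almost everywhere dominated by a geometric series from some index on,
  so the telescoping series converges.\<close>

lemma AE_convergent_fast:
  fixes u :: "nat \<Rightarrow> 'a \<Rightarrow> complex"
  assumes [measurable]: "\<And>k. u k \<in> borel_measurable M"
    and D: "\<And>k. emeasure M {x \<in> space M. (1/2) ^ k < cmod (u (Suc k) x - u k x)} \<le> ennreal (D * (1/2) ^ k)"
  shows "AE x in M. convergent (\<lambda>k. u k x)"
proof -
  have "AE x in M. eventually (\<lambda>k. cmod (u (Suc k) x - u k x) \<le> (1/2) ^ k) sequentially"
    by (rule AE_eventually_small[OF _ D]) measurable
  then show ?thesis
  proof eventually_elim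
    case (elim x)
    then obtain N where N: "\<And>k. N \<le> k \<Longrightarrow> cmod (u (Suc k) x - u k x) \<le> (1/2) ^ k"
      by (auto simp: eventually_sequentially)
    have "summable (\<lambda>k. u (Suc k) x - u k x)"
      by (rule summable_comparison_test'[where g = "\<lambda>k. (1/2::real) ^ k" and N = N]) (use N in auto)
    then have "convergent (\<lambda>n. \<Sum>k<n. u (Suc k) x - u k x)" by (simp add: summable_iff_convergent)
    then have "convergent (\<lambda>n. u n x - u 0 x)" unfolding sum_lessThan_telescope[of "\<lambda>k. u k x"] .
    then obtain L where "(\<lambda>n. u n x - u 0 x) \<longlonglongrightarrow> L" by (auto simp: convergent_def)
    then have "(\<lambda>n. (u n x - u 0 x) + u 0 x) \<longlonglongrightarrow> L + u 0 x" by (intro tendsto_intros)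
    then show ?case by (auto simp: convergent_def)
  qed
qed

lemma AE_zero_if_levels_null:
  fixes u :: "real ^ 'n \<Rightarrow> complex"
  assumes m: "u \<in> borel_measurable lebesgue"
    and "\<And>t. 0 < t \<Longrightarrow> level_measure u t = 0"
  shows "AE x in lebesgue. u x = 0"
proof -
  have null: "{x. 1 / Suc n < cmod (u x)} \<in> null_sets lebesgue" for n
    using assms by (intro null_setsI sets_level_lebesgue) auto
  have "AE x in lebesgue. \<forall>n. x \<notin> {x. 1 / Suc n < cmod (u x)}"
    unfolding AE_all_countable using AE_not_in[OF null] by blast
  then show ?thesis
  proof eventually_elim
    case (elim x)
    show ?case
    proof (rule ccontr)
      assume "u x \<noteq> 0"
      then obtain n where "1 / Suc n < cmod (u x)"
        using nat_approx_posE[of "cmod (u x)"] by auto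
      with elim show False by blast
    qed
  qed
qed

text \<open>A sum above \<open>t\<close> has a summand above \<open>t / 2\<close>. This halving is
  the source of the factors 2 in the weak bounds below.\<close>

lemma emeasure_level_add:
  fixes u v w :: "real ^ 'n \<Rightarrow> complex"
  assumes "u \<in> borel_measurable lebesgue" "v \<in> borel_measurable lebesgue" "w \<in> borel_measurable lebesgue"
    and "AE x in lebesgue. cmod (w x) \<le> cmod (u x) + cmod (v x)"
  shows "level_measure w t \<le> level_measure u (t / 2) + level_measure v (t / 2)"
proof -
  have m: "{x. t < cmod (w x)} \<in> sets lebesgue" "{x. t / 2 < cmod (u x)} \<in> sets lebesgue" "{x. t / 2 < cmod (v x)} \<in> sets lebesgue"
    by (rule sets_level_lebesgue, fact)+
  have "level_measure w t \<le> emeasure lebesgue ({x. t / 2 < cmod (u x)} \<union> {x. t / 2 < cmod (v x)})"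
    using assms(4) m by (intro emeasure_mono_AE) (auto elim!: eventually_mono)
  also have "\<dots> \<le> level_measure u (t / 2) + level_measure v (t / 2)"
    using m by (intro emeasure_subadditive)
  finally show ?thesis .
qed

text \<open>The strict inequality is an open condition, so at a point of convergence it passes from
  the limit to almost all members of the sequence. Fatou for the indicators does the rest.\<close>

lemma emeasure_level_Fatou:
  fixes u :: "nat \<Rightarrow> real ^ 'n \<Rightarrow> complex"
  assumes "\<And>n. u n \<in> borel_measurable lebesgue" "w \<in> borel_measurable lebesgue"
    and lim: "AE x in lebesgue. (\<lambda>n. u n x) \<longlonglongrightarrow> w x"
  shows "level_measure w t \<le> liminf (\<lambda>n. level_measure (u n) t)"
proof -
  have m [measurable]: "{x. t < cmod (w x)} \<in> sets lebesgue" "\<And>n. {x. t < cmod (u n x)} \<in> sets lebesgue"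
    using assms by (auto intro: sets_level_lebesgue)
  have "level_measure w t = (\<integral>\<^sup>+x. indicator {x. t < cmod (w x)} x \<partial>lebesgue)"
    using m by simp
  also have "\<dots> \<le> (\<integral>\<^sup>+x. liminf (\<lambda>n. indicator {x. t < cmod (u n x)} x) \<partial>lebesgue)"
  proof (rule nn_integral_mono_AE)
    show "AE x in lebesgue. (indicator {x. t < cmod (w x)} x :: ennreal) \<le> liminf (\<lambda>n. indicator {x. t < cmod (u n x)} x)"
      using lim
    proof eventually_elim
      case (elim x)
      show ?case
      proof (cases "t < cmod (w x)")
        case True
        have "(\<lambda>n. cmod (u n x)) \<longlonglongrightarrow> cmod (w x)" by (intro tendsto_norm elim)
        then have "eventually (\<lambda>n. t < cmod (u n x)) sequentially" using True by (rule order_tendstoD)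
        then have "eventually (\<lambda>n. (1::ennreal) \<le> indicator {x. t < cmod (u n x)} x) sequentially"
          by eventually_elim simp
        then have "1 \<le> liminf (\<lambda>n. indicator {x. t < cmod (u n x)} x :: ennreal)" by (rule Liminf_bounded)
        then show ?thesis using True by simp
      qed simp
    qed
  qed
  also have "\<dots> \<le> liminf (\<lambda>n. \<integral>\<^sup>+x. indicator {x. t < cmod (u n x)} x \<partial>lebesgue)"
    by (intro nn_integral_liminf) measurable
  also have "\<dots> = liminf (\<lambda>n. level_measure (u n) t)"
    using m by simp
  finally show ?thesis .
qed

lemma tendsto_0_ennreal_le:
  fixes a b :: "nat \<Rightarrow> ennreal"
  assumes "\<And>n. a n \<le> b n" "b \<longlonglongrightarrow> 0"
  shows "a \<longlonglongrightarrow> 0"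
  by (rule tendsto_sandwich[of "\<lambda>_. 0" a _ b]) (use assms in auto)

section \<open>Truncation of integrable functions\<close>

lemma Lp_space_1_iff:
  "f \<in> Lp_space 1 (\<lambda>_. 1) \<longleftrightarrow> f \<in> borel_measurable lebesgue \<and> L1_norm f < top"
  by (simp add: Lp_space_def Lp_norm_1)

text \<open>Cut in value and in domain at once. Large values are set to 0, so the truncation and its
  error are both dominated by |f|, and every point is left unchanged from some \<open>n\<close>
  on.\<close>

definition truncation :: "nat \<Rightarrow> (real ^ 'n \<Rightarrow> complex) \<Rightarrow> real ^ 'n \<Rightarrow> complex" where
  "truncation n f x = (if cmod (f x) \<le> real n \<and> norm x \<le> real n then f x else 0)"

lemma truncation_Linf_c:
  fixes f :: "real ^ 'n \<Rightarrow> complex"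
  assumes [measurable]: "f \<in> borel_measurable lebesgue"
  shows "truncation n f \<in> Linf_c"
proof (rule Linf_cI[where B = n and S = "cball 0 n"])
  have [measurable]: "(\<lambda>x::real^'n. norm x) \<in> borel_measurable lebesgue"
    by (simp add: measurable_completion)
  show "truncation n f \<in> borel_measurable lebesgue"
    unfolding truncation_def by measurable
qed (auto simp: truncation_def)

lemma truncation_le: "cmod (truncation n f x) \<le> cmod (f x)"
  by (simp add: truncation_def)

lemma truncation_tendsto_L1:
  fixes f :: "real ^ 'n \<Rightarrow> complex"
  assumes f: "f \<in> Lp_space 1 (\<lambda>_. 1)"
  shows "(\<lambda>n. L1_norm (\<lambda>x. truncation n f x - f x)) \<longlonglongrightarrow> 0"
proof -
  have fm [measurable]: "f \<in> borel_measurable lebesgue" and fin: "L1_norm f < top"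
    using f by (auto simp: Lp_space_1_iff)
  note [measurable] = Linf_c_measurable[OF truncation_Linf_c[OF fm]]
  have "(\<lambda>n. L1_norm (\<lambda>x. truncation n f x - f x)) \<longlonglongrightarrow> (\<integral>\<^sup>+x. 0 \<partial>(lebesgue :: (real^'n) measure))"
  proof (rule nn_integral_dominated_convergence[where w = "\<lambda>x. ennreal (cmod (f x))"])
    show "AE x in lebesgue. ennreal (cmod (truncation n f x - f x)) \<le> ennreal (cmod (f x))" for n
      by (intro AE_I2 ennreal_leI) (simp add: truncation_def)
    show "AE x in lebesgue. (\<lambda>n. ennreal (cmod (truncation n f x - f x))) \<longlonglongrightarrow> 0"
    proof (intro AE_I2)
      fix x
      obtain N where N: "max (cmod (f x)) (norm x) \<le> real N" using real_arch_simple by blast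
      have "eventually (\<lambda>n. ennreal (cmod (truncation n f x - f x)) = 0) sequentially"
        using eventually_ge_at_top[of N]
      proof eventually_elim
        case (elim n)
        then have "max (cmod (f x)) (norm x) \<le> real n" using N by linarith
        then show ?case by (simp add: truncation_def)
      qed
      then show "(\<lambda>n. ennreal (cmod (truncation n f x - f x))) \<longlonglongrightarrow> 0" by (rule tendsto_eventually)
    qed
  qed (use fin in auto)
  then show ?thesis by simp
qed

text \<open>The rate is adapted to the weak bound: an L1 error of 4^(-k) tested at level 2^(-k)
  gives a set of measure of order 2^(-k), which is summable.\<close>

lemma truncation_sequence:
  fixes f :: "real ^ 'n \<Rightarrow> complex"
  assumes f: "f \<in> Lp_space 1 (\<lambda>_. 1)"
  obtains F where "\<And>k. F k \<in> Linf_c" "\<And>k x. cmod (F k x) \<le> cmod (f x)"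
    "\<And>k. L1_norm (\<lambda>x. F k x - f x) \<le> ennreal ((1/4) ^ k)"
proof -
  have "\<exists>n. L1_norm (\<lambda>x. truncation n f x - f x) < ennreal ((1/4) ^ k)" for k
  proof -
    have "eventually (\<lambda>n. L1_norm (\<lambda>x. truncation n f x - f x) < ennreal ((1/4) ^ k)) sequentially"
      by (rule order_tendstoD[OF truncation_tendsto_L1[OF f]]) simp
    then show ?thesis by (rule eventually_happens'[rotated]) simp
  qed
  then obtain \<sigma> where "\<And>k. (L1_norm (\<lambda>x. truncation (\<sigma> k) f x - f x)) < ennreal ((1/4) ^ k)" by metis
  moreover have "f \<in> borel_measurable lebesgue" using f by (simp add: Lp_space_1_iff)
  ultimately show thesis
    using that[of "\<lambda>k. truncation (\<sigma> k) f"] truncation_Linf_c[of f] truncation_le[of _ f] by (simp add: less_imp_le)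
qed

lemma ennreal_quarter_power_bound:
  assumes "ennreal ((1/2) ^ k) * m \<le> ennreal (C * (1/4) ^ k)"
  shows "m \<le> ennreal (C * (1/2) ^ k)"
proof -
  have "m = ennreal (2 ^ k) * (ennreal ((1/2) ^ k) * m)"
    unfolding mult.assoc[symmetric] by (subst ennreal_mult[symmetric]) (auto simp: power_divide)
  also have "\<dots> \<le> ennreal (2 ^ k) * ennreal (C * (1/4) ^ k)"
    by (intro mult_left_mono assms) simp
  also have "\<dots> = ennreal (2 ^ k * (C * (1/4) ^ k))" by (rule ennreal_mult'[symmetric]) simp
  also have "2 ^ k * (C * (1/4) ^ k) = C * (2 * (1/4)) ^ k" unfolding power_mult_distrib by simp
  finally show ?thesis by simp
qed

lemma nn_integral_norm_diff_le:
  fixes f g h :: "real ^ 'n \<Rightarrow> complex"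
  assumes [measurable]: "f \<in> borel_measurable lebesgue" "g \<in> borel_measurable lebesgue" "h \<in> borel_measurable lebesgue"
  shows "L1_norm (\<lambda>x. f x - h x) \<le>
    L1_norm (\<lambda>x. f x - g x) + L1_norm (\<lambda>x. h x - g x)"
proof -
  have "L1_norm (\<lambda>x. f x - h x) \<le> (\<integral>\<^sup>+x. ennreal (cmod (f x - g x)) + ennreal (cmod (h x - g x)) \<partial>lebesgue)"
  proof (intro nn_integral_mono)
    fix x
    have "cmod (f x - h x) \<le> cmod (f x - g x) + cmod (h x - g x)"
      using norm_triangle_ineq4[of "f x - g x" "h x - g x"] by simp
    then show "ennreal (cmod (f x - h x)) \<le> ennreal (cmod (f x - g x)) + ennreal (cmod (h x - g x))"
      by (simp flip: ennreal_plus)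
  qed
  also have "\<dots> = L1_norm (\<lambda>x. f x - g x) + L1_norm (\<lambda>x. h x - g x)"
    by (rule nn_integral_add) measurable
  finally show ?thesis .
qed

section \<open>The weak (1,1) bound and the construction of the extension\<close>

context dini_cz_operator
begin

text \<open>Step functions \<open>F n\<close> converge to f in L1 and in L^s simultaneously. The
  first makes the weak bound for \<open>F n\<close> converge; the second lets the level sets of
  \<open>T (F n - f)\<close> disappear, by the boundedness on L^s. Splitting the level costs the
  factor 2.\<close>

lemma weak_type_Linf_c:
  obtains C where "0 \<le> C" "\<And>f t. f \<in> Linf_c \<Longrightarrow> 0 < t \<Longrightarrow>
    ennreal t * level_measure (T f) t \<le> ennreal C * L1_norm f"
proof -
  obtain Cs where Cs: "0 < Cs" and Ls: "\<And>f. f \<in> Linf_c \<Longrightarrow>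
    (\<integral>\<^sup>+x. ennreal (cmod (T f x) powr s) \<partial>lebesgue) \<le> ennreal Cs * (\<integral>\<^sup>+x. ennreal (cmod (f x) powr s) \<partial>lebesgue)"
    by (rule T_Ls_bound) (rule that; assumption)
  obtain C where C: "0 \<le> C" and weak: "\<And>h f t. 0 < h \<Longrightarrow> f \<in> Linf_c \<Longrightarrow> \<forall>x. \<forall>y\<in>dyadic_cell h 0 x. f y = f x \<Longrightarrow> 0 < t \<Longrightarrow>
    ennreal t * level_measure (T f) t \<le> ennreal C * L1_norm f"
    by (rule weak_type_step) (rule that; assumption)
  show thesis
  proof (rule that[of "2 * C"])
    fix f :: "real ^ 'n \<Rightarrow> complex" and t :: real
    assume f: "f \<in> Linf_c" and t: "0 < t"
    let ?m = "\<lambda>u t. level_measure u t"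
    obtain F H where F: "\<And>n. F n \<in> Linf_c" and H: "\<And>n. 0 < H n"
      and step: "\<And>n. \<forall>x. \<forall>y\<in>dyadic_cell (H n) 0 x. F n y = F n x"
      and lim: "\<And>p. 1 \<le> p \<Longrightarrow> (\<lambda>n. \<integral>\<^sup>+x. ennreal (cmod (F n x - f x) powr p) \<partial>lebesgue) \<longlonglongrightarrow> 0"
      by (rule Linf_c_step_approximation[OF f]) (rule that; assumption)
    note [measurable] = Linf_c_measurable[OF f] Linf_c_measurable[OF F]
    define a where "a n = L1_norm (\<lambda>x. F n x - f x)" for n
    define c where "c n = (\<integral>\<^sup>+x. ennreal (cmod (F n x - f x) powr s) \<partial>lebesgue)" for n
    have a0: "a \<longlonglongrightarrow> 0" using lim[of 1] unfolding a_def by simp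
    have c0: "c \<longlonglongrightarrow> 0" using lim[of s] s unfolding c_def by simp
    let ?k = "ennreal (t * Cs / (t/2) powr s)"
    have "ennreal t * ?m (T f) t \<le> ennreal (2 * C) * (L1_norm f + a n) + ?k * c n" for n
    proof -
      have D: "(\<lambda>x. F n x - f x) \<in> Linf_c" by (intro Linf_c_diff F f)
      have "?m (T f) t \<le> ?m (T (F n)) (t/2) + ?m (T (\<lambda>x. F n x - f x)) (t/2)"
      proof (rule emeasure_level_add)
        show "AE x in lebesgue. cmod (T f x) \<le> cmod (T (F n) x) + cmod (T (\<lambda>x. F n x - f x) x)"
          using T_diff[OF F[of n] f]
        proof eventually_elim
          case (elim x)
          then show ?case using norm_triangle_ineq4[of "T (F n) x" "T (F n) x - T f x"] by simp
        qed
      qed (intro T_measurable f F D)+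
      then have "ennreal t * ?m (T f) t \<le> ennreal t * (?m (T (F n)) (t/2) + ?m (T (\<lambda>x. F n x - f x)) (t/2))"
        by (rule mult_left_mono) simp
      also have "\<dots> = ennreal t * ?m (T (F n)) (t/2) + ennreal t * ?m (T (\<lambda>x. F n x - f x)) (t/2)"
        by (rule distrib_left)
      also have "ennreal t * ?m (T (F n)) (t/2) \<le> ennreal (2 * C) * (L1_norm f + a n)"
      proof -
        have "ennreal t * ?m (T (F n)) (t/2) = 2 * (ennreal (t/2) * ?m (T (F n)) (t/2))"
          unfolding mult.assoc[symmetric] using t by (simp add: ennreal_mult'[symmetric] flip: ennreal_numeral)
        also have "\<dots> \<le> 2 * (ennreal C * L1_norm (F n))"
          using t by (intro mult_left_mono weak[OF H F step]) auto
        also have "L1_norm (F n) \<le> L1_norm f + a n"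
          using nn_integral_norm_diff_le[of "F n" f "\<lambda>_. 0"] unfolding a_def by (simp add: add.commute)
        finally show ?thesis using C by (simp add: ennreal_mult' mult.assoc mult_left_mono)
      qed
      also have "ennreal t * ?m (T (\<lambda>x. F n x - f x)) (t/2) \<le> ?k * c n"
      proof -
        have "ennreal ((t/2) powr s) * ?m (T (\<lambda>x. F n x - f x)) (t/2) \<le> (\<integral>\<^sup>+x. ennreal (cmod (T (\<lambda>x. F n x - f x) x) powr s) \<partial>lebesgue)"
        proof (rule emeasure_Markov)
          show "{x. t/2 < cmod (T (\<lambda>x. F n x - f x) x)} \<in> sets lebesgue"
            by (rule sets_level_lebesgue[OF T_measurable[OF D]])
        qed (use t s in \<open>auto intro!: ennreal_leI powr_mono2\<close>)
        also have "\<dots> \<le> ennreal Cs * c n" unfolding c_def by (rule Ls[OF D])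
        finally have "ennreal (t / (t/2) powr s) * (ennreal ((t/2) powr s) * ?m (T (\<lambda>x. F n x - f x)) (t/2)) \<le> ennreal (t / (t/2) powr s) * (ennreal Cs * c n)"
          by (rule mult_left_mono) simp
        moreover have "ennreal (t / (t/2) powr s) * (ennreal ((t/2) powr s) * ?m (T (\<lambda>x. F n x - f x)) (t/2)) = ennreal t * ?m (T (\<lambda>x. F n x - f x)) (t/2)"
          unfolding mult.assoc[symmetric] using t by (subst ennreal_mult[symmetric]) auto
        moreover have "ennreal (t / (t/2) powr s) * (ennreal Cs * c n) = ?k * c n"
          unfolding mult.assoc[symmetric] using t Cs by (subst ennreal_mult[symmetric]) auto
        ultimately show ?thesis by simp
      qed
      finally show ?thesis by (simp add: add_mono)
    qed
    moreover have "(\<lambda>n. ennreal (2 * C) * (L1_norm f + a n) + ?k * c n) \<longlonglongrightarrow> ennreal (2 * C) * (L1_norm f + 0) + ?k * 0"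
      using a0 c0 by (intro tendsto_add ennreal_tendsto_cmult tendsto_const) auto
    ultimately show "ennreal t * ?m (T f) t \<le> ennreal (2 * C) * L1_norm f"
      using Lim_bounded2[of _ _ 0 "ennreal t * ?m (T f) t"] by simp
  qed (use C in simp)
qed

text \<open>The closure of the graph of T on \<open>Linf_c\<close>, with convergence in L1 for the
  arguments and in measure for the values. As a relation it can be shown to be linear and of weak
  type first; that it is a function then follows from these.\<close>

definition L1_limit :: "(real ^ 'n \<Rightarrow> complex) \<Rightarrow> (real ^ 'n \<Rightarrow> complex) \<Rightarrow> bool" where
  "L1_limit f h \<longleftrightarrow> f \<in> borel_measurable lebesgue \<and> h \<in> borel_measurable lebesgue \<and>
    (\<exists>F. (\<forall>n. F n \<in> Linf_c) \<and> (\<lambda>n. L1_norm (\<lambda>x. F n x - f x)) \<longlonglongrightarrow> 0 \<and>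
      (\<forall>\<epsilon>>0. (\<lambda>n. level_measure (\<lambda>x. T (F n) x - h x) \<epsilon>) \<longlonglongrightarrow> 0))"

lemma L1_limit_Linf_c: "f \<in> Linf_c \<Longrightarrow> L1_limit f (T f)"
  unfolding L1_limit_def by (auto intro!: exI[of _ "\<lambda>_. f"] simp: Linf_c_measurable T_measurable)

lemma L1_limit_add:
  assumes "L1_limit f h" "L1_limit g k"
  shows "L1_limit (\<lambda>x. f x + g x) (\<lambda>x. h x + k x)"
proof -
  from assms obtain F G where m [measurable]: "f \<in> borel_measurable lebesgue" "h \<in> borel_measurable lebesgue"
      "g \<in> borel_measurable lebesgue" "k \<in> borel_measurable lebesgue"
    and F: "\<And>n. F n \<in> Linf_c" "(\<lambda>n. L1_norm (\<lambda>x. F n x - f x)) \<longlonglongrightarrow> 0"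
       "\<And>\<epsilon>. 0 < \<epsilon> \<Longrightarrow> (\<lambda>n. level_measure (\<lambda>x. T (F n) x - h x) \<epsilon>) \<longlonglongrightarrow> 0"
    and G: "\<And>n. G n \<in> Linf_c" "(\<lambda>n. L1_norm (\<lambda>x. G n x - g x)) \<longlonglongrightarrow> 0"
       "\<And>\<epsilon>. 0 < \<epsilon> \<Longrightarrow> (\<lambda>n. level_measure (\<lambda>x. T (G n) x - k x) \<epsilon>) \<longlonglongrightarrow> 0"
    unfolding L1_limit_def by blast
  note [measurable] = Linf_c_measurable[OF F(1)] Linf_c_measurable[OF G(1)] T_measurable[OF F(1)] T_measurable[OF G(1)]
  have FG: "(\<lambda>x. F n x + G n x) \<in> Linf_c" for n by (intro Linf_c_add F G)
  note [measurable] = T_measurable[OF FG]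
  have sum0: "(\<lambda>n. a n + b n) \<longlonglongrightarrow> 0" if "a \<longlonglongrightarrow> 0" "b \<longlonglongrightarrow> 0" for a b :: "nat \<Rightarrow> ennreal"
    using tendsto_add[OF that] by simp
  have "(\<lambda>n. L1_norm (\<lambda>x. F n x + G n x - (f x + g x))) \<longlonglongrightarrow> 0"
  proof (rule tendsto_0_ennreal_le[OF _ sum0[OF F(2) G(2)]])
    fix n
    show "(L1_norm (\<lambda>x. F n x + G n x - (f x + g x))) \<le>
      L1_norm (\<lambda>x. F n x - f x) + L1_norm (\<lambda>x. G n x - g x)"
      using nn_integral_norm_diff_le[of "\<lambda>x. F n x - f x" "\<lambda>_. 0" "\<lambda>x. g x - G n x"]
      by (simp add: norm_minus_commute algebra_simps)
  qed
  moreover have "(\<lambda>n. level_measure (\<lambda>x. T (\<lambda>x. F n x + G n x) x - (h x + k x)) \<epsilon>) \<longlonglongrightarrow> 0" if "0 < \<epsilon>" for \<epsilon>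
  proof (rule tendsto_0_ennreal_le[OF _ sum0[OF F(3) G(3)]])
    fix n
    show "level_measure (\<lambda>x. T (\<lambda>x. F n x + G n x) x - (h x + k x)) \<epsilon> \<le>
      level_measure (\<lambda>x. T (F n) x - h x) (\<epsilon>/2) + level_measure (\<lambda>x. T (G n) x - k x) (\<epsilon>/2)"
    proof (rule emeasure_level_add)
      show "AE x in lebesgue. cmod (T (\<lambda>x. F n x + G n x) x - (h x + k x)) \<le> cmod (T (F n) x - h x) + cmod (T (G n) x - k x)"
        using T_add[OF F(1)[of n] G(1)[of n]]
      proof eventually_elim
        case (elim x)
        then show ?case using norm_triangle_ineq[of "T (F n) x - h x" "T (G n) x - k x"] by (simp add: algebra_simps)
      qed
    qed measurable
  qed (use that in auto)
  ultimately show ?thesis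
    unfolding L1_limit_def using FG by (intro conjI exI[of _ "\<lambda>n x. F n x + G n x"]) auto
qed

lemma L1_limit_cmult:
  assumes "L1_limit f h"
  shows "L1_limit (\<lambda>x. c * f x) (\<lambda>x. c * h x)"
\<comment> \<open>For nonzero c, level \<epsilon> of the multiple is level \<epsilon> / |c| of the
  original. For c = 0 the zero sequence is taken instead.\<close>
proof (cases "c = 0")
  case True
  have *: "L1_limit (\<lambda>x. 0) (T (\<lambda>x. 0))" by (rule L1_limit_Linf_c) simp
  have eq: "level_measure (\<lambda>x. T (\<lambda>x. 0) x) \<epsilon> = 0" if "0 < \<epsilon>" for \<epsilon>
  proof -
    have "level_measure (\<lambda>x. T (\<lambda>x. 0) x) \<epsilon> \<le> emeasure lebesgue ({} :: (real^'n) set)"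
      using T_zero that by (intro emeasure_mono_AE) (auto elim!: eventually_mono)
    then show ?thesis by simp
  qed
  show ?thesis unfolding L1_limit_def True
    by (intro conjI exI[of _ "\<lambda>_ _. 0"]) (auto simp: eq)
next
  case False
  from assms obtain F where m [measurable]: "f \<in> borel_measurable lebesgue" "h \<in> borel_measurable lebesgue"
    and F: "\<And>n. F n \<in> Linf_c" "(\<lambda>n. L1_norm (\<lambda>x. F n x - f x)) \<longlonglongrightarrow> 0"
       "\<And>\<epsilon>. 0 < \<epsilon> \<Longrightarrow> (\<lambda>n. level_measure (\<lambda>x. T (F n) x - h x) \<epsilon>) \<longlonglongrightarrow> 0"
    unfolding L1_limit_def by blast
  note [measurable] = Linf_c_measurable[OF F(1)] T_measurable[OF F(1)]
  have cF: "(\<lambda>x. c * F n x) \<in> Linf_c" for n by (intro Linf_c_cmult F)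
  note [measurable] = T_measurable[OF cF]
  have "(\<lambda>n. ennreal (cmod c) * L1_norm (\<lambda>x. F n x - f x)) \<longlonglongrightarrow> ennreal (cmod c) * 0"
    by (intro ennreal_tendsto_cmult F(2)) simp
  moreover have "L1_norm (\<lambda>x. c * F n x - c * f x) = ennreal (cmod c) * L1_norm (\<lambda>x. F n x - f x)" for n
    by (subst nn_integral_cmult[symmetric]) (auto simp: right_diff_distrib[symmetric] norm_mult ennreal_mult')
  ultimately have 1: "(\<lambda>n. L1_norm (\<lambda>x. c * F n x - c * f x)) \<longlonglongrightarrow> 0" by simp
  have 2: "(\<lambda>n. level_measure (\<lambda>x. T (\<lambda>x. c * F n x) x - c * h x) \<epsilon>) \<longlonglongrightarrow> 0" if "0 < \<epsilon>" for \<epsilon>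
  proof (rule tendsto_0_ennreal_le[OF _ F(3)[of "\<epsilon> / cmod c"]])
    fix n
    show "level_measure (\<lambda>x. T (\<lambda>x. c * F n x) x - c * h x) \<epsilon> \<le> level_measure (\<lambda>x. T (F n) x - h x) (\<epsilon> / cmod c)"
    proof (rule emeasure_mono_AE)
      show "AE x in lebesgue. x \<in> {x. \<epsilon> < cmod (T (\<lambda>x. c * F n x) x - c * h x)} \<longrightarrow> x \<in> {x. \<epsilon> / cmod c < cmod (T (F n) x - h x)}"
        using T_cmult[OF F(1)[of n], of c]
      proof eventually_elim
        case (elim x)
        have "T (\<lambda>x. c * F n x) x - c * h x = c * (T (F n) x - h x)"
          unfolding elim by (simp only: right_diff_distrib)
        then show ?case using False by (simp add: norm_mult pos_divide_less_eq mult.commute)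
      qed
    qed (intro sets_level_lebesgue, measurable)
  qed (use that False in simp)
  show ?thesis unfolding L1_limit_def
    using 1 2 cF by (intro conjI exI[of _ "\<lambda>n x. c * F n x"]) auto
qed

text \<open>Half of the level is given to the difference, whose level set vanishes in the limit by
  convergence in measure, and half to \<open>T (F n)\<close>, where the weak bound on
  \<open>Linf_c\<close> applies.\<close>

lemma L1_limit_weak_type:
  obtains C where "0 \<le> C" "\<And>f h t. L1_limit f h \<Longrightarrow> 0 < t \<Longrightarrow>
    ennreal t * level_measure h t \<le> ennreal C * L1_norm f"
proof -
  obtain C where C: "0 \<le> C" and weak: "\<And>f t. f \<in> Linf_c \<Longrightarrow> 0 < t \<Longrightarrow>
    ennreal t * level_measure (T f) t \<le> ennreal C * L1_norm f"
    by (rule weak_type_Linf_c) (rule that; assumption)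
  show thesis
  proof (rule that[of "2 * C"])
    fix f h t assume *: "L1_limit f h" and t: "(0::real) < t"
    let ?m = "\<lambda>u t. level_measure u t"
    from * obtain F where m [measurable]: "f \<in> borel_measurable lebesgue" "h \<in> borel_measurable lebesgue"
      and F: "\<And>n. F n \<in> Linf_c" "(\<lambda>n. L1_norm (\<lambda>x. F n x - f x)) \<longlonglongrightarrow> 0"
         "\<And>\<epsilon>. 0 < \<epsilon> \<Longrightarrow> (\<lambda>n. level_measure (\<lambda>x. T (F n) x - h x) \<epsilon>) \<longlonglongrightarrow> 0"
      unfolding L1_limit_def by blast
    note [measurable] = Linf_c_measurable[OF F(1)] T_measurable[OF F(1)]
    define a where "a n = L1_norm (\<lambda>x. F n x - f x)" for n
    define c where "c n = level_measure (\<lambda>x. T (F n) x - h x) (t/2)" for n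
    have a0: "a \<longlonglongrightarrow> 0" unfolding a_def by (rule F(2))
    have c0: "c \<longlonglongrightarrow> 0" unfolding c_def using t by (intro F(3)) simp
    have "ennreal t * ?m h t \<le> ennreal (2 * C) * (L1_norm f + a n) + ennreal t * c n" for n
    proof -
      have "?m h t \<le> ?m (T (F n)) (t/2) + c n"
        unfolding c_def
      proof (rule emeasure_level_add)
        show "AE x in lebesgue. cmod (h x) \<le> cmod (T (F n) x) + cmod (T (F n) x - h x)"
        proof (intro AE_I2)
          fix x show "cmod (h x) \<le> cmod (T (F n) x) + cmod (T (F n) x - h x)"
            using norm_triangle_ineq4[of "T (F n) x" "T (F n) x - h x"] by simp
        qed
      qed measurable
      then have "ennreal t * ?m h t \<le> ennreal t * (?m (T (F n)) (t/2) + c n)"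
        by (rule mult_left_mono) simp
      also have "\<dots> = ennreal t * ?m (T (F n)) (t/2) + ennreal t * c n"
        by (rule distrib_left)
      also have "ennreal t * ?m (T (F n)) (t/2) \<le> ennreal (2 * C) * (L1_norm f + a n)"
      proof -
        have "ennreal t * ?m (T (F n)) (t/2) = 2 * (ennreal (t/2) * ?m (T (F n)) (t/2))"
          unfolding mult.assoc[symmetric] using t by (simp add: ennreal_mult'[symmetric] flip: ennreal_numeral)
        also have "\<dots> \<le> 2 * (ennreal C * L1_norm (F n))"
          using t by (intro mult_left_mono weak[OF F(1)]) auto
        also have "L1_norm (F n) \<le> L1_norm f + a n"
          using nn_integral_norm_diff_le[of "F n" f "\<lambda>_. 0"] unfolding a_def by (simp add: add.commute)
        finally show ?thesis using C by (simp add: ennreal_mult' mult.assoc mult_left_mono)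
      qed
      finally show ?thesis by (simp add: add_mono)
    qed
    moreover have "(\<lambda>n. ennreal (2 * C) * (L1_norm f + a n) + ennreal t * c n) \<longlonglongrightarrow> ennreal (2 * C) * (L1_norm f + 0) + ennreal t * 0"
      using a0 c0 by (intro tendsto_add ennreal_tendsto_cmult tendsto_const) auto
    ultimately show "ennreal t * ?m h t \<le> ennreal (2 * C) * L1_norm f"
      using Lim_bounded2[of _ _ 0 "ennreal t * ?m h t"] by simp
  qed (use C in simp)
qed

text \<open>By linearity h - k is a limit value for the zero function, and the weak bound with L1
  norm 0 makes all its level sets null.\<close>

lemma L1_limit_unique:
  assumes "L1_limit f h" "L1_limit f k"
  shows "AE x in lebesgue. h x = k x"
proof -
  obtain C where weak: "\<And>f h t. L1_limit f h \<Longrightarrow> 0 < t \<Longrightarrow>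
    ennreal t * level_measure h t \<le> ennreal C * L1_norm f"
    by (rule L1_limit_weak_type) (rule that; assumption)
  have L: "L1_limit (\<lambda>x. f x + (-1) * f x) (\<lambda>x. h x + (-1) * k x)"
    by (intro L1_limit_add L1_limit_cmult assms)
  have m: "h \<in> borel_measurable lebesgue" "k \<in> borel_measurable lebesgue" using assms by (auto simp: L1_limit_def)
  have "AE x in lebesgue. h x - k x = 0"
  proof (rule AE_zero_if_levels_null)
    show "(\<lambda>x. h x - k x) \<in> borel_measurable lebesgue" using m by (rule borel_measurable_diff)
    show "level_measure (\<lambda>x. h x - k x) t = 0" if "0 < t" for t
      using weak[OF L that] that by simp
  qed
  then show ?thesis by eventually_elim simp
qed

text \<open>For truncations with error 4^(-k), the weak bound makes the increments of
  \<open>T (F k)\<close> exceed 2^(-k) only on sets of summable measure, hence there is an almost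
  everywhere limit.\<close>

lemma L1_limit_exists:
  assumes f: "f \<in> Lp_space 1 (\<lambda>_. 1)"
  shows "\<exists>h. L1_limit f h"
proof -
  have fm [measurable]: "f \<in> borel_measurable lebesgue" using f by (simp add: Lp_space_1_iff)
  obtain C where C: "0 \<le> C" and weak: "\<And>f t. f \<in> Linf_c \<Longrightarrow> 0 < t \<Longrightarrow>
    ennreal t * level_measure (T f) t \<le> ennreal C * L1_norm f"
    by (rule weak_type_Linf_c) (rule that; assumption)
  obtain F where F: "\<And>k. F k \<in> Linf_c" and NF: "\<And>k. L1_norm (\<lambda>x. F k x - f x) \<le> ennreal ((1/4) ^ k)"
    by (rule truncation_sequence[OF f]) (rule that; assumption)
  note [measurable] = Linf_c_measurable[OF F] T_measurable[OF F]
  have diff: "ennreal t * level_measure (\<lambda>x. T (F i) x - T (F j) x) t \<le> ennreal C * (ennreal ((1/4) ^ i) + ennreal ((1/4) ^ j))"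
    if t: "0 < t" for t i j
  proof -
    have D: "(\<lambda>x. F i x - F j x) \<in> Linf_c" by (intro Linf_c_diff F)
    have "level_measure (\<lambda>x. T (F i) x - T (F j) x) t \<le> level_measure (\<lambda>x. T (\<lambda>x. F i x - F j x) x) t"
      using T_diff[OF F F, of i j]
      by (intro emeasure_mono_AE sets_level_lebesgue T_measurable D) (auto elim!: eventually_mono)
    then have "ennreal t * level_measure (\<lambda>x. T (F i) x - T (F j) x) t \<le> ennreal C * L1_norm (\<lambda>x. F i x - F j x)"
      using weak[OF D t] by (meson mult_left_mono order_trans zero_le)
    also have "L1_norm (\<lambda>x. F i x - F j x) \<le> ennreal ((1/4) ^ i) + ennreal ((1/4) ^ j)"
      using nn_integral_norm_diff_le[of "F i" f "F j"] NF[of i] NF[of j] by (meson add_mono order_trans Linf_c_measurable F fm)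
    finally show ?thesis by (simp add: mult_left_mono)
  qed
  have "AE x in lebesgue. convergent (\<lambda>k. T (F k) x)"
  proof (rule AE_convergent_fast)
    fix k
    show "emeasure lebesgue {x \<in> space lebesgue. (1/2) ^ k < cmod (T (F (Suc k)) x - T (F k) x)} \<le> ennreal (2 * C * (1/2) ^ k)"
    proof -
      let ?m = "level_measure (\<lambda>x. T (F (Suc k)) x - T (F k) x) ((1/2) ^ k)"
      have "ennreal ((1/2) ^ k) * ?m \<le> ennreal C * (ennreal ((1/4) ^ Suc k) + ennreal ((1/4) ^ k))"
        by (rule diff) simp
      also have "\<dots> = ennreal (C * ((1/4) ^ Suc k + (1/4) ^ k))"
        using C by (simp add: ennreal_mult' del: power_Suc)
      also have "\<dots> \<le> ennreal (2 * C * (1/4) ^ k)"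
        using C by (intro ennreal_leI) (auto simp: mult_left_mono algebra_simps)
      finally show ?thesis by (simp add: ennreal_quarter_power_bound)
    qed
  qed measurable
  then have conv: "AE x in lebesgue. (\<lambda>k. T (F k) x) \<longlonglongrightarrow> lim (\<lambda>k. T (F k) x)"
    by eventually_elim (simp add: convergent_LIMSEQ_iff)
  define h where "h x = lim (\<lambda>k. T (F k) x)" for x
  have hm [measurable]: "h \<in> borel_measurable lebesgue" unfolding h_def by measurable
  have p4: "(\<lambda>n. ennreal ((1/4) ^ n)) \<longlonglongrightarrow> 0"
    using tendsto_ennrealI[OF LIMSEQ_power_zero[of "1/4::real"]] by simp
  have "(\<lambda>n. level_measure (\<lambda>x. T (F n) x - h x) \<epsilon>) \<longlonglongrightarrow> 0" if \<epsilon>: "0 < \<epsilon>" for \<epsilon>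
  proof (rule tendsto_0_ennreal_le)
    let ?k = "ennreal (1 / \<epsilon>) * ennreal C"
    have "(\<lambda>n. ?k * ennreal ((1/4) ^ n)) \<longlonglongrightarrow> ?k * 0"
      by (intro ennreal_tendsto_cmult p4) (simp add: ennreal_mult_less_top)
    then show "(\<lambda>n. ?k * ennreal ((1/4) ^ n)) \<longlonglongrightarrow> 0" by simp
    fix n
    \<comment> \<open>Fatou in the second index turns the Cauchy estimate between
      \<open>T (F n)\<close> and \<open>T (F j)\<close> into a rate of convergence in measure to
      \<open>h\<close>.\<close>
    have "level_measure (\<lambda>x. T (F n) x - h x) \<epsilon> \<le> liminf (\<lambda>j. level_measure (\<lambda>x. T (F n) x - T (F j) x) \<epsilon>)"
    proof (rule emeasure_level_Fatou)
      show "AE x in lebesgue. (\<lambda>j. T (F n) x - T (F j) x) \<longlonglongrightarrow> T (F n) x - h x"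
        using conv by eventually_elim (auto simp: h_def intro!: tendsto_intros)
    qed measurable
    also have "\<dots> \<le> liminf (\<lambda>j. ?k * (ennreal ((1/4) ^ n) + ennreal ((1/4) ^ j)))"
    proof (rule Liminf_mono, rule always_eventually, rule allI)
      fix j
      let ?m = "level_measure (\<lambda>x. T (F n) x - T (F j) x) \<epsilon>"
      have "ennreal (1/\<epsilon>) * (ennreal \<epsilon> * ?m) \<le> ennreal (1/\<epsilon>) * (ennreal C * (ennreal ((1/4) ^ n) + ennreal ((1/4) ^ j)))"
        by (intro mult_left_mono diff \<epsilon>) simp
      also have "ennreal (1/\<epsilon>) * (ennreal \<epsilon> * ?m) = ?m"
        unfolding mult.assoc[symmetric] using \<epsilon> by (subst ennreal_mult[symmetric]) auto
      finally show "?m \<le> ?k * (ennreal ((1/4) ^ n) + ennreal ((1/4) ^ j))" by (simp add: mult.assoc)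
    qed
    also have "\<dots> = ?k * (ennreal ((1/4) ^ n) + 0)"
      by (intro lim_imp_Liminf ennreal_tendsto_cmult tendsto_add tendsto_const p4) (auto simp: ennreal_mult_less_top)
    finally show "level_measure (\<lambda>x. T (F n) x - h x) \<epsilon> \<le> ?k * ennreal ((1/4) ^ n)" by simp
  qed
  moreover have "(\<lambda>n. L1_norm (\<lambda>x. F n x - f x)) \<longlonglongrightarrow> 0"
    by (rule tendsto_0_ennreal_le[OF NF p4])
  ultimately have "L1_limit f h" unfolding L1_limit_def using F by (intro conjI exI[of _ F]) auto
  then show ?thesis by (intro exI[of _ h])
qed

text \<open>\<open>L1_ext\<close> is a choice, so one witness suffices: any selection from the
  relation \<open>L1_limit\<close>, whose linearity almost everywhere comes from uniqueness. From
  here on the extension is known only through the clauses of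
  \<open>weak_L1_extension\<close>.\<close>

lemma weak_L1_extension_L1_ext: "weak_L1_extension T (L1_ext T)"
  unfolding L1_ext_def
proof (rule someI_ex[of "weak_L1_extension T"])
  define S where "S f = (SOME h. L1_limit f h)" for f
  have S': "L1_limit f (S f)" if "L1_limit f h" for f h
    unfolding S_def using that by (intro someI[of "L1_limit f" h])
  have S: "L1_limit f (S f)" if "f \<in> Lp_space 1 (\<lambda>_. 1)" for f
    using L1_limit_exists[OF that] S' by blast
  have in1: "f \<in> Lp_space 1 (\<lambda>_. 1)" if "f \<in> Linf_c" for f :: "real ^ 'n \<Rightarrow> complex"
    using Linf_c_subset_Lp_space[OF that _ weight_1] by simp
  obtain C where weak: "\<And>f h t. L1_limit f h \<Longrightarrow> 0 < t \<Longrightarrow>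
    ennreal t * level_measure h t \<le> ennreal C * L1_norm f"
    by (rule L1_limit_weak_type) (rule that; assumption)
  have "weak_L1_extension T S"
    unfolding weak_L1_extension_def linear_ae_on_def
  proof (intro conjI ballI allI exI[of _ C] impI)
    fix f :: "real ^ 'n \<Rightarrow> complex" assume "f \<in> Linf_c"
    then show "AE x in lebesgue. S f x = T f x"
      by (intro L1_limit_unique[of f] S in1 L1_limit_Linf_c)
  next
    fix f g :: "real ^ 'n \<Rightarrow> complex" assume fg: "f \<in> Lp_space 1 (\<lambda>_. 1)" "g \<in> Lp_space 1 (\<lambda>_. 1)"
    then have L: "L1_limit (\<lambda>x. f x + g x) (\<lambda>x. S f x + S g x)" by (intro L1_limit_add S)
    then have "L1_limit (\<lambda>x. f x + g x) (S (\<lambda>x. f x + g x))" by (rule S')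
    from L1_limit_unique[OF this L] show "AE x in lebesgue. S (\<lambda>y. f y + g y) x = S f x + S g x" .
  next
    fix f :: "real ^ 'n \<Rightarrow> complex" and c assume "f \<in> Lp_space 1 (\<lambda>_. 1)"
    then have L: "L1_limit (\<lambda>x. c * f x) (\<lambda>x. c * S f x)" by (intro L1_limit_cmult S)
    then have "L1_limit (\<lambda>x. c * f x) (S (\<lambda>x. c * f x))" by (rule S')
    from L1_limit_unique[OF this L] show "AE x in lebesgue. S (\<lambda>y. c * f y) x = c * S f x" .
  next
    fix f :: "real ^ 'n \<Rightarrow> complex" assume "f \<in> Lp_space 1 (\<lambda>_. 1)"
    from S[OF this] show "S f \<in> borel_measurable lebesgue" by (simp add: L1_limit_def)
  next
    fix f :: "real ^ 'n \<Rightarrow> complex" and t :: real assume "f \<in> Lp_space 1 (\<lambda>_. 1)" "0 < t"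
    then show "ennreal t * level_measure (S f) t \<le> ennreal C * Lp_norm 1 (\<lambda>_. 1) f"
      unfolding Lp_norm_1 by (intro weak S)
  qed
  then show "\<exists>S. weak_L1_extension T S" by blast
qed

end

section \<open>Sufficiency\<close>

text \<open>Lets an operator norm, defined as an infimum of constants, act as a constant itself. The
  side conditions exclude the two failures caused by \<open>0 * top = 0\<close>: an empty
  \<open>A\<close> with \<open>b = 0\<close>, and an infimum 0 that is not attained with
  \<open>b = top\<close>.\<close>

lemma ennreal_le_mult_Inf:
  fixes a b :: ennreal
  assumes "A \<noteq> {}" "b < top" "\<And>N. N \<in> A \<Longrightarrow> a \<le> N * b"
  shows "a \<le> Inf A * b"
proof (cases "b = 0")
  case True
  then show ?thesis using assms by fastforce
next
  case False
  have "a / b \<le> Inf A"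
    using False assms by (intro Inf_greatest divide_le_posI_ennreal) (auto simp: zero_less_iff_neq_zero mult.commute)
  then have "a / b * b \<le> Inf A * b" by (rule mult_right_mono) simp
  then show ?thesis using False assms(2) by (simp add: ennreal_divide_times)
qed

lemma loc_integrable_measurable:
  fixes f :: "real ^ 'n \<Rightarrow> 'b::euclidean_space"
  assumes "loc_integrable f"
  shows "f \<in> borel_measurable lebesgue"
proof (rule borel_measurable_LIMSEQ_metric)
  fix n :: nat
  have "f absolutely_integrable_on cball 0 (real n)" using assms by (simp add: loc_integrable_def)
  then have "integrable lebesgue (\<lambda>x. indicator (cball 0 (real n)) x *\<^sub>R f x)" by (simp add: set_integrable_def)
  then show "(\<lambda>x. indicator (cball 0 (real n)) x *\<^sub>R f x) \<in> borel_measurable lebesgue"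
    by (rule borel_measurable_integrable)
next
  fix x :: "real ^ 'n"
  obtain N where N: "norm x \<le> real N" using real_arch_simple by blast
  have "eventually (\<lambda>n. indicator (cball 0 (real n)) x *\<^sub>R f x = f x) sequentially"
    using eventually_ge_at_top[of N]
  proof eventually_elim
    case (elim n)
    then have "norm x \<le> real n" using N by linarith
    then show ?case by simp
  qed
  then show "(\<lambda>n. indicator (cball 0 (real n)) x *\<^sub>R f x) \<longlonglongrightarrow> f x" by (rule tendsto_eventually)
qed

lemma loc_integrable_mult_Linf_c:
  fixes b f :: "real ^ 'n \<Rightarrow> complex"
  assumes b: "loc_integrable b" and f: "f \<in> Linf_c"
  shows "(\<lambda>x. b x * f x) \<in> Lp_space 1 (\<lambda>_. 1)"
proof -
  from Linf_cE[OF f] obtain B R where *: "f \<in> borel_measurable lebesgue" "0 < B" "0 < R"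
    "\<And>x. cmod (f x) \<le> B" "\<And>x. R < norm x \<Longrightarrow> f x = 0" by metis
  note [measurable] = *(1) loc_integrable_measurable[OF b]
  have "b absolutely_integrable_on cball 0 R" using b by (simp add: loc_integrable_def)
  then have bi: "integrable lebesgue (\<lambda>x. indicator (cball 0 R) x *\<^sub>R b x)" by (simp add: set_integrable_def)
  have "L1_norm (\<lambda>x. b x * f x) \<le> (\<integral>\<^sup>+x. ennreal B * ennreal (norm (indicator (cball 0 R) x *\<^sub>R b x)) \<partial>lebesgue)"
  proof (intro nn_integral_mono)
    fix x
    show "ennreal (cmod (b x * f x)) \<le> ennreal B * ennreal (norm (indicator (cball 0 R) x *\<^sub>R b x))"
    proof (cases "norm x \<le> R")
      case True
      then show ?thesis using *(2) *(4)[of x]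
        by (simp add: norm_mult ennreal_mult'[symmetric] ennreal_leI mult.commute[of "cmod (b x)"] mult_right_mono)
    qed (use * in auto)
  qed
  also have "\<dots> = ennreal B * (\<integral>\<^sup>+x. ennreal (norm (indicator (cball 0 R) x *\<^sub>R b x)) \<partial>lebesgue)"
    by (intro nn_integral_cmult measurable_compose[OF borel_measurable_integrable[OF integrable_norm[OF bi]] measurable_ennreal])
  also have "\<dots> < top" using bi by (simp add: ennreal_mult_less_top integrable_iff_bounded)
  finally show ?thesis by (simp add: Lp_space_1_iff)
qed

lemma loc_integrable_diff_const:
  fixes b :: "real ^ 'n \<Rightarrow> complex"
  assumes "loc_integrable b" shows "loc_integrable (\<lambda>x. b x - c)"
  using assms unfolding loc_integrable_def
  by (auto intro!: set_integral_diff absolutely_integrable_on_const lmeasurable_compact)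

lemma Lp_norm_cong_AE:
  assumes "AE x in lebesgue. f x = g x"
  shows "Lp_norm p w f = Lp_norm p w g"
  unfolding Lp_norm_def
  by (rule arg_cong2[where f = epowr, OF nn_integral_cong_AE refl]) (use assms in \<open>auto elim!: eventually_mono\<close>)

lemma Lp_norm_mono:
  assumes "0 < p" "\<And>x. 0 \<le> w x" "\<And>x. cmod (f x) \<le> cmod (g x)"
  shows "Lp_norm p w f \<le> Lp_norm p w g"
  unfolding Lp_norm_def using assms
  by (intro epowr_mono nn_integral_mono ennreal_leI mult_right_mono powr_mono2) auto

lemma Lp_norm_eq_0_AE:
  assumes "weight w" "f \<in> borel_measurable lebesgue" "Lp_norm p w f = 0"
  shows "AE x in lebesgue. f x = 0"
proof -
  have [measurable]: "f \<in> borel_measurable lebesgue" "w \<in> borel_measurable lebesgue"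
    using assms loc_integrable_measurable by (auto simp: weight_def)
  have "(\<integral>\<^sup>+x. ennreal (cmod (f x) powr p * w x) \<partial>lebesgue) = 0" using assms by (simp add: Lp_norm_def)
  then have "AE x in lebesgue. ennreal (cmod (f x) powr p * w x) = 0"
    by (subst (asm) nn_integral_0_iff_AE) auto
  then show ?thesis
  proof eventually_elim
    case (elim x)
    have "0 < w x" using assms by (simp add: weight_def)
    moreover have "cmod (f x) powr p * w x \<le> 0" using elim by (simp add: ennreal_eq_0_iff)
    ultimately have "\<not> 0 < cmod (f x) powr p" by (auto simp: mult_le_0_iff)
    then show ?case by auto
  qed
qed

lemma Lp_norm_Fatou:
  fixes u :: "nat \<Rightarrow> real ^ 'n \<Rightarrow> complex"
  assumes p: "0 < p" and w: "weight w"
    and m: "\<And>n. u n \<in> borel_measurable lebesgue" and lim: "AE x in lebesgue. (\<lambda>n. u n x) \<longlonglongrightarrow> h x"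
    and bound: "\<And>n. Lp_norm p w (u n) \<le> A"
  shows "Lp_norm p w h \<le> A"
proof (cases A)
  case (real a)
  have [measurable]: "w \<in> borel_measurable lebesgue"
    using w loc_integrable_measurable by (auto simp: weight_def)
  note [measurable] = m
  have I: "(\<integral>\<^sup>+x. ennreal (cmod (u n x) powr p * w x) \<partial>lebesgue) \<le> ennreal (a powr p)" for n
    using bound[of n] Lp_norm_le_iff[OF p real(1), of w "u n"] real(2) by simp
  have "(\<integral>\<^sup>+x. ennreal (cmod (h x) powr p * w x) \<partial>lebesgue) \<le> (\<integral>\<^sup>+x. liminf (\<lambda>n. ennreal (cmod (u n x) powr p * w x)) \<partial>lebesgue)"
  proof (rule nn_integral_mono_AE)
    show "AE x in lebesgue. ennreal (cmod (h x) powr p * w x) \<le> liminf (\<lambda>n. ennreal (cmod (u n x) powr p * w x))"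
      using lim
    proof eventually_elim
      case (elim x)
      have "(\<lambda>n. ennreal (cmod (u n x) powr p * w x)) \<longlonglongrightarrow> ennreal (cmod (h x) powr p * w x)"
        using p by (intro tendsto_ennrealI tendsto_mult tendsto_const tendsto_powr' tendsto_norm elim) auto
      then show ?case by (simp add: lim_imp_Liminf)
    qed
  qed
  also have "\<dots> \<le> liminf (\<lambda>n. \<integral>\<^sup>+x. ennreal (cmod (u n x) powr p * w x) \<partial>lebesgue)"
    by (intro nn_integral_liminf) measurable
  also have "\<dots> \<le> liminf (\<lambda>n. ennreal (a powr p))"
    by (intro Liminf_mono always_eventually allI I)
  finally show ?thesis using Lp_norm_le_iff[OF p real(1), of w h] real(2) by (simp add: Liminf_const)
qed simp

lemma op_norm_leI:
  assumes "0 \<le> N" "\<And>f. f \<in> D \<Longrightarrow> Lp_norm q \<nu> (U f) \<le> ennreal N * Lp_norm p \<mu> f"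
  shows "op_norm D p \<mu> q \<nu> U \<le> ennreal N"
  unfolding op_norm_def using assms by (intro Inf_lower) auto

lemma op_norm_attained:
  assumes "op_norm D p \<mu> q \<nu> U < top" "f \<in> D" "Lp_norm p \<mu> f < top"
  shows "Lp_norm q \<nu> (U f) \<le> op_norm D p \<mu> q \<nu> U * Lp_norm p \<mu> f"
  unfolding op_norm_def
proof (rule ennreal_le_mult_Inf)
  show "{ennreal N |N. 0 \<le> N \<and> (\<forall>f\<in>D. Lp_norm q \<nu> (U f) \<le> ennreal N * Lp_norm p \<mu> f)} \<noteq> {}"
    using assms(1) unfolding op_norm_def by (metis (lifting) Inf_empty less_irrefl)
qed (use assms in auto)

context dini_cz_operator
begin

abbreviation "S \<equiv> L1_ext T"

lemma ext_eq: "f \<in> Linf_c \<Longrightarrow> AE x in lebesgue. S f x = T f x"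
  using weak_L1_extension_L1_ext by (simp add: weak_L1_extension_def)

lemma ext_measurable: "f \<in> Lp_space 1 (\<lambda>_. 1) \<Longrightarrow> S f \<in> borel_measurable lebesgue"
  using weak_L1_extension_L1_ext by (simp add: weak_L1_extension_def)

lemma ext_add: "f \<in> Lp_space 1 (\<lambda>_. 1) \<Longrightarrow> g \<in> Lp_space 1 (\<lambda>_. 1) \<Longrightarrow>
    AE x in lebesgue. S (\<lambda>y. f y + g y) x = S f x + S g x"
  using weak_L1_extension_L1_ext by (simp add: weak_L1_extension_def linear_ae_on_def)

lemma ext_weak_type:
  obtains C where "0 \<le> C" "\<And>f t. f \<in> Lp_space 1 (\<lambda>_. 1) \<Longrightarrow> 0 < t \<Longrightarrow>
    ennreal t * level_measure (S f) t \<le> ennreal C * L1_norm f"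
proof -
  obtain C where C: "\<And>f t. f \<in> Lp_space 1 (\<lambda>_. 1) \<Longrightarrow> 0 < t \<Longrightarrow>
    ennreal t * level_measure (S f) t \<le> ennreal C * L1_norm f"
    using weak_L1_extension_L1_ext unfolding weak_L1_extension_def Lp_norm_1 by blast
  show thesis
  proof (rule that[of "max 0 C"])
    fix f :: "real ^ 'n \<Rightarrow> complex" and t :: real assume "f \<in> Lp_space 1 (\<lambda>_. 1)" "0 < t"
    from C[OF this] show "ennreal t * level_measure (S f) t \<le> ennreal (max 0 C) * L1_norm f"
      by (rule order_trans) (intro mult_right_mono ennreal_leI, auto)
  qed simp
qed

text \<open>The weak bound with L1 norm 0; by linearity this is what makes the extension independent
  of representatives.\<close>

lemma ext_zero:
  assumes f: "f \<in> Lp_space 1 (\<lambda>_. 1)" and 0: "AE x in lebesgue. f x = 0"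
  shows "AE x in lebesgue. S f x = 0"
proof -
  obtain C where C: "\<And>f t. f \<in> Lp_space 1 (\<lambda>_. 1) \<Longrightarrow> 0 < t \<Longrightarrow>
    ennreal t * level_measure (S f) t \<le> ennreal C * L1_norm f"
    by (rule ext_weak_type) (rule that; assumption)
  have "L1_norm f = (\<integral>\<^sup>+x. 0 \<partial>(lebesgue :: (real^'n) measure))"
    using 0 by (intro nn_integral_cong_AE) (auto elim!: eventually_mono)
  then have "level_measure (S f) t = 0" if "0 < t" for t
    using C[OF f that] that by simp
  then show ?thesis by (intro AE_zero_if_levels_null ext_measurable f)
qed

text \<open>T commutes with the constant c. The identity holds almost everywhere because linearity
  of the extension and its agreement with T hold only in that sense.\<close>

lemma commutator_shift:
  assumes b: "loc_integrable b" and f: "f \<in> Linf_c"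
  shows "AE x in lebesgue. commutator b T f x = (b x - c) * T f x - S (\<lambda>y. (b y - c) * f y) x"
proof -
  have cf: "(\<lambda>y. c * f y) \<in> Linf_c" by (rule Linf_c_cmult[OF f])
  have "AE x in lebesgue. S (\<lambda>y. (b y - c) * f y + c * f y) x = S (\<lambda>y. (b y - c) * f y) x + S (\<lambda>y. c * f y) x"
    by (intro ext_add loc_integrable_mult_Linf_c[OF loc_integrable_diff_const[OF b] f] Linf_c_subset_Lp_space[OF cf _ weight_1]) simp
  moreover have "(\<lambda>y. (b y - c) * f y + c * f y) = (\<lambda>y. b y * f y)" by (auto simp: algebra_simps)
  ultimately have "AE x in lebesgue. S (\<lambda>y. b y * f y) x = S (\<lambda>y. (b y - c) * f y) x + S (\<lambda>y. c * f y) x" by simp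
  then show ?thesis using ext_eq[OF cf] T_cmult[OF f, of c]
  proof eventually_elim
    case (elim x)
    then show ?case by (simp add: commutator_def algebra_simps)
  qed
qed

text \<open>No constant is lost: the weak bound for \<open>S (F k - f)\<close> only identifies the
  almost everywhere limit of \<open>T (F k)\<close> as \<open>S f\<close>. The norm estimate comes
  from Fatou together with |F k| \<le> |f|, which is why truncations and not step functions
  approximate f here: the weighted norm of \<open>F k\<close> stays below that of f.\<close>

lemma ext_Lp_bound:
  assumes q: "0 < q" and \<nu>: "weight \<nu>" and f: "f \<in> Lp_space 1 (\<lambda>_. 1)"
    and T: "\<And>g. g \<in> Linf_c \<Longrightarrow> Lp_norm q \<nu> (T g) \<le> N * Lp_norm q \<nu> g"
  shows "Lp_norm q \<nu> (S f) \<le> N * Lp_norm q \<nu> f"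
proof -
  have fm [measurable]: "f \<in> borel_measurable lebesgue" using f by (simp add: Lp_space_1_iff)
  obtain C where C: "0 \<le> C" and weak: "\<And>f t. f \<in> Lp_space 1 (\<lambda>_. 1) \<Longrightarrow> 0 < t \<Longrightarrow>
    ennreal t * level_measure (S f) t \<le> ennreal C * L1_norm f"
    by (rule ext_weak_type) (rule that; assumption)
  obtain F where F: "\<And>k. F k \<in> Linf_c" and F_le: "\<And>k x. cmod (F k x) \<le> cmod (f x)"
    and NF: "\<And>k. L1_norm (\<lambda>x. F k x - f x) \<le> ennreal ((1/4) ^ k)"
    by (rule truncation_sequence[OF f]) (rule that; assumption)
  note [measurable] = Linf_c_measurable[OF F] T_measurable[OF F] ext_measurable[OF f]
  have D: "(\<lambda>x. F k x - f x) \<in> Lp_space 1 (\<lambda>_. 1)" for k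
  proof -
    have "L1_norm (\<lambda>x. F k x - f x) < top" using NF[of k] by (rule le_less_trans) simp
    then show ?thesis by (simp add: Lp_space_1_iff)
  qed
  have "AE x in lebesgue. eventually (\<lambda>k. cmod (T (F k) x - S f x) \<le> (1/2) ^ k) sequentially"
  proof (rule AE_eventually_small)
    fix k
    let ?m = "level_measure (\<lambda>x. T (F k) x - S f x) ((1/2) ^ k)"
    have m1: "{x. (1/2) ^ k < cmod (S (\<lambda>x. F k x - f x) x)} \<in> sets lebesgue"
      by (intro sets_level_lebesgue ext_measurable D)
    have "AE x in lebesgue. S (\<lambda>x. (F k x - f x) + f x) x = S (\<lambda>x. F k x - f x) x + S f x"
      by (intro ext_add D f)
    then have "AE x in lebesgue. T (F k) x - S f x = S (\<lambda>x. F k x - f x) x"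
      using ext_eq[OF F[of k]] by (simp, eventually_elim) simp
    then have "?m \<le> level_measure (\<lambda>x. S (\<lambda>x. F k x - f x) x) ((1/2) ^ k)"
      using m1 by (intro emeasure_mono_AE) (auto elim!: eventually_mono)
    then have "ennreal ((1/2) ^ k) * ?m \<le> ennreal ((1/2) ^ k) * level_measure (\<lambda>x. S (\<lambda>x. F k x - f x) x) ((1/2) ^ k)"
      by (rule mult_left_mono) simp
    also have "\<dots> \<le> ennreal C * L1_norm (\<lambda>x. F k x - f x)" by (intro weak D) simp
    also have "\<dots> \<le> ennreal C * ennreal ((1/4) ^ k)"
      by (intro mult_left_mono NF) simp
    also have "\<dots> = ennreal (C * (1/4) ^ k)" using C by (simp add: ennreal_mult)
    finally show "emeasure lebesgue {x \<in> space lebesgue. (1/2) ^ k < cmod (T (F k) x - S f x)} \<le> ennreal (C * (1/2) ^ k)"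
      by (simp add: ennreal_quarter_power_bound)
  qed measurable
  then have lim: "AE x in lebesgue. (\<lambda>k. T (F k) x) \<longlonglongrightarrow> S f x"
  proof eventually_elim
    case (elim x)
    then have "(\<lambda>k. T (F k) x - S f x) \<longlonglongrightarrow> 0"
      by (rule Lim_null_comparison) (simp add: LIMSEQ_power_zero)
    then show ?case by (simp add: LIM_zero_iff)
  qed
  show ?thesis
  proof (rule Lp_norm_Fatou[OF q \<nu> _ lim])
    fix k
    show "T (F k) \<in> borel_measurable lebesgue" by measurable
    have "Lp_norm q \<nu> (T (F k)) \<le> N * Lp_norm q \<nu> (F k)" by (rule T[OF F])
    also have "\<dots> \<le> N * Lp_norm q \<nu> f"
      using q \<nu> by (intro mult_left_mono Lp_norm_mono) (auto simp: F_le weight_def less_imp_le)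
    finally show "Lp_norm q \<nu> (T (F k)) \<le> N * Lp_norm q \<nu> f" .
  qed
qed

text \<open>Covers the case in which the right-hand side of (i) is
  \<open>top * 0 = 0\<close>.\<close>

lemma commutator_zero_if_const_AE:
  assumes b: "loc_integrable b" and c: "AE x in lebesgue. b x = c"
  shows "op_norm Linf_c p \<mu> q \<nu> (commutator b T) = 0"
proof -
  have "op_norm Linf_c p \<mu> q \<nu> (commutator b T) \<le> ennreal 0"
  proof (rule op_norm_leI)
    fix f :: "real ^ 'n \<Rightarrow> complex" assume f: "f \<in> Linf_c"
    have "AE x in lebesgue. S (\<lambda>y. (b y - c) * f y) x = 0"
      using c by (intro ext_zero loc_integrable_mult_Linf_c[OF loc_integrable_diff_const[OF b] f]) (auto elim!: eventually_mono)
    then have "AE x in lebesgue. commutator b T f x = 0"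
      using commutator_shift[OF b f, of c] c by eventually_elim simp
    then have "Lp_norm q \<nu> (commutator b T f) = Lp_norm q \<nu> (\<lambda>_. 0)" by (rule Lp_norm_cong_AE)
    then show "Lp_norm q \<nu> (commutator b T f) \<le> ennreal 0 * Lp_norm p \<mu> f" by (simp add: Lp_norm_def)
  qed simp
  then show ?thesis by simp
qed

text \<open>After the shift by c, Minkowski separates (b - c) T f, where T acts on L^p(\<mu>) before
  the multiplication, from S ((b - c) f), where the multiplication comes first and the norm on
  L^q(\<nu>) enters. If the multiplication norm is infinite, the right-hand side is infinite unless
  both norms of T are 0; then both terms have norm 0.\<close>

lemma commutator_op_norm_shift_le:
  assumes p: "1 \<le> p" and q: "1 \<le> q" and \<mu>: "weight \<mu>" and \<nu>: "weight \<nu>" and b: "loc_integrable b"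
    and fin: "op_norm Linf_c p \<mu> p \<mu> T < top" "op_norm Linf_c q \<nu> q \<nu> T < top"
  shows "op_norm Linf_c p \<mu> q \<nu> (commutator b T)
    \<le> (op_norm Linf_c p \<mu> p \<mu> T + op_norm Linf_c q \<nu> q \<nu> T) * mult_norm p \<mu> q \<nu> (\<lambda>x. b x - c)"
    (is "_ \<le> (?A + ?B) * ?M")
proof (cases "?A + ?B \<noteq> 0 \<and> ?M = top")
  case True
  then have "(?A + ?B) * ?M = top" by (auto simp only: ennreal_mult_eq_top_iff)
  then show ?thesis by (metis top_greatest)
next
  case False
  have meas [measurable]: "b \<in> borel_measurable lebesgue" "\<nu> \<in> borel_measurable lebesgue"
    using b \<nu> loc_integrable_measurable by (auto simp: weight_def)
  have bound: "Lp_norm q \<nu> (commutator b T f) \<le> (?A + ?B) * ?M * Lp_norm p \<mu> f" if f: "f \<in> Linf_c" for f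
  proof -
    note [measurable] = T_measurable[OF f] Linf_c_measurable[OF f]
    have f1: "(\<lambda>y. (b y - c) * f y) \<in> Lp_space 1 (\<lambda>_. 1)"
      by (rule loc_integrable_mult_Linf_c[OF loc_integrable_diff_const[OF b] f])
    note [measurable] = ext_measurable[OF f1]
    have ffin: "Lp_norm p \<mu> f < top" using Linf_c_Lp_norm_finite[OF f _ \<mu>] p by simp
    have Tf: "Lp_norm p \<mu> (T f) \<le> ?A * Lp_norm p \<mu> f" by (rule op_norm_attained[OF fin(1) f ffin])
    have TB: "Lp_norm q \<nu> (T g) \<le> ?B * Lp_norm q \<nu> g" if "g \<in> Linf_c" for g
      using op_norm_attained[OF fin(2) that] Linf_c_Lp_norm_finite[OF that _ \<nu>] q by simp
    have ext: "Lp_norm q \<nu> (S (\<lambda>y. (b y - c) * f y)) \<le> ?B * Lp_norm q \<nu> (\<lambda>y. (b y - c) * f y)"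
      using q by (intro ext_Lp_bound \<nu> f1 TB) auto
    have "Lp_norm q \<nu> (commutator b T f) = Lp_norm q \<nu> (\<lambda>x. (b x - c) * T f x + (- S (\<lambda>y. (b y - c) * f y) x))"
      using commutator_shift[OF b f, of c] by (intro Lp_norm_cong_AE) simp
    also have "\<dots> \<le> Lp_norm q \<nu> (\<lambda>x. (b x - c) * T f x) + Lp_norm q \<nu> (\<lambda>x. - S (\<lambda>y. (b y - c) * f y) x)"
      using \<nu> q by (intro Lp_norm_triangle) (auto simp: weight_def less_imp_le)
    also have "Lp_norm q \<nu> (\<lambda>x. - S (\<lambda>y. (b y - c) * f y) x) = Lp_norm q \<nu> (S (\<lambda>y. (b y - c) * f y))"
      by (simp add: Lp_norm_def)
    finally have *: "Lp_norm q \<nu> (commutator b T f) \<le> Lp_norm q \<nu> (\<lambda>x. (b x - c) * T f x) + Lp_norm q \<nu> (S (\<lambda>y. (b y - c) * f y))" .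
    show ?thesis
    proof (cases "?M = top")
      case True
      with False have AB: "?A = 0" "?B = 0" by auto
      then have "Lp_norm p \<mu> (T f) = 0" using Tf by simp
      then have "AE x in lebesgue. T f x = 0" by (intro Lp_norm_eq_0_AE[OF \<mu>]) auto
      then have "Lp_norm q \<nu> (\<lambda>x. (b x - c) * T f x) = Lp_norm q \<nu> (\<lambda>x. 0)"
        by (intro Lp_norm_cong_AE) (auto elim!: eventually_mono)
      also have "\<dots> = 0" by (simp add: Lp_norm_def)
      finally show ?thesis using * ext AB by simp
    next
      case fM: False
      have M: "Lp_norm q \<nu> (\<lambda>x. (b x - c) * g x) \<le> ?M * Lp_norm p \<mu> g" if "g \<in> Lp_space p \<mu>" for g
        using op_norm_attained[of "Lp_space p \<mu>" p \<mu> q \<nu> "\<lambda>f x. (b x - c) * f x" g] fM that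
        by (simp add: mult_norm_def Lp_space_def less_top)
      have "Lp_norm p \<mu> (T f) < top"
        using Tf ffin fin(1) by (simp add: le_less_trans ennreal_mult_less_top)
      then have "Lp_norm q \<nu> (\<lambda>x. (b x - c) * T f x) \<le> ?M * Lp_norm p \<mu> (T f)"
        by (intro M) (simp add: Lp_space_def)
      also have "\<dots> \<le> ?M * (?A * Lp_norm p \<mu> f)" by (intro mult_left_mono Tf) simp
      finally have 1: "Lp_norm q \<nu> (\<lambda>x. (b x - c) * T f x) \<le> ?A * ?M * Lp_norm p \<mu> f" by (simp add: ac_simps)
      have "Lp_norm q \<nu> (S (\<lambda>y. (b y - c) * f y)) \<le> ?B * (?M * Lp_norm p \<mu> f)"
        using p by (intro order_trans[OF ext] mult_left_mono M Linf_c_subset_Lp_space f \<mu>) auto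
      then have 2: "Lp_norm q \<nu> (S (\<lambda>y. (b y - c) * f y)) \<le> ?B * ?M * Lp_norm p \<mu> f" by (simp add: ac_simps)
      show ?thesis using order_trans[OF * add_mono[OF 1 2]] by (simp add: distrib_right)
    qed
  qed
  have "(?A + ?B) * ?M < top" using False fin by (auto simp: ennreal_mult_less_top less_top)
  then obtain N where N: "(?A + ?B) * ?M = ennreal N" "0 \<le> N" by (cases "(?A + ?B) * ?M") auto
  show ?thesis unfolding N(1) using bound by (intro op_norm_leI N) (simp add: N)
qed

text \<open>Take constants \<open>c n\<close> with multiplication norm below 2^(-n) and test on the
  indicator of a ball: the integrals of |b - c n|^q \<nu> over it are summable, so
  \<open>c n\<close> tends to \<open>b x\<close> at almost every point of the ball. But a sequence
  of numbers has only one limit.\<close>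

lemma const_AE_if_mult_norm_INF_zero:
  fixes \<mu> \<nu> :: "real ^ 'n \<Rightarrow> real"
  assumes p: "1 \<le> p" and q: "1 \<le> q" and \<mu>: "weight \<mu>" and \<nu>: "weight \<nu>" and b: "loc_integrable b"
    and INF0: "(INF c::complex. mult_norm p \<mu> q \<nu> (\<lambda>x. b x - c)) = 0"
  shows "\<exists>c. AE x in lebesgue. b x = c"
proof -
  have meas [measurable]: "b \<in> borel_measurable lebesgue" "\<nu> \<in> borel_measurable lebesgue"
    using b \<nu> loc_integrable_measurable by (auto simp: weight_def)
  have \<nu>0: "0 < \<nu> x" for x using \<nu> by (simp add: weight_def)
  have "\<exists>c. mult_norm p \<mu> q \<nu> (\<lambda>x. b x - c) < ennreal ((1/2) ^ n)" for n
    using INF0 INF_less_iff[of "\<lambda>c. mult_norm p \<mu> q \<nu> (\<lambda>x. b x - c)" UNIV "ennreal ((1/2) ^ n)"] by auto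
  then obtain c where c: "\<And>n. mult_norm p \<mu> q \<nu> (\<lambda>x. b x - c n) < ennreal ((1/2) ^ n)" by metis
  have "AE x in lebesgue. norm x \<le> real m \<longrightarrow> c \<longlonglongrightarrow> b x" for m
  proof -
    define f where "f = (\<lambda>x::real^'n. if norm x \<le> real m then 1 else 0 :: complex)"
    have f: "f \<in> Linf_c"
    proof (rule Linf_cI[where B = 1 and S = "cball 0 (real m)"])
      have "f \<in> borel_measurable borel" unfolding f_def by measurable
      then show "f \<in> borel_measurable lebesgue" by (simp add: measurable_completion)
    qed (auto simp: f_def)
    note [measurable] = Linf_c_measurable[OF f]
    have ffin: "Lp_norm p \<mu> f < top" using Linf_c_Lp_norm_finite[OF f _ \<mu>] p by simp
    then obtain k where k: "Lp_norm p \<mu> f = ennreal k" "0 \<le> k" by (cases "Lp_norm p \<mu> f") auto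
    have I: "(\<integral>\<^sup>+x. ennreal (cmod ((b x - c n) * f x) powr q * \<nu> x) \<partial>lebesgue) \<le> ennreal (((1/2) ^ n * k) powr q)" for n
    proof -
      have "Lp_norm q \<nu> (\<lambda>x. (b x - c n) * f x) \<le> mult_norm p \<mu> q \<nu> (\<lambda>x. b x - c n) * Lp_norm p \<mu> f"
        unfolding mult_norm_def
      proof (rule op_norm_attained[where U = "\<lambda>f x. (b x - c n) * f x"])
        show "op_norm (Lp_space p \<mu>) p \<mu> q \<nu> (\<lambda>f x. (b x - c n) * f x) < top"
          using c[of n] unfolding mult_norm_def by (rule order_less_trans) simp
      qed (use ffin in \<open>auto simp: Lp_space_def\<close>)
      also have "\<dots> \<le> ennreal ((1/2) ^ n) * ennreal k"
        unfolding k(1) by (intro mult_right_mono less_imp_le[OF c]) simp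
      also have "\<dots> = ennreal ((1/2) ^ n * k)" using k by (simp add: ennreal_mult)
      finally show ?thesis using Lp_norm_le_iff[of q "(1/2) ^ n * k" \<nu> "\<lambda>x. (b x - c n) * f x"] q k by simp
    qed
    have "(\<integral>\<^sup>+x. (\<Sum>n. ennreal (cmod ((b x - c n) * f x) powr q * \<nu> x)) \<partial>lebesgue) = (\<Sum>n. \<integral>\<^sup>+x. ennreal (cmod ((b x - c n) * f x) powr q * \<nu> x) \<partial>lebesgue)"
      by (rule nn_integral_suminf) measurable
    also have "\<dots> \<le> (\<Sum>n. ennreal (((1/2) ^ n * k) powr q))"
      by (intro suminf_le I) auto
    also have "\<dots> = (\<Sum>n. ennreal (((1/2) powr q) ^ n * k powr q))"
    proof (intro suminf_cong)
      fix n
      have "((1/2) ^ n) powr q = ((1/2::real) powr q) ^ n"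
        by (simp add: powr_realpow[symmetric] powr_powr mult.commute powr_power)
      then show "ennreal (((1/2) ^ n * k) powr q) = ennreal (((1/2) powr q) ^ n * k powr q)"
        using k by (simp add: powr_mult)
    qed
    also have "\<dots> < top"
    proof -
      have "(1/2::real) powr q < 1" using q powr_less_mono2[of q "1/2" 1] by simp
      then have "summable (\<lambda>n. ((1/2::real) powr q) ^ n * k powr q)"
        by (intro summable_mult2 summable_geometric) simp
      then show ?thesis by (subst suminf_ennreal2) auto
    qed
    finally have "(\<integral>\<^sup>+x. (\<Sum>n. ennreal (cmod ((b x - c n) * f x) powr q * \<nu> x)) \<partial>lebesgue) \<noteq> \<infinity>" by simp
    then have "AE x in lebesgue. (\<Sum>n. ennreal (cmod ((b x - c n) * f x) powr q * \<nu> x)) \<noteq> \<infinity>"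
      by (intro nn_integral_PInf_AE) measurable
    then show ?thesis
    proof eventually_elim
      case (elim x)
      show ?case
      proof
        assume x: "norm x \<le> real m"
        have "summable (\<lambda>n. cmod ((b x - c n) * f x) powr q * \<nu> x)"
          using elim \<nu>0[of x] by (intro summable_suminf_not_top) (auto simp: less_imp_le)
        then have "(\<lambda>n. cmod (b x - c n) powr q * \<nu> x / \<nu> x) \<longlonglongrightarrow> 0 / \<nu> x"
          using x \<nu>0[of x] by (intro tendsto_divide tendsto_const) (auto simp: f_def dest: summable_LIMSEQ_zero)
        then have "(\<lambda>n. cmod (b x - c n) powr q) \<longlonglongrightarrow> 0" using \<nu>0[of x] by simp
        then have "(\<lambda>n. (cmod (b x - c n) powr q) powr (1/q)) \<longlonglongrightarrow> 0 powr (1/q)"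
          using q by (intro tendsto_powr' tendsto_const) auto
        then have "(\<lambda>n. norm (b x - c n)) \<longlonglongrightarrow> 0" using q by (simp add: powr_powr)
        then have "(\<lambda>n. c n - b x) \<longlonglongrightarrow> 0"
          by (subst tendsto_norm_zero_iff[symmetric]) (simp add: norm_minus_commute)
        then show "c \<longlonglongrightarrow> b x" by (simp add: LIM_zero_iff)
      qed
    qed
  qed
  then have "AE x in lebesgue. \<forall>m. norm x \<le> real m \<longrightarrow> c \<longlonglongrightarrow> b x"
    by (subst AE_all_countable) blast
  then have "AE x in lebesgue. b x = lim c"
  proof eventually_elim
    case (elim x)
    obtain m where "norm x \<le> real m" using real_arch_simple by blast
    with elim have "c \<longlonglongrightarrow> b x" by blast
    then show ?case by (simp add: limI)
  qed
  then show ?thesis by blast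
qed

lemma commutator_op_norm_le:
  assumes p: "1 \<le> p" and q: "1 \<le> q" and \<mu>: "weight \<mu>" and \<nu>: "weight \<nu>" and b: "loc_integrable b"
  shows "op_norm Linf_c p \<mu> q \<nu> (commutator b T)
    \<le> (op_norm Linf_c p \<mu> p \<mu> T + op_norm Linf_c q \<nu> q \<nu> T) * (INF c::complex. mult_norm p \<mu> q \<nu> (\<lambda>x. b x - c))"
    (is "?L \<le> (?A + ?B) * ?I")
proof (cases "?A + ?B = top")
  case True
  show ?thesis
  proof (cases "?I = 0")
    case True
    from const_AE_if_mult_norm_INF_zero[OF p q \<mu> \<nu> b this]
    have "?L = 0" using commutator_zero_if_const_AE[OF b] by blast
    then show ?thesis by simp
  next
    case False
    then have "(?A + ?B) * ?I = top" using True by (simp only: ennreal_mult_eq_top_iff) simp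
    then show ?thesis by (metis top_greatest)
  qed
next
  case False
  then have fin: "?A < top" "?B < top" by (auto simp: less_top)
  have "?L \<le> ?I * (?A + ?B)"
    using commutator_op_norm_shift_le[OF p q \<mu> \<nu> b fin] False
    by (intro ennreal_le_mult_Inf) (auto simp: mult.commute less_top)
  then show ?thesis by (simp add: mult.commute)
qed

end

section \<open>Power weights\<close>

text \<open>The weight |x|^(-d \<theta>), written through the d-th power of the norm to fit the
  radial integrals. The value at the origin is set by hand, since \<open>0 powr (- \<theta>)\<close>
  is 0 and a weight must be positive everywhere.\<close>

definition power_weight :: "real \<Rightarrow> real ^ 'n \<Rightarrow> real" where
  "power_weight \<theta> x = (if x = 0 then 1 else (norm x ^ CARD('n)) powr (- \<theta>))"

lemma power_weight_pos: "0 < power_weight \<theta> x"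
  by (simp add: power_weight_def)

lemma power_weight_borel: "power_weight \<theta> \<in> borel_measurable borel"
  unfolding power_weight_def by measurable

lemma power_weight_measurable [measurable]: "power_weight \<theta> \<in> borel_measurable lebesgue"
  by (rule measurable_completion) (simp add: power_weight_borel)

lemma AE_lebesgue_neq: "AE x in lebesgue. x \<noteq> (c :: real ^ 'n)"
  by (intro AE_completion AE_lborel_singleton)

lemma nn_integral_power_weight_ball:
  assumes "\<theta> < 1" "0 \<le> R"
  shows "(\<integral>\<^sup>+x. ennreal (power_weight \<theta> x) * indicator {x. norm (x :: real ^ 'n) ^ CARD('n) \<le> R} x \<partial>lebesgue)
    = ennreal (unit_ball_vol (real CARD('n)) * R powr (1 - \<theta>) / (1 - \<theta>))"
proof -
  have "(\<integral>\<^sup>+x. ennreal (power_weight \<theta> x) * indicator {x. norm (x :: real ^ 'n) ^ CARD('n) \<le> R} x \<partial>lebesgue)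
     = (\<integral>\<^sup>+x. ennreal ((norm (x - 0) ^ CARD('n)) powr (- \<theta>)) * indicator {x. norm (x - 0 :: real ^ 'n) ^ CARD('n) \<le> R} x \<partial>lebesgue)"
  proof (rule nn_integral_cong_AE)
    show "AE x in lebesgue. ennreal (power_weight \<theta> x) * indicator {x. norm (x :: real ^ 'n) ^ CARD('n) \<le> R} x =
      ennreal ((norm (x - 0) ^ CARD('n)) powr (- \<theta>)) * indicator {x. norm (x - 0 :: real ^ 'n) ^ CARD('n) \<le> R} x"
      using AE_lebesgue_neq[of "0 :: real ^ 'n"] by eventually_elim (simp add: power_weight_def)
  qed
  also have "\<dots> = ennreal (unit_ball_vol (real CARD('n)) * R powr (- \<theta> + 1) / (- \<theta> + 1))"
    by (rule nn_integral_norm_powr_ball) (use assms in auto)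
  finally show ?thesis by simp
qed

lemma weight_power_weight:
  assumes "\<theta> < 1"
  shows "weight (power_weight \<theta> :: real ^ 'n \<Rightarrow> real)"
  unfolding weight_def loc_integrable_def
proof (intro conjI allI impI)
  fix A :: "(real ^ 'n) set" assume A: "compact A"
  then obtain R where R: "0 < R" "\<And>x. x \<in> A \<Longrightarrow> norm x \<le> R"
    using compact_imp_bounded bounded_pos by metis
  have [measurable]: "A \<in> sets lebesgue" using A by (simp add: lborelD borel_compact)
  have "(\<integral>\<^sup>+x. ennreal (norm (indicator A x *\<^sub>R power_weight \<theta> x)) \<partial>lebesgue) \<le>
    (\<integral>\<^sup>+x. ennreal (power_weight \<theta> x) * indicator {x. norm (x :: real ^ 'n) ^ CARD('n) \<le> R ^ CARD('n)} x \<partial>lebesgue)"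
    using R
    by (intro nn_integral_mono) (auto simp: indicator_def abs_of_pos[OF power_weight_pos] intro: power_mono)
  also have "\<dots> < top" using R assms by (subst nn_integral_power_weight_ball) auto
  finally have "integrable lebesgue (\<lambda>x. indicator A x *\<^sub>R power_weight \<theta> x)"
    by (intro integrableI_bounded) auto
  then show "power_weight \<theta> absolutely_integrable_on A" by (simp add: set_integrable_def)
qed (rule power_weight_pos)

lemma emeasure_cube:
  fixes a :: "real ^ 'n"
  assumes "0 < l" shows "emeasure lebesgue (cbox a (a + (\<chi> i. l))) = ennreal (l ^ CARD('n))"
proof -
  have "\<forall>i\<in>Basis. a \<bullet> i \<le> (a + (\<chi> i. l)) \<bullet> i"
    using assms by (auto simp: Basis_vec_def inner_axis)
  moreover have "(\<Prod>i\<in>Basis. (a + (\<chi> i. l) - a) \<bullet> i) = (\<Prod>i\<in>(Basis :: (real^'n) set). l)"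
    by (intro prod.cong) (auto simp: Basis_vec_def inner_axis)
  ultimately show ?thesis by (simp add: emeasure_lborel_cbox_eq)
qed

lemma weight_1_Ap:
  assumes "1 < p" shows "(\<lambda>_ :: real ^ 'n. 1) \<in> Ap_weights p"
proof -
  have "avg Q (\<lambda>_ :: real ^ 'n. 1) = 1" if "Q \<in> cubes" for Q
  proof -
    from that obtain a and l :: real where Q: "Q = cbox a (a + (\<chi> i. l))" "0 < l" by (auto simp: cubes_def)
    have "emeasure lebesgue Q = ennreal (l ^ CARD('n))" unfolding Q(1) by (rule emeasure_cube) fact
    moreover have "Q \<in> sets lebesgue" using Q by (simp add: lborelD)
    ultimately show ?thesis using Q(2) by (simp add: avg_def ennreal_divide_self del: emeasure_completion)
  qed
  then have "Ap_const p (\<lambda>_ :: real ^ 'n. 1) \<le> 1"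
    unfolding Ap_const_def by (intro SUP_least) (simp add: epowr_def)
  then show ?thesis using weight_1 by (auto simp: Ap_weights_def intro: le_less_trans)
qed

text \<open>The hypothesis is Muckenhoupt's A1 condition, with \<open>m\<close> a lower bound of the
  weight on the cube. The dual power of the weight is then at most that of \<open>m\<close>, and as
  the exponents p'/p and p/p' are inverse to each other, the second factor is at most 1 / m.\<close>

lemma A1_imp_Ap:
  fixes w :: "real ^ 'n \<Rightarrow> real"
  assumes p: "1 < p" and w: "weight w" and C: "0 \<le> C"
    and A1: "\<And>Q. Q \<in> cubes \<Longrightarrow> \<exists>m>0. (AE x in lebesgue. x \<in> Q \<longrightarrow> m \<le> w x) \<and> avg Q w \<le> ennreal (C * m)"
  shows "w \<in> Ap_weights p"
proof -
  let ?e = "conj_exponent p / p"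
  have e: "0 < ?e" "0 < p / conj_exponent p" "?e * (p / conj_exponent p) = 1" using conj_exponent_gt_1[OF p] p by auto
  have "avg Q w * epowr (avg Q (\<lambda>x. w x powr (- ?e))) (p / conj_exponent p) \<le> ennreal C" if Q: "Q \<in> cubes" for Q
  proof -
    from A1[OF Q] obtain m where m: "0 < m" "AE x in lebesgue. x \<in> Q \<longrightarrow> m \<le> w x" "avg Q w \<le> ennreal (C * m)" by blast
    from Q obtain a and l :: real where Q': "Q = cbox a (a + (\<chi> i. l))" "0 < l" by (auto simp: cubes_def)
    have em: "emeasure lebesgue Q = ennreal (l ^ CARD('n))" unfolding Q'(1) by (rule emeasure_cube) fact
    have Qm: "Q \<in> sets lebesgue" using Q' by (simp add: lborelD)
    have "avg Q (\<lambda>x. w x powr (- ?e)) \<le> (\<integral>\<^sup>+x. ennreal (m powr (- ?e)) * indicator Q x \<partial>lebesgue) / emeasure lebesgue Q"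
      unfolding avg_def
    proof (intro divide_right_mono_ennreal nn_integral_mono_AE)
      show "AE x in lebesgue. ennreal (w x powr (- ?e)) * indicator Q x \<le> ennreal (m powr (- ?e)) * indicator Q x"
        using m(2)
      proof eventually_elim
        case (elim x)
        then show ?case using m(1) e(1) by (auto simp: indicator_def intro!: ennreal_leI powr_mono2')
      qed
    qed
    also have "\<dots> = ennreal (m powr (- ?e))"
      using Qm Q'(2) by (subst nn_integral_cmult_indicator) (auto simp: em mult_divide_eq_ennreal simp del: emeasure_completion)
    finally have "epowr (avg Q (\<lambda>x. w x powr (- ?e))) (p / conj_exponent p) \<le> epowr (ennreal (m powr (- ?e))) (p / conj_exponent p)"
      using e(2) by (intro epowr_mono)
    also have "\<dots> = ennreal (m powr (- (?e * (p / conj_exponent p))))" by (simp add: powr_powr)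
    also have "\<dots> = ennreal (1 / m)" unfolding e(3) using m(1) by (simp add: powr_minus inverse_eq_divide)
    finally have "avg Q w * epowr (avg Q (\<lambda>x. w x powr (- ?e))) (p / conj_exponent p) \<le> ennreal (C * m) * ennreal (1 / m)"
      using m(3) by (intro mult_mono) auto
    also have "\<dots> = ennreal C" using m(1) C by (subst ennreal_mult[symmetric]) auto
    finally show ?thesis .
  qed
  then have "Ap_const p w \<le> ennreal C"
    unfolding Ap_const_def by (intro SUP_least)
  then show ?thesis using w by (auto simp: Ap_weights_def intro: le_less_trans)
qed

lemma power_weight_ge:
  assumes "0 \<le> \<theta>" "x \<noteq> 0" "norm (x :: real ^ 'n) \<le> r"
  shows "(r ^ CARD('n)) powr (- \<theta>) \<le> power_weight \<theta> x"
  using assms by (auto simp: power_weight_def intro!: powr_mono2' power_mono)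

lemma power_weight_le:
  assumes "0 \<le> \<theta>" "0 < r" "r \<le> norm (x :: real ^ 'n)"
  shows "power_weight \<theta> x \<le> (r ^ CARD('n)) powr (- \<theta>)"
  using assms by (auto simp: power_weight_def intro!: powr_mono2' power_mono)

text \<open>Let D bound the diameter of the cube. If its corner has norm at least 2 D, norms in the
  cube vary between r and 3 r, so the weight varies by at most the factor 3^(d \<theta>). Otherwise
  the cube lies in the ball of radius 3 D about the origin, over which the weight has an explicit
  integral because \<theta> < 1. The two entries of the maximum \<open>C\<close> belong to these
  cases.\<close>

lemma power_weight_Ap:
  assumes \<theta>: "0 \<le> \<theta>" "\<theta> < 1" and p: "1 < p"
  shows "(power_weight \<theta> :: real ^ 'n \<Rightarrow> real) \<in> Ap_weights p"
proof -
  let ?d = "CARD('n)" and ?V = "unit_ball_vol (real CARD('n))"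
  define C where "C = max ((3 ^ ?d) powr \<theta>) (?V * (3 * real ?d) ^ ?d / (1 - \<theta>))"
  show ?thesis
  proof (rule A1_imp_Ap[OF p weight_power_weight[OF \<theta>(2)], of C])
    show "0 \<le> C" by (simp add: C_def le_max_iff_disj)
    fix Q :: "(real ^ 'n) set" assume "Q \<in> cubes"
    then obtain a and l :: real where Q: "Q = cbox a (a + (\<chi> i. l))" "0 < l" by (auto simp: cubes_def)
    have em: "emeasure lebesgue Q = ennreal (l ^ ?d)" unfolding Q(1) by (rule emeasure_cube) fact
    have Qm: "Q \<in> sets lebesgue" using Q by (simp add: lborelD)
    define D where "D = real ?d * l"
    have D: "0 < D" using Q by (simp add: D_def)
    have diam: "norm (x - a) \<le> D" if "x \<in> Q" for x
    proof -
      have "\<bar>(x - a) $ i\<bar> \<le> l" for i using that by (auto simp: Q(1) mem_box_cart dest: spec[of _ i])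
      then have "(\<Sum>i\<in>UNIV. \<bar>(x - a) $ i\<bar>) \<le> (\<Sum>i\<in>(UNIV::'n set). l)" by (intro sum_mono)
      then show ?thesis using norm_le_l1_cart[of "x - a"] by (simp add: D_def)
    qed
    show "\<exists>m>0. (AE x in lebesgue. x \<in> Q \<longrightarrow> m \<le> power_weight \<theta> x) \<and> avg Q (power_weight \<theta>) \<le> ennreal (C * m)"
    proof (cases "2 * D \<le> norm a")
      case True
      define r where "r = norm a / 2"
      have "0 < norm a" using True D by linarith
      then have r: "0 < r" by (simp add: r_def)
      have xr: "r \<le> norm x" "norm x \<le> 3 * r" if "x \<in> Q" for x
        using diam[OF that] True norm_triangle_ineq2[of a x] norm_triangle_ineq2[of x a]
        by (auto simp: r_def norm_minus_commute)
      show ?thesis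
      proof (intro exI[of _ "((3 * r) ^ ?d) powr (- \<theta>)"] conjI)
        show "0 < ((3 * r) ^ ?d) powr (- \<theta>)" using r by simp
        show "AE x in lebesgue. x \<in> Q \<longrightarrow> ((3 * r) ^ ?d) powr (- \<theta>) \<le> power_weight \<theta> x"
          using xr r \<theta> by (intro AE_I2 impI power_weight_ge) (auto dest: xr(1))
        have "avg Q (power_weight \<theta>) \<le> (\<integral>\<^sup>+x. ennreal ((r ^ ?d) powr (- \<theta>)) * indicator Q x \<partial>lebesgue) / emeasure lebesgue Q"
          unfolding avg_def using xr r \<theta>
          by (intro divide_right_mono_ennreal nn_integral_mono) (auto simp: indicator_def intro!: ennreal_leI power_weight_le)
        also have "\<dots> = ennreal ((r ^ ?d) powr (- \<theta>))"
          using Qm Q(2) by (subst nn_integral_cmult_indicator) (auto simp: em mult_divide_eq_ennreal simp del: emeasure_completion)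
        also have "(r ^ ?d) powr (- \<theta>) = (3 ^ ?d) powr \<theta> * ((3 * r) ^ ?d) powr (- \<theta>)"
          using r by (simp add: power_mult_distrib powr_mult powr_minus)
        also have "\<dots> \<le> C * ((3 * r) ^ ?d) powr (- \<theta>)"
          by (intro mult_right_mono) (auto simp: C_def)
        finally show "avg Q (power_weight \<theta>) \<le> ennreal (C * ((3 * r) ^ ?d) powr (- \<theta>))"
          by (simp add: ennreal_leI)
      qed
    next
      case False
      define R where "R = (3 * D) ^ ?d"
      have R: "0 < R" using D by (simp add: R_def)
      have xR: "norm x \<le> 3 * D" if "x \<in> Q" for x
        using diam[OF that] False norm_triangle_ineq2[of x a] by linarith
      have xR': "norm x ^ ?d \<le> R" if "x \<in> Q" for x
        unfolding R_def using xR[OF that] by (intro power_mono) auto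
      show ?thesis
      proof (intro exI[of _ "R powr (- \<theta>)"] conjI)
        show "0 < R powr (- \<theta>)" using R by simp
        show "AE x in lebesgue. x \<in> Q \<longrightarrow> R powr (- \<theta>) \<le> power_weight \<theta> x"
          using AE_lebesgue_neq[of "0 :: real ^ 'n"]
        proof eventually_elim
          case (elim x)
          show ?case using power_weight_ge[OF \<theta>(1) elim xR] by (simp add: R_def)
        qed
        have "avg Q (power_weight \<theta>) \<le> (\<integral>\<^sup>+x. ennreal (power_weight \<theta> x) * indicator {x. norm (x :: real ^ 'n) ^ CARD('n) \<le> R} x \<partial>lebesgue) / emeasure lebesgue Q"
          unfolding avg_def
          by (intro divide_right_mono_ennreal nn_integral_mono) (auto simp: indicator_def xR')
        also have "\<dots> = ennreal (?V * R powr (1 - \<theta>) / (1 - \<theta>)) / ennreal (l ^ ?d)"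
          using R \<theta> by (simp add: nn_integral_power_weight_ball em del: emeasure_completion)
        also have "\<dots> = ennreal (?V * R powr (1 - \<theta>) / (1 - \<theta>) / l ^ ?d)"
          using Q(2) \<theta> by (intro divide_ennreal) auto
        also have "?V * R powr (1 - \<theta>) / (1 - \<theta>) / l ^ ?d = ?V * (R / l ^ ?d) / (1 - \<theta>) * R powr (- \<theta>)"
          using R by (simp add: powr_diff powr_minus field_simps)
        also have "R / l ^ ?d = (3 * real ?d) ^ ?d"
          using Q(2) by (simp add: R_def D_def power_mult_distrib)
        also have "?V * (3 * real ?d) ^ ?d / (1 - \<theta>) * R powr (- \<theta>) \<le> C * R powr (- \<theta>)"
          by (intro mult_right_mono) (auto simp: C_def)
        finally show "avg Q (power_weight \<theta>) \<le> ennreal (C * R powr (- \<theta>))"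
          by (simp add: ennreal_leI)
      qed
    qed
  qed
qed

text \<open>The test function |x|^(-d/p) on the shell makes both integrands equal to |x|^(-d), up to
  \<kappa>^q. With L the integral of |x|^(-d) over the shell, which is proportional to the logarithm
  of the ratio of the radii, the quotient of the norms is \<kappa> L^(1/q - 1/p), unbounded because
  q < p.\<close>

lemma mult_norm_power_weight_shell:
  fixes b :: "real ^ 'n \<Rightarrow> complex"
  assumes pq: "1 < q" "q < p" and \<kappa>: "0 < \<kappa>"
    and b: "\<And>\<Lambda>. 0 < \<Lambda> \<Longrightarrow> \<exists>s>0. \<exists>t. ln t - ln s = \<Lambda> \<and> 0 < t \<and> (\<forall>x. s \<le> norm x ^ CARD('n) \<and> norm x ^ CARD('n) \<le> t \<longrightarrow> cmod (b x) = \<kappa>)"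
  shows "mult_norm p (\<lambda>_. 1) q (power_weight (1 - q / p)) b = \<infinity>"
proof -
  let ?V = "unit_ball_vol (real CARD('n))"
  define \<gamma> where "\<gamma> = 1 / q - 1 / p"
  have \<gamma>: "0 < \<gamma>" using pq by (simp add: \<gamma>_def field_simps)
  have V: "?V \<noteq> 0" using unit_ball_vol_pos[of "real CARD('n)"] by linarith
  have "False" if N: "0 \<le> N" and le: "\<And>f. f \<in> Lp_space p (\<lambda>_ :: real ^ 'n. 1) \<Longrightarrow>
      Lp_norm q (power_weight (1 - q / p)) (\<lambda>x. b x * f x) \<le> ennreal N * Lp_norm p (\<lambda>_. 1) f" for N
  proof -
    \<comment> \<open>Solves \<kappa> L^\<gamma> = N + 1, just above the supposed bound
      \<open>N\<close>.\<close>
    define L where "L = ((N + 1) / \<kappa>) powr (1 / \<gamma>)"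
    have L: "0 < L" using N \<kappa> by (simp add: L_def)
    have L\<gamma>: "\<kappa> * L powr \<gamma> = N + 1" using N \<kappa> \<gamma> by (simp add: L_def powr_powr)
    obtain s t where st: "0 < s" "ln t - ln s = L / ?V" "0 < t"
      and bs: "\<And>x. s \<le> norm x ^ CARD('n) \<Longrightarrow> norm x ^ CARD('n) \<le> t \<Longrightarrow> cmod (b x) = \<kappa>"
      using b[of "L / ?V"] L by auto
    have "ln s \<le> ln t" using st L by (metis diff_gt_0_iff_gt divide_pos_pos less_imp_le unit_ball_vol_pos of_nat_0_le_iff)
    then have s_le_t: "s \<le> t" using st by simp
    let ?A = "{x. s \<le> norm x ^ CARD('n) \<and> norm (x :: real ^ 'n) ^ CARD('n) \<le> t}"
    define f where "f = (\<lambda>x :: real ^ 'n. complex_of_real (if x \<in> ?A then (norm x ^ CARD('n)) powr (- 1 / p) else 0))"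
    have shell: "(\<integral>\<^sup>+x. ennreal (1 / (norm (x::real^'n) ^ CARD('n))) * indicator ?A x \<partial>lebesgue) = ennreal L"
      using nn_integral_norm_inverse_shell[OF st(1) s_le_t, where 'n = 'n] st(2) V by simp
    have cm: "cmod (f x) = (if x \<in> ?A then (norm x ^ CARD('n)) powr (- 1 / p) else 0)" for x
      unfolding f_def norm_of_real by simp
    have fmeas: "f \<in> borel_measurable lebesgue"
    proof -
      have "f \<in> borel_measurable borel" unfolding f_def by measurable
      then show ?thesis by (simp add: measurable_completion)
    qed
    have pos: "0 < norm x ^ CARD('n)" "x \<noteq> 0" if "x \<in> ?A" for x
      using that st(1) by (auto simp: power_0_left)
    have "(\<integral>\<^sup>+x. ennreal (cmod (f x) powr p * 1) \<partial>lebesgue) = ennreal L"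
      unfolding shell[symmetric]
    proof (intro nn_integral_cong)
      fix x
      show "ennreal (cmod (f x) powr p * 1) = ennreal (1 / (norm x ^ CARD('n))) * indicator ?A x"
      proof (cases "x \<in> ?A")
        case True
        let ?n = "norm x ^ CARD('n)"
        have "(?n powr (- 1 / p)) powr p = ?n powr (- 1)" using pq by (simp only: powr_powr) simp
        also have "\<dots> = 1 / ?n" using pos[OF True] by (simp add: powr_minus inverse_eq_divide)
        finally show ?thesis using True unfolding cm by simp
      qed (use pq in \<open>auto simp: cm\<close>)
    qed
    then have nf: "Lp_norm p (\<lambda>_. 1) f = ennreal (L powr (1 / p))"
      unfolding Lp_norm_def using L by simp
    have "(\<integral>\<^sup>+x. ennreal (cmod (b x * f x) powr q * power_weight (1 - q / p) x) \<partial>lebesgue) = (\<integral>\<^sup>+x. ennreal (\<kappa> powr q) * (ennreal (1 / (norm (x::real^'n) ^ CARD('n))) * indicator ?A x) \<partial>lebesgue)"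
    proof (intro nn_integral_cong)
      fix x
      show "ennreal (cmod (b x * f x) powr q * power_weight (1 - q / p) x) = ennreal (\<kappa> powr q) * (ennreal (1 / (norm x ^ CARD('n))) * indicator ?A x)"
      proof (cases "x \<in> ?A")
        case True
        let ?n = "norm x ^ CARD('n)"
        have "cmod (b x * f x) = \<kappa> * ?n powr (- 1 / p)"
          using True bs[of x] by (simp add: norm_mult cm)
        then have "cmod (b x * f x) powr q = \<kappa> powr q * ?n powr (- q / p)"
          using \<kappa> pos[OF True] by (simp add: powr_mult powr_powr)
        moreover have "power_weight (1 - q / p) x = ?n powr (- (1 - q / p))"
          using pos[OF True] by (simp add: power_weight_def)
        moreover have "?n powr (- q / p) * ?n powr (- (1 - q / p)) = 1 / ?n"
        proof -
          have "?n powr (- q / p) * ?n powr (- (1 - q / p)) = ?n powr (- q / p + - (1 - q / p))"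
            by (rule powr_add[symmetric])
          also have "- q / p + - (1 - q / p) = - 1" by simp
          finally show ?thesis using pos[OF True] by (simp add: powr_minus inverse_eq_divide)
        qed
        ultimately have "cmod (b x * f x) powr q * power_weight (1 - q / p) x = \<kappa> powr q * (1 / ?n)"
          by (simp only: mult.assoc)
        then show ?thesis using True by (simp add: ennreal_mult'[symmetric])
      qed (use pq in \<open>auto simp: f_def\<close>)
    qed
    also have "\<dots> = ennreal (\<kappa> powr q) * ennreal L"
      unfolding shell[symmetric]
      by (intro nn_integral_cmult) (auto intro!: measurable_completion)
    finally have nbf: "Lp_norm q (power_weight (1 - q / p)) (\<lambda>x. b x * f x) = ennreal (\<kappa> * L powr (1 / q))"
      unfolding Lp_norm_def using L \<kappa> pq by (simp add: ennreal_mult[symmetric] powr_mult powr_powr)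
    have "f \<in> Lp_space p (\<lambda>_. 1)" using fmeas nf by (simp add: Lp_space_def)
    from le[OF this] have "\<kappa> * L powr (1 / q) \<le> N * L powr (1 / p)"
      unfolding nf nbf using N by (simp add: ennreal_mult[symmetric])
    then have "\<kappa> * L powr (1 / q) / L powr (1 / p) \<le> N" using L by (simp add: pos_divide_le_eq)
    then have "\<kappa> * L powr \<gamma> \<le> N" using L by (simp add: \<gamma>_def powr_diff)
    then show False using L\<gamma> by simp
  qed
  then have "{ennreal N |N. 0 \<le> N \<and> (\<forall>f\<in>Lp_space p (\<lambda>_. 1). Lp_norm q (power_weight (1 - q / p)) (\<lambda>x. b x * f x) \<le> ennreal N * Lp_norm p (\<lambda>_. 1) f)} = {}"
    by blast
  then show ?thesis unfolding mult_norm_def op_norm_def by (simp only: Inf_empty) simp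
qed

section \<open>Kernel estimates across the unit sphere\<close>

text \<open>Tonelli is applied to Borel functions and \<open>lborel\<close>, where the product
  measure has the expected measurable sets: \<open>g\<close> is replaced by a Borel function equal
  to it almost everywhere, and \<open>k\<close> is jointly Borel already.\<close>

lemma Tonelli_lebesgue:
  fixes k :: "real ^ 'n \<Rightarrow> real ^ 'n \<Rightarrow> ennreal"
  assumes k: "case_prod k \<in> borel_measurable (borel \<Otimes>\<^sub>M borel)" and g: "g \<in> borel_measurable lebesgue"
  shows "(\<lambda>x. \<integral>\<^sup>+y. k x y * g y \<partial>lebesgue) \<in> borel_measurable lebesgue" (is ?m)
    and "(\<integral>\<^sup>+x. (\<integral>\<^sup>+y. k x y * g y \<partial>lebesgue) \<partial>lebesgue) = (\<integral>\<^sup>+y. (\<integral>\<^sup>+x. k x y \<partial>lebesgue) * g y \<partial>lebesgue)" (is ?e)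
proof -
  obtain g' where g' [measurable]: "g' \<in> borel_measurable lborel" and gg': "AE y in lborel. g y = g' y"
    using completion_ex_borel_measurable[OF g] by blast
  have [measurable]: "g' \<in> borel_measurable borel" using g' by simp
  note [measurable] = k
  have km: "(\<lambda>(x, y). k x y * g' y) \<in> borel_measurable (lborel \<Otimes>\<^sub>M lborel)"
  proof -
    have "(\<lambda>(x, y). k x y * g' y) \<in> borel_measurable (borel \<Otimes>\<^sub>M borel)" by measurable
    then show ?thesis by (simp cong: measurable_cong_sets add: sets_pair_measure_cong[OF sets_lborel sets_lborel])
  qed
  have eq: "(\<integral>\<^sup>+y. k x y * g y \<partial>lebesgue) = (\<integral>\<^sup>+y. k x y * g' y \<partial>lborel)" for x
    unfolding nn_integral_completion using gg' by (intro nn_integral_cong_AE) (auto elim!: eventually_mono)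
  have "(\<lambda>x. \<integral>\<^sup>+y. k x y * g' y \<partial>lborel) \<in> borel_measurable lborel"
    using lborel.borel_measurable_nn_integral[OF km] by simp
  then show ?m unfolding eq by (intro measurable_completion)
  have "(\<integral>\<^sup>+x. (\<integral>\<^sup>+y. k x y * g y \<partial>lebesgue) \<partial>lebesgue) = (\<integral>\<^sup>+x. (\<integral>\<^sup>+y. k x y * g' y \<partial>lborel) \<partial>lebesgue)"
    by (simp only: eq)
  also have "\<dots> = (\<integral>\<^sup>+x. (\<integral>\<^sup>+y. k x y * g' y \<partial>lborel) \<partial>lborel)"
    by (rule nn_integral_completion)
  also have "\<dots> = (\<integral>\<^sup>+y. (\<integral>\<^sup>+x. k x y * g' y \<partial>lborel) \<partial>lborel)"
    using lborel_pair.Fubini[OF km] by simp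
  also have "\<dots> = (\<integral>\<^sup>+y. (\<integral>\<^sup>+x. k x y \<partial>lborel) * g' y \<partial>lborel)"
    by (intro nn_integral_cong nn_integral_multc) measurable
  also have "\<dots> = (\<integral>\<^sup>+y. (\<integral>\<^sup>+x. k x y \<partial>lebesgue) * g y \<partial>lebesgue)"
    unfolding nn_integral_completion using gg' by (intro nn_integral_cong_AE) (auto elim!: eventually_mono)
  finally show ?e .
qed

text \<open>The sum is at most three times the largest summand, and the power of the latter is one
  of the three on the right.\<close>

lemma epowr_add3_le:
  assumes "0 < q"
  shows "epowr (u + v + w) q \<le> ennreal (3 powr q) * (epowr u q + epowr v q + epowr w q)"
proof -
  define m where "m = max u (max v w)"
  have le: "u \<le> m" "v \<le> m" "w \<le> m" by (auto simp: m_def le_max_iff_disj)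
  have "u + v + w \<le> m + m + m" by (intro add_mono le)
  also have "m + m + m = 3 * m"
  proof -
    have "(3 :: ennreal) = 1 + 1 + 1" by simp
    then show ?thesis by (simp only: distrib_right mult_1_left)
  qed
  finally have "epowr (u + v + w) q \<le> epowr (ennreal 3 * m) q" using assms by (intro epowr_mono) auto
  also have "\<dots> = ennreal (3 powr q) * epowr m q" by (simp only: epowr_mult epowr_ennreal zero_le_numeral)
  also have "epowr m q \<le> epowr u q + epowr v q + epowr w q"
  proof -
    have "m = u \<or> m = v \<or> m = w" by (auto simp: m_def max_def)
    then show ?thesis by (auto simp: add_increasing add_increasing2)
  qed
  finally show ?thesis by (simp add: mult_left_mono)
qed

text \<open>Compares the distance to the unit sphere with its counterpart in the variable r^d of the
  radial integrals.\<close>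

lemma abs_power_diff_1_le:
  fixes r :: real
  assumes "0 \<le> r" "r \<le> 2"
  shows "\<bar>r ^ d - 1\<bar> \<le> real d * 2 ^ d * \<bar>r - 1\<bar>"
proof (induction d)
  case (Suc d)
  have "r ^ Suc d - 1 = r * (r ^ d - 1) + (r - 1)" by (simp add: algebra_simps)
  then have "\<bar>r ^ Suc d - 1\<bar> \<le> r * \<bar>r ^ d - 1\<bar> + \<bar>r - 1\<bar>"
    using assms abs_triangle_ineq[of "r * (r ^ d - 1)" "r - 1"] by (simp add: abs_mult)
  also have "r * \<bar>r ^ d - 1\<bar> \<le> 2 * (real d * 2 ^ d * \<bar>r - 1\<bar>)"
    using assms Suc by (intro mult_mono) auto
  also have "2 * (real d * 2 ^ d * \<bar>r - 1\<bar>) + \<bar>r - 1\<bar> \<le> real (Suc d) * 2 ^ Suc d * \<bar>r - 1\<bar>"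
  proof -
    have "1 * \<bar>r - 1\<bar> \<le> 2 ^ Suc d * \<bar>r - 1\<bar>" by (intro mult_right_mono one_le_power) auto
    then show ?thesis by (simp add: algebra_simps)
  qed
  finally show ?case by simp
qed simp

text \<open>Apart from the null set |x| = 1, the points at which the indicator of the open unit ball
  differs from its value at \<open>x\<close>: only there does the kernel of the commutator
  live.\<close>

definition opposite_side :: "real ^ 'n \<Rightarrow> (real ^ 'n) set" where
  "opposite_side x = {y. norm x < 1 \<and> 1 \<le> norm y \<or> 1 < norm x \<and> norm y < 1}"

text \<open>Since \<open>\<bar>x - y\<bar> \<ge> \<bar>\<bar>x\<bar> - 1\<bar>\<close> for \<open>x\<close> and \<open>y\<close> on opposite sides of the unit sphere, a small power of
  \<open>\<bar>x - y\<bar>\<^sup>-\<^sup>1\<close> can be traded for a power of the distance of \<open>x\<close> to the sphere.\<close>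

lemma opposite_kernel_le:
  fixes x y :: "real ^ 'n" and e :: real
  assumes e: "0 < e" "e \<le> 1" and y: "y \<in> opposite_side x"
  shows "1 / norm (x - y) ^ CARD('n) \<le>
      2 ^ CARD('n) / norm y ^ CARD('n) * indicator {x. norm x < 1} x * indicator {y. 1 \<le> norm y} y +
      2 ^ CARD('n) / norm x ^ CARD('n) * indicator {x. 2 \<le> norm x} x * indicator {y. norm y < 1} y +
      (real CARD('n) * 2 ^ CARD('n)) powr (CARD('n) * e) * \<bar>norm x ^ CARD('n) - 1\<bar> powr (- (CARD('n) * e)) *
        (norm (x - y) ^ CARD('n)) powr (e - 1) * indicator {x. 1 / 2 < norm x \<and> norm x < 2} x * indicator {y. norm y < 2} y"
    (is "_ \<le> ?A + ?B + ?C")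
proof -
  let ?d = "CARD('n)"
  have nn: "0 \<le> ?A" "0 \<le> ?B" "0 \<le> ?C" by (auto simp: indicator_def)
  \<comment> \<open>Far from the sphere, |x - y| is at least half the norm of the outer one of the
    two points, here \<open>z\<close>. This produces the first two terms, in which the variables are
    separated.\<close>
  have half: "1 / norm (x - y) ^ ?d \<le> 2 ^ ?d / norm z ^ ?d" if "norm z / 2 \<le> norm (x - y)" "z \<noteq> 0" for z :: "real ^ 'n"
  proof -
    have "(norm z / 2) ^ ?d \<le> norm (x - y) ^ ?d" using that by (intro power_mono) auto
    then have "1 / norm (x - y) ^ ?d \<le> 1 / (norm z / 2) ^ ?d"
      using that by (intro divide_left_mono mult_pos_pos zero_less_power) auto
    then show ?thesis by (simp add: power_divide)
  qed
  have xy: "norm y - norm x \<le> norm (x - y)" "norm x - norm y \<le> norm (x - y)"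
    using norm_triangle_ineq2[of y x] norm_triangle_ineq2[of x y] by (auto simp: norm_minus_commute)
  have near: "1 / norm (x - y) ^ ?d \<le> ?C" if x: "1 / 2 < norm x" "norm x < 2" and y2: "norm y < 2"
  proof -
    have sep: "\<bar>norm x - 1\<bar> \<le> norm (x - y)" "norm x \<noteq> 1" using xy y by (auto simp: opposite_side_def)
    define L where "L = real ?d * 2 ^ ?d"
    have L: "0 < L" by (simp add: L_def)
    define \<delta> where "\<delta> = \<bar>norm x ^ ?d - 1\<bar>"
    have \<delta>: "0 < \<delta>" using sep power_eq_iff_eq_base[of ?d "norm x" 1] by (simp add: \<delta>_def)
    have "\<delta> \<le> L * \<bar>norm x - 1\<bar>"
      unfolding \<delta>_def L_def using x by (intro abs_power_diff_1_le) auto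
    also have "\<dots> \<le> L * norm (x - y)" using sep L by (intro mult_left_mono) auto
    finally have "\<delta> / L \<le> norm (x - y)" using L by (simp add: pos_divide_le_eq mult.commute)
    then have pw: "(\<delta> / L) ^ ?d \<le> norm (x - y) ^ ?d" using \<delta> L by (intro power_mono) auto
    have npos: "0 < norm (x - y) ^ ?d" using pw \<delta> L by (meson divide_pos_pos less_le_trans zero_less_power)
    have "1 / norm (x - y) ^ ?d = (norm (x - y) ^ ?d) powr (- e + (e - 1))"
      using npos by (simp add: powr_minus inverse_eq_divide)
    also have "\<dots> = (norm (x - y) ^ ?d) powr (- e) * (norm (x - y) ^ ?d) powr (e - 1)" by (rule powr_add)
    also have "\<dots> \<le> ((\<delta> / L) ^ ?d) powr (- e) * (norm (x - y) ^ ?d) powr (e - 1)"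
      using e pw \<delta> L by (intro mult_right_mono powr_mono2') auto
    also have "((\<delta> / L) ^ ?d) powr (- e) = L powr (?d * e) * \<delta> powr (- (?d * e))"
    proof -
      have "((\<delta> / L) ^ ?d) powr (- e) = ((\<delta> / L) powr real ?d) powr (- e)" using \<delta> L by (simp add: powr_realpow)
      also have "\<dots> = (\<delta> / L) powr (- (?d * e))" by (simp add: powr_powr)
      also have "\<dots> = L powr (?d * e) * \<delta> powr (- (?d * e))" using \<delta> L by (simp add: powr_divide powr_minus field_simps)
      finally show ?thesis .
    qed
    finally show ?thesis using x y2 by (simp add: \<delta>_def L_def)
  qed
  consider (in_out) "norm x < 1" "1 \<le> norm y" | (out_in) "1 < norm x" "norm y < 1" using y by (auto simp: opposite_side_def)
  then show ?thesis
  proof cases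
    case in_out
    show ?thesis
    proof (cases "norm x \<le> 1/2 \<or> 2 \<le> norm y")
      case True
      then have "norm y / 2 \<le> norm (x - y)" using xy in_out by linarith
      then have "1 / norm (x - y) ^ ?d \<le> ?A" using half[of y] in_out by force
      then show ?thesis using nn by linarith
    next
      case False
      then show ?thesis using near in_out nn by linarith
    qed
  next
    case out_in
    show ?thesis
    proof (cases "2 \<le> norm x")
      case True
      then have "norm x / 2 \<le> norm (x - y)" using xy out_in by linarith
      then have "1 / norm (x - y) ^ ?d \<le> ?B" using half[of x] True out_in by force
      then show ?thesis using nn by linarith
    next
      case False
      then show ?thesis using near out_in nn by linarith
    qed
  qed
qed

text \<open>Two points of the ball of radius 2 are less than 4 apart, and e > 0 makes the
  singularity integrable. The kernel is symmetric, so this is the uniform bound of Schur's test in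
  either variable.\<close>

lemma nn_integral_norm_diff_powr_le:
  fixes x :: "real ^ 'n"
  assumes e: "0 < e" and x: "norm x < 2"
  shows "(\<integral>\<^sup>+y. ennreal ((norm (x - y) ^ CARD('n)) powr (e - 1)) * indicator {y. norm y < 2} y \<partial>lebesgue)
    \<le> ennreal (unit_ball_vol (real CARD('n)) * (4 ^ CARD('n)) powr e / e)"
proof -
  have "(\<integral>\<^sup>+y. ennreal ((norm (x - y) ^ CARD('n)) powr (e - 1)) * indicator {y. norm y < 2} y \<partial>lebesgue) \<le>
    (\<integral>\<^sup>+y. ennreal ((norm (y - x) ^ CARD('n)) powr (e - 1)) * indicator {y. norm (y - x) ^ CARD('n) \<le> 4 ^ CARD('n)} y \<partial>lebesgue)"
  proof (intro nn_integral_mono)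
    fix y :: "real ^ 'n"
    have "norm (y - x) ^ CARD('n) \<le> 4 ^ CARD('n)" if "norm y < 2"
      using norm_triangle_ineq4[of y x] x that by (intro power_mono) auto
    then show "ennreal ((norm (x - y) ^ CARD('n)) powr (e - 1)) * indicator {y. norm y < 2} y \<le>
        ennreal ((norm (y - x) ^ CARD('n)) powr (e - 1)) * indicator {y. norm (y - x) ^ CARD('n) \<le> 4 ^ CARD('n)} y"
      by (simp add: indicator_def norm_minus_commute[of x y])
  qed
  also have "\<dots> = ennreal (unit_ball_vol (real CARD('n)) * (4 ^ CARD('n)) powr (e - 1 + 1) / (e - 1 + 1))"
    by (rule nn_integral_norm_powr_ball) (use e in auto)
  finally show ?thesis by simp
qed

lemma epowr_indicator: "epowr (indicator A x * u) r = indicator A x * epowr u r"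
  by (simp add: indicator_def)

text \<open>In the two far terms of \<open>opposite_kernel_le\<close> the variables separate, and
  Hoelder in y with exponents 1/p and \<beta> = 1 - 1/p suffices. For the near term, Hoelder in y
  bounds the q-th power by W^(1 - \<theta>), where W is the integral of k g^p; Hoelder in x with
  exponents \<theta> and 1 - \<theta> then pairs it with the singularity D^\<theta> at the sphere,
  and Tonelli bounds the integral of W.\<close>

lemma cross_sphere_bound:
  assumes pq: "1 < q" "q < p"
  obtains C where "C < top"
    "\<And>g :: real ^ 'n \<Rightarrow> ennreal. g \<in> borel_measurable lebesgue \<Longrightarrow>
      (\<integral>\<^sup>+x. epowr (\<integral>\<^sup>+y. ennreal (1 / norm (x - y) ^ CARD('n)) * indicator (opposite_side x) y * g y \<partial>lebesgue) q
         * ennreal (power_weight (1 - q / p) x) \<partial>lebesgue)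
      \<le> C * epowr (\<integral>\<^sup>+y. epowr (g y) p \<partial>lebesgue) (q / p)"
proof -
  let ?d = "CARD('n)" and ?V = "unit_ball_vol (real CARD('n))"
  define \<theta> where "\<theta> = 1 - q / p"
  define \<beta> where "\<beta> = 1 - 1 / p"
  \<comment> \<open>Chosen such that q d e = \<theta> / 2: the q-th power of the singular factor is
    then the \<theta>-th power of \<open>D\<close>, whose exponent -1/2 is integrable across the
    sphere.\<close>
  define e where "e = \<theta> / (2 * q * ?d)"
  define L where "L = (real ?d * 2 ^ ?d) powr (?d * e)"
  have \<theta>: "0 < \<theta>" "\<theta> < 1" "q / p = 1 - \<theta>" using pq by (auto simp: \<theta>_def field_simps)
  have \<beta>: "0 < \<beta>" "\<beta> < 1" "1 / p + \<beta> = 1" using pq by (auto simp: \<beta>_def field_simps)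
  have e: "0 < e" "e \<le> 1"
  proof -
    show "0 < e" using \<theta> pq by (simp add: e_def)
    have "1 \<le> 2 * q * ?d" using pq by (intro order_trans[OF _ mult_mono[of 1 "2*q" 1 "real ?d"]]) (auto simp: Suc_leI)
    then show "e \<le> 1" using \<theta> pq by (simp add: e_def pos_divide_le_eq)
  qed
  have de: "q * (?d * e) = \<theta> / 2" using pq by (simp add: e_def)
  have L: "0 \<le> L" by (simp add: L_def)
  let ?N = "\<lambda>x :: real ^ 'n. norm x ^ ?d"
  define A where "A = {x :: real ^ 'n. norm x < 1}"
  define B where "B = {x :: real ^ 'n. 2 \<le> norm x}"
  define E where "E = {x :: real ^ 'n. 1 / 2 < norm x \<and> norm x < 2}"
  define F where "F = {y :: real ^ 'n. 1 \<le> norm y}"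
  define F2 where "F2 = {y :: real ^ 'n. norm y < 2}"
  have sets_borel [measurable]: "A \<in> sets borel" "B \<in> sets borel" "E \<in> sets borel" "F \<in> sets borel" "F2 \<in> sets borel"
    unfolding A_def B_def E_def F_def F2_def by measurable
  have lborel_leb: "u \<in> borel_measurable lebesgue" if "u \<in> borel_measurable borel" for u :: "real ^ 'n \<Rightarrow> ennreal"
    using that by (intro measurable_completion) simp
  define k where "k x y = ennreal (?N (x - y) powr (e - 1)) * indicator F2 y" for x y
  \<comment> \<open>\<open>1 / \<beta>\<close> is the conjugate exponent of \<open>p\<close>; being
    larger than 1, it makes the kernel tail integrable at infinity.\<close>
  define u where "u y = ennreal ((2 ^ ?d / ?N y) powr (1 / \<beta>)) * indicator F y" for y
  define D where "D x = ennreal (\<bar>?N x - 1\<bar> powr (- 1 / 2)) * indicator E x" for x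
  define M where "M = ennreal (?V * (4 ^ ?d) powr e / e)"
  have k_borel: "k x \<in> borel_measurable borel" "case_prod k \<in> borel_measurable (borel \<Otimes>\<^sub>M borel)" for x
    unfolding k_def by measurable
  have u_borel: "u \<in> borel_measurable borel" unfolding u_def by measurable
  have D_borel: "D \<in> borel_measurable borel" unfolding D_def by measurable
  have w_borel: "(\<lambda>x. ennreal (power_weight \<theta> x)) \<in> borel_measurable (borel :: (real ^ 'n) measure)"
    using power_weight_borel by (rule measurable_compose[OF _ measurable_ennreal])
  define U where "U = (\<integral>\<^sup>+y. u y \<partial>lebesgue)"
  define \<Delta> where "\<Delta> = (\<integral>\<^sup>+y. D y \<partial>lebesgue)"
  define I1 where "I1 = (\<integral>\<^sup>+x. indicator A x * ennreal (power_weight \<theta> x) \<partial>lebesgue)"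
  define I2 where "I2 = (\<integral>\<^sup>+x. indicator B x * ennreal ((2 ^ ?d / ?N x) powr q * power_weight \<theta> x) \<partial>lebesgue)"
  have U_fin: "U < top"
  proof -
    have "U = (\<integral>\<^sup>+y. ennreal ((2 ^ ?d) powr (1 / \<beta>)) * (ennreal (?N (y - 0) powr (- 1 / \<beta>)) * indicator {y. 1 \<le> ?N (y - 0)} y) \<partial>lebesgue)"
      unfolding U_def
    proof (intro nn_integral_cong)
      fix y :: "real ^ 'n"
      have "1 \<le> norm y \<longleftrightarrow> 1 \<le> ?N y" using power_mono_iff[of 1 "norm y" ?d] by simp
      then show "u y = ennreal ((2 ^ ?d) powr (1 / \<beta>)) * (ennreal (?N (y - 0) powr (- 1 / \<beta>)) * indicator {y. 1 \<le> ?N (y - 0)} y)"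
        by (simp add: u_def F_def indicator_def powr_divide powr_minus_divide ennreal_mult'[symmetric])
    qed
    also have "\<dots> = ennreal ((2 ^ ?d) powr (1 / \<beta>)) * (\<integral>\<^sup>+y. ennreal (?N (y - 0) powr (- 1 / \<beta>)) * indicator {y. 1 \<le> ?N (y - 0)} y \<partial>lebesgue)"
      by (intro nn_integral_cmult lborel_leb) measurable
    also have "\<dots> = ennreal ((2 ^ ?d) powr (1 / \<beta>)) * ennreal (?V * 1 powr (- 1 / \<beta> + 1) / (- (- 1 / \<beta>) - 1))"
      using \<beta> by (subst nn_integral_norm_powr_outside) auto
    also have "\<dots> < top" by (simp add: ennreal_mult_less_top)
    finally show ?thesis .
  qed
  have \<Delta>_fin: "\<Delta> < top"
  proof -
    have "\<Delta> \<le> (\<integral>\<^sup>+x. ennreal (\<bar>?N x - 1\<bar> powr (-1/2)) * indicator {x. ?N x \<le> 2 ^ ?d} x \<partial>lebesgue)"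
      unfolding \<Delta>_def
    proof (intro nn_integral_mono)
      fix x :: "real ^ 'n"
      have "?N x \<le> 2 ^ ?d" if "x \<in> E" using that by (intro power_mono) (auto simp: E_def)
      then show "D x \<le> ennreal (\<bar>?N x - 1\<bar> powr (-1/2)) * indicator {x. ?N x \<le> 2 ^ ?d} x"
        by (auto simp: D_def indicator_def)
    qed
    also have "\<dots> < top" by (rule nn_integral_norm_sphere_singularity) simp
    finally show ?thesis .
  qed
  have I1_fin: "I1 < top"
  proof -
    have "I1 \<le> (\<integral>\<^sup>+x. ennreal (power_weight \<theta> x) * indicator {x. ?N x \<le> 1} x \<partial>lebesgue)"
      unfolding I1_def by (intro nn_integral_mono) (auto simp: A_def indicator_def power_le_one)
    also have "\<dots> < top" using \<theta> by (subst nn_integral_power_weight_ball) auto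
    finally show ?thesis .
  qed
  have I2_fin: "I2 < top"
  proof -
    have "I2 \<le> (\<integral>\<^sup>+x. ennreal ((2 ^ ?d) powr q) * (ennreal (?N (x - 0) powr (- q - \<theta>)) * indicator {x. 1 \<le> ?N (x - 0)} x) \<partial>lebesgue)"
      unfolding I2_def
    proof (intro nn_integral_mono)
      fix x :: "real ^ 'n"
      show "indicator B x * ennreal ((2 ^ ?d / ?N x) powr q * power_weight \<theta> x) \<le>
        ennreal ((2 ^ ?d) powr q) * (ennreal (?N (x - 0) powr (- q - \<theta>)) * indicator {x. 1 \<le> ?N (x - 0)} x)"
      proof (cases "x \<in> B")
        case True
        then have x: "2 \<le> norm x" "x \<noteq> 0" "1 \<le> ?N x" by (auto simp: B_def)
        have "(2 ^ ?d / ?N x) powr q * power_weight \<theta> x = (2 ^ ?d) powr q * (?N x powr (- q) * ?N x powr (- \<theta>))"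
          using x by (simp add: power_weight_def powr_divide powr_minus_divide)
        also have "?N x powr (- q) * ?N x powr (- \<theta>) = ?N x powr (- q - \<theta>)"
          unfolding powr_add[symmetric] by simp
        finally show ?thesis using x True by (simp add: ennreal_mult'[symmetric])
      qed simp
    qed
    also have "\<dots> = ennreal ((2 ^ ?d) powr q) * (\<integral>\<^sup>+x. ennreal (?N (x - 0) powr (- q - \<theta>)) * indicator {x. 1 \<le> ?N (x - 0)} x \<partial>lebesgue)"
      by (intro nn_integral_cmult lborel_leb) measurable
    also have "\<dots> = ennreal ((2 ^ ?d) powr q) * ennreal (?V * 1 powr (- q - \<theta> + 1) / (- (- q - \<theta>) - 1))"
      using \<theta> pq by (subst nn_integral_norm_powr_outside) auto
    also have "\<dots> < top" by (simp add: ennreal_mult_less_top)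
    finally show ?thesis .
  qed
  have M: "(\<integral>\<^sup>+y. k x y \<partial>lebesgue) \<le> M" if "norm x < 2" for x :: "real ^ 'n"
    unfolding k_def M_def F2_def using e that by (intro nn_integral_norm_diff_powr_le) auto
  define b1 where "b1 = emeasure lebesgue A"
  have b1_fin: "b1 < top"
  proof -
    have "b1 \<le> emeasure lebesgue (cball (0 :: real ^ 'n) 1)"
      unfolding b1_def by (intro emeasure_mono) (auto simp: A_def)
    also have "\<dots> < top" by (simp add: emeasure_cball)
    finally show ?thesis .
  qed
  \<comment> \<open>The second factor bounds the power weight on \<open>E\<close>, where the norm
    exceeds 1/2.\<close>
  define c3 where "c3 = ennreal (L powr q * (2 ^ ?d) powr \<theta>)"
  define C where "C = ennreal (3 powr q) * (epowr U (\<beta> * q) * I1 + epowr b1 (\<beta> * q) * I2 +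
     c3 * epowr M (\<beta> * q) * epowr \<Delta> \<theta> * epowr M (1 - \<theta>))"
  show thesis
  proof (rule that[of C])
    show "C < top"
      using U_fin \<Delta>_fin I1_fin I2_fin b1_fin by (simp add: C_def M_def c3_def ennreal_mult_less_top)
    fix g :: "real ^ 'n \<Rightarrow> ennreal" assume g [measurable]: "g \<in> borel_measurable lebesgue"
    define G where "G = (\<integral>\<^sup>+y. epowr (g y) p \<partial>lebesgue)"
    define P where "P x = (\<integral>\<^sup>+y. ennreal (1 / norm (x - y) ^ ?d) * indicator (opposite_side x) y * g y \<partial>lebesgue)" for x
    define a1 where "a1 = (\<integral>\<^sup>+y. ennreal (2 ^ ?d / ?N y) * indicator F y * g y \<partial>lebesgue)"
    define a2 where "a2 = (\<integral>\<^sup>+y. indicator A y * g y \<partial>lebesgue)"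
    define H where "H x = (\<integral>\<^sup>+y. k x y * g y \<partial>lebesgue)" for x
    define W where "W x = (\<integral>\<^sup>+y. k x y * epowr (g y) p \<partial>lebesgue)" for x
    have gp: "epowr (epowr (g y) p) (1 / p) = g y" for y using pq by (simp add: epowr_epowr)
    note [measurable] = lborel_leb[OF u_borel] lborel_leb[OF k_borel(1)] lborel_leb[OF D_borel] lborel_leb[OF w_borel]
    have Am [measurable]: "A \<in> sets lebesgue" "E \<in> sets lebesgue" "F \<in> sets lebesgue" using sets_borel by (auto intro: sets_completionI_sets)
    have a1: "a1 \<le> epowr G (1 / p) * epowr U \<beta>"
    proof -
      have "a1 = (\<integral>\<^sup>+y. epowr (epowr (g y) p) (1 / p) * epowr (u y) \<beta> \<partial>lebesgue)"
        unfolding a1_def gp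
      proof (intro nn_integral_cong)
        fix y :: "real ^ 'n"
        have "epowr (u y) \<beta> = ennreal (2 ^ ?d / ?N y) * indicator F y"
          using \<beta> by (simp add: u_def indicator_def powr_powr)
        then show "ennreal (2 ^ ?d / ?N y) * indicator F y * g y = g y * epowr (u y) \<beta>" by (simp add: mult.commute)
      qed
      also have "\<dots> \<le> epowr G (1 / p) * epowr U \<beta>"
        unfolding G_def U_def using \<beta> pq by (intro Holder_nn_integral) auto
      finally show ?thesis .
    qed
    have a2: "a2 \<le> epowr G (1 / p) * epowr b1 \<beta>"
    proof -
      have "a2 = (\<integral>\<^sup>+y. epowr (epowr (g y) p) (1 / p) * epowr (indicator A y) \<beta> \<partial>lebesgue)"
        unfolding a2_def gp
        by (intro nn_integral_cong) (auto simp: indicator_def epowr_def)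
      also have "\<dots> \<le> epowr G (1 / p) * epowr (\<integral>\<^sup>+y. indicator A y \<partial>lebesgue) \<beta>"
        unfolding G_def using \<beta> pq by (intro Holder_nn_integral) auto
      finally show ?thesis using Am by (simp add: b1_def)
    qed
    \<comment> \<open>The kernel is split as \<open>k\<close> to the power \<open>1 / p\<close>,
      which goes with \<open>g\<close>, times \<open>k\<close> to the power \<open>\<beta>\<close>,
      whose integral is at most \<open>M\<close>.\<close>
    have H: "H x \<le> epowr (W x) (1 / p) * epowr M \<beta>" if "norm x < 2" for x
    proof -
      have "H x = (\<integral>\<^sup>+y. epowr (k x y * epowr (g y) p) (1 / p) * epowr (k x y) \<beta> \<partial>lebesgue)"
        unfolding H_def
      proof (intro nn_integral_cong)
        fix y :: "real ^ 'n"
        have "epowr (k x y) (1 / p) * epowr (k x y) \<beta> = k x y"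
          using \<beta> pq by (subst epowr_add) auto
        then show "k x y * g y = epowr (k x y * epowr (g y) p) (1 / p) * epowr (k x y) \<beta>"
          unfolding epowr_mult gp by (metis mult.assoc mult.commute)
      qed
      also have "\<dots> \<le> epowr (W x) (1 / p) * epowr (\<integral>\<^sup>+y. k x y \<partial>lebesgue) \<beta>"
        unfolding W_def using \<beta> pq by (intro Holder_nn_integral) auto
      also have "\<dots> \<le> epowr (W x) (1 / p) * epowr M \<beta>"
        using \<beta> M[OF that] by (intro mult_left_mono epowr_mono) auto
      finally show ?thesis .
    qed
    define \<delta> where "\<delta> x = \<bar>?N x - 1\<bar> powr (- (?d * e))" for x
    have P_le: "P x \<le> indicator A x * a1 + indicator B x * (ennreal (2 ^ ?d / ?N x) * a2) + indicator E x * (ennreal (L * \<delta> x) * H x)" for x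
    proof -
      have "P x \<le> (\<integral>\<^sup>+y. indicator A x * (ennreal (2 ^ ?d / ?N y) * indicator F y * g y) +
         (indicator B x * ennreal (2 ^ ?d / ?N x)) * (indicator A y * g y) + (indicator E x * ennreal (L * \<delta> x)) * (k x y * g y) \<partial>lebesgue)"
        unfolding P_def
      proof (intro nn_integral_mono)
        fix y :: "real ^ 'n"
        have "ennreal (1 / norm (x - y) ^ ?d) * indicator (opposite_side x) y \<le>
          indicator A x * (ennreal (2 ^ ?d / ?N y) * indicator F y) +
          (indicator B x * ennreal (2 ^ ?d / ?N x)) * indicator A y + (indicator E x * ennreal (L * \<delta> x)) * k x y"
        proof (cases "y \<in> opposite_side x")
          case True
          have "ennreal (1 / norm (x - y) ^ ?d) \<le> ennreal (2 ^ ?d / ?N y * indicator A x * indicator F y +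
             2 ^ ?d / ?N x * indicator B x * indicator A y +
             L * \<delta> x * ?N (x - y) powr (e - 1) * indicator E x * indicator F2 y)"
            using opposite_kernel_le[OF e True] unfolding A_def B_def E_def F_def F2_def L_def \<delta>_def by (rule ennreal_leI)
          also have "\<dots> = ennreal (2 ^ ?d / ?N y * indicator A x * indicator F y) +
             ennreal (2 ^ ?d / ?N x * indicator B x * indicator A y) +
             ennreal (L * \<delta> x * ?N (x - y) powr (e - 1) * indicator E x * indicator F2 y)"
            using L by (simp add: \<delta>_def)
          also have "ennreal (2 ^ ?d / ?N y * indicator A x * indicator F y) = indicator A x * (ennreal (2 ^ ?d / ?N y) * indicator F y)"
            by (simp add: indicator_def)
          also have "ennreal (2 ^ ?d / ?N x * indicator B x * indicator A y) = (indicator B x * ennreal (2 ^ ?d / ?N x)) * indicator A y"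
            by (simp add: indicator_def)
          also have "ennreal (L * \<delta> x * ?N (x - y) powr (e - 1) * indicator E x * indicator F2 y) = (indicator E x * ennreal (L * \<delta> x)) * k x y"
            using L by (simp add: indicator_def k_def ennreal_mult'' \<delta>_def)
          finally show ?thesis using True by simp
        qed simp
        then have "ennreal (1 / norm (x - y) ^ ?d) * indicator (opposite_side x) y * g y \<le>
          (indicator A x * (ennreal (2 ^ ?d / ?N y) * indicator F y) +
          (indicator B x * ennreal (2 ^ ?d / ?N x)) * indicator A y + (indicator E x * ennreal (L * \<delta> x)) * k x y) * g y"
          by (rule mult_right_mono) simp
        then show "ennreal (1 / norm (x - y) ^ ?d) * indicator (opposite_side x) y * g y \<le>
          indicator A x * (ennreal (2 ^ ?d / ?N y) * indicator F y * g y) +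
         (indicator B x * ennreal (2 ^ ?d / ?N x)) * (indicator A y * g y) + (indicator E x * ennreal (L * \<delta> x)) * (k x y * g y)"
          by (simp only: distrib_right mult.assoc)
      qed
      also have "\<dots> = indicator A x * a1 + (indicator B x * ennreal (2 ^ ?d / ?N x)) * a2 + (indicator E x * ennreal (L * \<delta> x)) * H x"
      proof -
        have 1: "(\<lambda>y. ennreal (2 ^ ?d / ?N y) * indicator F y * g y) \<in> borel_measurable lebesgue"
          by (intro borel_measurable_times_ennreal lborel_leb g) measurable
        have 2: "(\<lambda>y. indicator A y * g y) \<in> borel_measurable lebesgue" by measurable
        have 3: "(\<lambda>y. k x y * g y) \<in> borel_measurable lebesgue" by measurable
        show ?thesis
          unfolding a1_def a2_def H_def using 1 2 3
          by (simp add: nn_integral_add nn_integral_cmult)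
      qed
      finally show ?thesis by (simp only: mult.assoc)
    qed
    \<comment> \<open>A majorant of the near term, to the power q and weighted, in the form that
      Hoelder in x with exponents \<theta> and 1 - \<theta> requires.\<close>
    define Q where "Q x = c3 * epowr M (\<beta> * q) * (epowr (D x) \<theta> * epowr (indicator E x * W x) (1 - \<theta>))" for x
    have pt: "epowr (P x) q * ennreal (power_weight \<theta> x) \<le> ennreal (3 powr q) * (epowr a1 q * (indicator A x * ennreal (power_weight \<theta> x)) +
       epowr a2 q * (indicator B x * ennreal ((2 ^ ?d / ?N x) powr q * power_weight \<theta> x)) + Q x)" for x
    proof -
      let ?w = "ennreal (power_weight \<theta> x)"
      have pw: "ennreal ((2 ^ ?d / ?N x) powr q * power_weight \<theta> x) = ennreal ((2 ^ ?d / ?N x) powr q) * ?w"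
        by (rule ennreal_mult') simp
      have "epowr (P x) q \<le> ennreal (3 powr q) * (epowr (indicator A x * a1) q + epowr (indicator B x * (ennreal (2 ^ ?d / ?N x) * a2)) q
         + epowr (indicator E x * (ennreal (L * \<delta> x) * H x)) q)"
        using pq by (intro order_trans[OF epowr_mono[OF P_le] epowr_add3_le]) auto
      then have "epowr (P x) q * ?w \<le> ennreal (3 powr q) * (epowr (indicator A x * a1) q + epowr (indicator B x * (ennreal (2 ^ ?d / ?N x) * a2)) q
         + epowr (indicator E x * (ennreal (L * \<delta> x) * H x)) q) * ?w"
        by (rule mult_right_mono) simp
      also have "\<dots> = ennreal (3 powr q) * (epowr (indicator A x * a1) q * ?w + epowr (indicator B x * (ennreal (2 ^ ?d / ?N x) * a2)) q * ?w
         + epowr (indicator E x * (ennreal (L * \<delta> x) * H x)) q * ?w)"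
        by (simp only: distrib_right mult.assoc)
      also have "epowr (indicator A x * a1) q * ?w = epowr a1 q * (indicator A x * ?w)"
        unfolding epowr_indicator by (simp add: ac_simps)
      also have "epowr (indicator B x * (ennreal (2 ^ ?d / ?N x) * a2)) q * ?w = epowr a2 q * (indicator B x * ennreal ((2 ^ ?d / ?N x) powr q * power_weight \<theta> x))"
        unfolding pw by (cases "x \<in> B") (simp_all add: epowr_mult ac_simps)
      also have "epowr (indicator E x * (ennreal (L * \<delta> x) * H x)) q * ?w \<le> Q x"
      proof (cases "x \<in> E")
        case True
        then have x: "1 / 2 < norm x" "norm x < 2" by (auto simp: E_def)
        have w: "?w \<le> ennreal ((2 ^ ?d) powr \<theta>)"
        proof -
          have "power_weight \<theta> x \<le> ((1 / 2) ^ ?d) powr (- \<theta>)"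
            using \<theta> x by (intro power_weight_le) auto
          also have "\<dots> = (2 ^ ?d) powr \<theta>" by (simp add: power_divide powr_divide powr_minus)
          finally show ?thesis by (rule ennreal_leI)
        qed
        have "epowr (H x) q \<le> epowr (epowr (W x) (1 / p) * epowr M \<beta>) q"
          using pq x by (intro epowr_mono H) auto
        also have "\<dots> = epowr (W x) (1 - \<theta>) * epowr M (\<beta> * q)"
          using \<theta>(3) by (simp add: epowr_mult epowr_epowr)
        finally have Hq: "epowr (H x) q \<le> epowr (W x) (1 - \<theta>) * epowr M (\<beta> * q)" .
        have \<delta>q: "epowr (ennreal (L * \<delta> x)) q = ennreal (L powr q) * epowr (D x) \<theta>"
        proof -
          have "- (?d * e) * q = (- 1 / 2) * \<theta>" using de by (simp add: mult.commute)
          then have "\<delta> x powr q = (\<bar>?N x - 1\<bar> powr (- 1 / 2)) powr \<theta>"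
            unfolding \<delta>_def powr_powr by (rule arg_cong)
          moreover have "epowr (D x) \<theta> = ennreal ((\<bar>?N x - 1\<bar> powr (- 1 / 2)) powr \<theta>)"
            using True by (simp add: D_def)
          moreover have "epowr (ennreal (L * \<delta> x)) q = ennreal (L powr q * \<delta> x powr q)"
            using L by (subst epowr_ennreal) (auto simp: \<delta>_def powr_mult)
          ultimately show ?thesis by (simp only: ennreal_mult' powr_ge_zero)
        qed
        have "epowr (indicator E x * (ennreal (L * \<delta> x) * H x)) q * ?w = epowr (ennreal (L * \<delta> x)) q * epowr (H x) q * ?w"
          using True by (simp add: epowr_mult)
        also have "\<dots> \<le> ennreal (L powr q) * epowr (D x) \<theta> * (epowr (W x) (1 - \<theta>) * epowr M (\<beta> * q)) * ennreal ((2 ^ ?d) powr \<theta>)"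
          unfolding \<delta>q by (intro mult_mono Hq w) auto
        also have "\<dots> = Q x" using True by (simp add: Q_def c3_def ennreal_mult' ac_simps)
        finally show ?thesis .
      qed (simp add: Q_def)
      finally show ?thesis by (simp add: mult_left_mono add_left_mono)
    qed
    have W_eq: "indicator E x * W x = (\<integral>\<^sup>+y. (indicator E x * k x y) * epowr (g y) p \<partial>lebesgue)" for x
      unfolding W_def mult.assoc by (intro nn_integral_cmult[symmetric]) measurable
    have Ek: "(\<lambda>(x, y). indicator E x * k x y) \<in> borel_measurable (borel \<Otimes>\<^sub>M borel)"
      using k_borel(2) by measurable
    have gp_meas: "(\<lambda>y. epowr (g y) p) \<in> borel_measurable lebesgue" by measurable
    have W_meas [measurable]: "(\<lambda>x. indicator E x * W x) \<in> borel_measurable lebesgue"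
      unfolding W_eq by (rule Tonelli_lebesgue(1)[OF Ek gp_meas])
    \<comment> \<open>Tonelli moves the integration in x onto the kernel alone, and by symmetry of
      the kernel the bound \<open>M\<close> applies to that variable too.\<close>
    have W_int: "(\<integral>\<^sup>+x. indicator E x * W x \<partial>lebesgue) \<le> M * G"
    proof -
      have "(\<integral>\<^sup>+x. indicator E x * W x \<partial>lebesgue) = (\<integral>\<^sup>+y. (\<integral>\<^sup>+x. indicator E x * k x y \<partial>lebesgue) * epowr (g y) p \<partial>lebesgue)"
        unfolding W_eq by (rule Tonelli_lebesgue(2)[OF Ek gp_meas])
      also have "\<dots> \<le> (\<integral>\<^sup>+y. M * epowr (g y) p \<partial>lebesgue)"
      proof (intro nn_integral_mono mult_right_mono)
        fix y :: "real ^ 'n"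
        show "(\<integral>\<^sup>+x. indicator E x * k x y \<partial>lebesgue) \<le> M"
        proof (cases "norm y < 2")
          case True
          have "(\<integral>\<^sup>+x. indicator E x * k x y \<partial>lebesgue) \<le> (\<integral>\<^sup>+x. k y x \<partial>lebesgue)"
            by (intro nn_integral_mono) (auto simp: k_def E_def F2_def indicator_def norm_minus_commute)
          also have "\<dots> \<le> M" by (rule M[OF True])
          finally show ?thesis .
        qed (simp add: k_def F2_def)
      qed simp
      also have "\<dots> = M * G" unfolding G_def by (intro nn_integral_cmult) measurable
      finally show ?thesis .
    qed
    have B_leb: "(\<lambda>x. indicator B x * ennreal ((2 ^ ?d / ?N x) powr q * power_weight \<theta> x)) \<in> borel_measurable lebesgue"
    proof (rule lborel_leb)
      note [measurable] = power_weight_borel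
      show "(\<lambda>x. indicator B x * ennreal ((2 ^ ?d / ?N x) powr q * power_weight \<theta> x)) \<in> borel_measurable borel" by measurable
    qed
    have A_leb: "(\<lambda>x. indicator A x * ennreal (power_weight \<theta> x)) \<in> borel_measurable lebesgue" by measurable
    have Q_leb: "Q \<in> borel_measurable lebesgue" unfolding Q_def by measurable
    have Q_int: "(\<integral>\<^sup>+x. Q x \<partial>lebesgue) \<le> c3 * epowr M (\<beta> * q) * epowr \<Delta> \<theta> * epowr M (1 - \<theta>) * epowr G (1 - \<theta>)"
    proof -
      have "(\<integral>\<^sup>+x. Q x \<partial>lebesgue) = c3 * epowr M (\<beta> * q) * (\<integral>\<^sup>+x. epowr (D x) \<theta> * epowr (indicator E x * W x) (1 - \<theta>) \<partial>lebesgue)"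
        unfolding Q_def by (intro nn_integral_cmult) measurable
      also have "(\<integral>\<^sup>+x. epowr (D x) \<theta> * epowr (indicator E x * W x) (1 - \<theta>) \<partial>lebesgue) \<le>
         epowr \<Delta> \<theta> * epowr (\<integral>\<^sup>+x. indicator E x * W x \<partial>lebesgue) (1 - \<theta>)"
        unfolding \<Delta>_def using \<theta> by (intro Holder_nn_integral) auto
      also have "\<dots> \<le> epowr \<Delta> \<theta> * epowr (M * G) (1 - \<theta>)"
        using \<theta> W_int by (intro mult_left_mono epowr_mono) auto
      finally show ?thesis by (simp add: epowr_mult mult_left_mono mult.assoc)
    qed
    have a1q: "epowr a1 q \<le> epowr G (1 - \<theta>) * epowr U (\<beta> * q)"
    proof -
      have "epowr a1 q \<le> epowr (epowr G (1 / p) * epowr U \<beta>) q" using pq by (intro epowr_mono a1) auto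
      then show ?thesis using \<theta>(3) by (simp add: epowr_mult epowr_epowr)
    qed
    have a2q: "epowr a2 q \<le> epowr G (1 - \<theta>) * epowr b1 (\<beta> * q)"
    proof -
      have "epowr a2 q \<le> epowr (epowr G (1 / p) * epowr b1 \<beta>) q" using pq by (intro epowr_mono a2) auto
      then show ?thesis using \<theta>(3) by (simp add: epowr_mult epowr_epowr)
    qed
    have "(\<integral>\<^sup>+x. epowr (P x) q * ennreal (power_weight \<theta> x) \<partial>lebesgue) \<le>
      (\<integral>\<^sup>+x. ennreal (3 powr q) * (epowr a1 q * (indicator A x * ennreal (power_weight \<theta> x)) +
       epowr a2 q * (indicator B x * ennreal ((2 ^ ?d / ?N x) powr q * power_weight \<theta> x)) + Q x) \<partial>lebesgue)"
      by (intro nn_integral_mono pt)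
    also have "\<dots> = ennreal (3 powr q) * (epowr a1 q * I1 + epowr a2 q * I2 + (\<integral>\<^sup>+x. Q x \<partial>lebesgue))"
      unfolding I1_def I2_def using A_leb B_leb Q_leb
      by (simp add: nn_integral_add nn_integral_cmult)
    also have "\<dots> \<le> ennreal (3 powr q) * ((epowr G (1 - \<theta>) * epowr U (\<beta> * q)) * I1 + (epowr G (1 - \<theta>) * epowr b1 (\<beta> * q)) * I2 +
        c3 * epowr M (\<beta> * q) * epowr \<Delta> \<theta> * epowr M (1 - \<theta>) * epowr G (1 - \<theta>))"
      by (intro mult_left_mono add_mono mult_right_mono a1q a2q Q_int) auto
    also have "\<dots> = C * epowr G (1 - \<theta>)"
      unfolding C_def by (simp only: distrib_left distrib_right ac_simps)
    finally show "(\<integral>\<^sup>+x. epowr (\<integral>\<^sup>+y. ennreal (1 / norm (x - y) ^ ?d) * indicator (opposite_side x) y * g y \<partial>lebesgue) q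
         * ennreal (power_weight (1 - q / p) x) \<partial>lebesgue) \<le> C * epowr (\<integral>\<^sup>+y. epowr (g y) p \<partial>lebesgue) (q / p)"
      unfolding P_def G_def \<theta>_def[symmetric] unfolding \<theta>(3) .
  qed
qed

definition ball_indicator :: "real ^ 'n \<Rightarrow> complex" where
  "ball_indicator x = (if norm x < 1 then 1 else 0)"

lemma ball_indicator_measurable [measurable]: "ball_indicator \<in> borel_measurable lebesgue"
proof (rule measurable_completion)
  show "ball_indicator \<in> borel_measurable lborel" unfolding ball_indicator_def by measurable
qed

lemma loc_integrable_ball_indicator: "loc_integrable (ball_indicator :: real ^ 'n \<Rightarrow> complex)"
  unfolding loc_integrable_def
proof (intro allI impI)
  fix A :: "(real ^ 'n) set" assume A: "compact A"
  have [measurable]: "A \<in> sets lebesgue" using A by (simp add: lborelD borel_compact)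
  have "(\<lambda>x. indicator A x *\<^sub>R ball_indicator x) \<in> Linf_c"
  proof (rule Linf_cI[where B = 1 and S = A])
    show "(\<lambda>x. indicator A x *\<^sub>R ball_indicator x) \<in> borel_measurable lebesgue" by measurable
  qed (use compact_imp_bounded[OF A] in \<open>auto simp: ball_indicator_def indicator_def\<close>)
  then show "ball_indicator absolutely_integrable_on A"
    unfolding set_integrable_def by (rule Linf_c_integrable)
qed

lemma mult_norm_ball_indicator:
  assumes pq: "1 < q" "q < p"
  shows "mult_norm p (\<lambda>_ :: real ^ 'n. 1) q (power_weight (1 - q / p)) (\<lambda>x. ball_indicator x - c) = \<infinity>"
proof (cases "c = 1")
  case False
  show ?thesis
  proof (rule mult_norm_power_weight_shell[OF pq, of "cmod (1 - c)"])
    fix \<Lambda> :: real assume "0 < \<Lambda>"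
    have "norm x < 1" if "norm (x :: real ^ 'n) ^ CARD('n) \<le> 1 / 2" for x
    proof (rule ccontr)
      assume "\<not> norm x < 1"
      then have "1 \<le> norm x ^ CARD('n)" by (intro one_le_power) simp
      with that show False by simp
    qed
    \<comment> \<open>The outer radius stays fixed inside the unit ball and the inner one shrinks to
      the origin.\<close>
    then show "\<exists>s>0. \<exists>t. ln t - ln s = \<Lambda> \<and> 0 < t \<and>
        (\<forall>x :: real ^ 'n. s \<le> norm x ^ CARD('n) \<and> norm x ^ CARD('n) \<le> t \<longrightarrow> cmod (ball_indicator x - c) = cmod (1 - c))"
      by (intro exI[of _ "exp (ln (1/2) - \<Lambda>)"] exI[of _ "1/2"] conjI) (auto simp: ball_indicator_def)
  qed (use False in auto)
next
  case True
  show ?thesis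
  proof (rule mult_norm_power_weight_shell[OF pq, of 1])
    fix \<Lambda> :: real assume "0 < \<Lambda>"
    have "\<not> norm x < 1" if "2 \<le> norm (x :: real ^ 'n) ^ CARD('n)" for x
    proof
      assume "norm x < 1"
      then have "norm x ^ CARD('n) \<le> 1" by (intro power_le_one) auto
      with that show False by simp
    qed
    \<comment> \<open>Now the inner radius stays fixed outside the unit ball and the outer one goes
      to infinity.\<close>
    then show "\<exists>s>0. \<exists>t. ln t - ln s = \<Lambda> \<and> 0 < t \<and>
        (\<forall>x :: real ^ 'n. s \<le> norm x ^ CARD('n) \<and> norm x ^ CARD('n) \<le> t \<longrightarrow> cmod (ball_indicator x - c) = 1)"
      by (intro exI[of _ 2] exI[of _ "exp (ln 2 + \<Lambda>)"] conjI) (auto simp: ball_indicator_def True)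
  qed simp
qed

context dini_cz_operator
begin

lemma kernel_size:
  obtains C where "0 < C" "\<And>x y. x \<noteq> y \<Longrightarrow> cmod (K x y) \<le> C / norm (x - y) ^ CARD('n)"
proof -
  obtain C where C: "\<And>x y. x \<noteq> y \<Longrightarrow> cmod (K x y) \<le> C / norm (x - y) ^ CARD('n)"
    using kernel unfolding cz_kernel_def by blast
  show thesis
  proof (rule that[of "max 1 C"])
    fix x y :: "real ^ 'n" assume "x \<noteq> y"
    then have "cmod (K x y) \<le> C / norm (x - y) ^ CARD('n)" by (rule C)
    also have "\<dots> \<le> max 1 C / norm (x - y) ^ CARD('n)" by (intro divide_right_mono) auto
    finally show "cmod (K x y) \<le> max 1 C / norm (x - y) ^ CARD('n)" .
  qed simp
qed

text \<open>Only the off-diagonal kernel representation of \<open>T\<close> enters, because \<open>b\<close> takes only two values: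
  \<open>[b, T] f\<close> equals \<open>T (f 1\<^bsub>B\<^sup>c\<^esub>)\<close> in the ball \<open>B\<close> and \<open>- T (f 1\<^bsub>B\<^esub>)\<close> outside.\<close>

lemma commutator_ball_indicator_le:
  obtains C where "0 < C" "\<And>f. f \<in> Linf_c \<Longrightarrow> AE x in lebesgue.
    ennreal (cmod (commutator ball_indicator T f x)) \<le>
      (\<integral>\<^sup>+y. ennreal (1 / norm (x - y) ^ CARD('n)) * indicator (opposite_side x) y * ennreal (C * cmod (f y)) \<partial>lebesgue)"
proof -
  obtain C where C: "0 < C" "\<And>x y. x \<noteq> y \<Longrightarrow> cmod (K x y) \<le> C / norm (x - y) ^ CARD('n)"
    by (rule kernel_size) (rule that; assumption)
  show thesis
  proof (rule that[OF C(1)])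
    fix f :: "real ^ 'n \<Rightarrow> complex" assume f: "f \<in> Linf_c"
    let ?R = "\<lambda>x. \<integral>\<^sup>+y. ennreal (1 / norm (x - y) ^ CARD('n)) * indicator (opposite_side x) y * ennreal (C * cmod (f y)) \<partial>lebesgue"
    define f1 where "f1 = (\<lambda>y. ball_indicator y * f y)"
    define f2 where "f2 = (\<lambda>y. f y - f1 y)"
    have f1: "f1 \<in> Linf_c" unfolding f1_def
      by (rule Linf_c_mult[OF f ball_indicator_measurable, where B = 1]) (simp add: ball_indicator_def)
    have f2: "f2 \<in> Linf_c" unfolding f2_def by (rule Linf_c_diff[OF f f1])
    have sum: "(\<lambda>y. f1 y + f2 y) = f" by (auto simp: f2_def)
    have f1_0: "f1 y = 0" if "\<not> norm y < 1" for y using that by (simp add: f1_def ball_indicator_def)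
    have f2_0: "f2 y = 0" if "norm y < 1" for y using that by (simp add: f2_def f1_def ball_indicator_def)
    have le: "cmod (f1 y) \<le> cmod (f y)" "cmod (f2 y) \<le> cmod (f y)" for y
      by (auto simp: f2_def f1_def ball_indicator_def)
    have clos1: "closure {y. f1 y \<noteq> 0} \<subseteq> cball 0 1"
      using f1_0 by (intro closure_minimal) force+
    have clos2: "closure {y. f2 y \<noteq> 0} \<subseteq> - ball 0 1"
      using f2_0 by (intro closure_minimal) force+
    have bound: "ennreal (cmod (\<integral>y. K x y * h y \<partial>lebesgue)) \<le> ?R x"
      if h: "\<And>y. cmod (h y) \<le> cmod (f y)" "\<And>y. h y \<noteq> 0 \<Longrightarrow> y \<in> opposite_side x" for h x
    proof -
      have "ennreal (cmod (\<integral>y. K x y * h y \<partial>lebesgue)) \<le> (\<integral>\<^sup>+y. ennreal (cmod (K x y * h y)) \<partial>lebesgue)"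
        by (rule norm_integral_le_nn_integral)
      also have "\<dots> \<le> ?R x"
      proof (intro nn_integral_mono)
        fix y
        show "ennreal (cmod (K x y * h y)) \<le> ennreal (1 / norm (x - y) ^ CARD('n)) * indicator (opposite_side x) y * ennreal (C * cmod (f y))"
        proof (cases "h y = 0")
          case False
          then have y: "y \<in> opposite_side x" by (rule h(2))
          then have "x \<noteq> y" by (auto simp: opposite_side_def)
          then have "cmod (K x y) * cmod (h y) \<le> C / norm (x - y) ^ CARD('n) * cmod (f y)"
            using C by (intro mult_mono C(2) h(1)) auto
          then have "ennreal (cmod (K x y * h y)) \<le> ennreal (1 / norm (x - y) ^ CARD('n) * (C * cmod (f y)))"
            by (intro ennreal_leI) (simp add: norm_mult)
          also have "\<dots> = ennreal (1 / norm (x - y) ^ CARD('n)) * ennreal (C * cmod (f y))"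
            by (rule ennreal_mult') simp
          finally show ?thesis using y by simp
        qed simp
      qed
      finally show ?thesis .
    qed
    \<comment> \<open>A point of the sphere may belong to the closed supports of both pieces of f,
      so neither kernel representation is available there; the sphere is a null set.\<close>
    have "AE x in lebesgue. norm (x :: real ^ 'n) \<noteq> 1"
    proof -
      have "sphere (0 :: real ^ 'n) 1 \<in> null_sets lebesgue"
        using negligible_sphere by (simp add: negligible_iff_null_sets)
      from AE_not_in[OF this] show ?thesis by eventually_elim simp
    qed
    moreover have "AE x in lebesgue. T f x = T f1 x + T f2 x" using T_add[OF f1 f2] unfolding sum .
    ultimately show "AE x in lebesgue. ennreal (cmod (commutator ball_indicator T f x)) \<le> ?R x"
      using ext_eq[OF f1] representation[OF f1] representation[OF f2]
    proof eventually_elim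
      case (elim x)
      have comm: "commutator ball_indicator T f x = ball_indicator x * (T f1 x + T f2 x) - T f1 x"
        using elim(2,3) by (simp add: commutator_def f1_def)
      show ?case
      proof (cases "norm x < 1")
        case True
        then have "x \<notin> closure {y. f2 y \<noteq> 0}" using clos2 by auto
        then have "commutator ball_indicator T f x = (\<integral>y. K x y * f2 y \<partial>lebesgue)"
          using comm elim(5) True by (simp add: ball_indicator_def)
        moreover have "ennreal (cmod (\<integral>y. K x y * f2 y \<partial>lebesgue)) \<le> ?R x"
          using True f2_0 le by (intro bound) (auto simp: opposite_side_def not_less[symmetric])
        ultimately show ?thesis by simp
      next
        case False
        with elim(1) have x: "1 < norm x" by simp
        then have "x \<notin> closure {y. f1 y \<noteq> 0}" using clos1 by auto
        then have "commutator ball_indicator T f x = - (\<integral>y. K x y * f1 y \<partial>lebesgue)"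
          using comm elim(4) x by (simp add: ball_indicator_def)
        moreover have "ennreal (cmod (\<integral>y. K x y * f1 y \<partial>lebesgue)) \<le> ?R x"
          using x f1_0 le by (intro bound) (auto simp: opposite_side_def)
        ultimately show ?thesis by simp
      qed
    qed
  qed
qed

text \<open>\<open>cross_sphere_bound\<close> applied to a multiple of |f|, followed by a q-th root,
  which turns the power q/p of the integral of |f|^p into its L^p norm.\<close>

lemma commutator_ball_indicator_bounded:
  assumes pq: "1 < q" "q < p"
  shows "op_norm Linf_c p (\<lambda>_. 1) q (power_weight (1 - q / p)) (commutator ball_indicator T) < \<infinity>"
proof -
  obtain C0 where C0: "0 < C0" and comm: "\<And>f. f \<in> Linf_c \<Longrightarrow> AE x in lebesgue.
    ennreal (cmod (commutator ball_indicator T f x)) \<le>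
      (\<integral>\<^sup>+y. ennreal (1 / norm (x - y) ^ CARD('n)) * indicator (opposite_side x) y * ennreal (C0 * cmod (f y)) \<partial>lebesgue)"
    by (rule commutator_ball_indicator_le) (rule that; assumption)
  obtain C where C: "C < top" and cross: "\<And>g :: real ^ 'n \<Rightarrow> ennreal. g \<in> borel_measurable lebesgue \<Longrightarrow>
      (\<integral>\<^sup>+x. epowr (\<integral>\<^sup>+y. ennreal (1 / norm (x - y) ^ CARD('n)) * indicator (opposite_side x) y * g y \<partial>lebesgue) q
         * ennreal (power_weight (1 - q / p) x) \<partial>lebesgue)
      \<le> C * epowr (\<integral>\<^sup>+y. epowr (g y) p \<partial>lebesgue) (q / p)"
    by (rule cross_sphere_bound[OF pq]) (rule that; assumption)
  define N where "N = epowr C (1 / q) * ennreal C0"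
  have "N < top" using C by (simp add: N_def ennreal_mult_less_top)
  then obtain N' where N': "N = ennreal N'" "0 \<le> N'" by (cases N) auto
  have "op_norm Linf_c p (\<lambda>_. 1) q (power_weight (1 - q / p)) (commutator ball_indicator T) \<le> ennreal N'"
  proof (rule op_norm_leI[OF N'(2)])
    fix f :: "real ^ 'n \<Rightarrow> complex" assume f: "f \<in> Linf_c"
    note [measurable] = Linf_c_measurable[OF f]
    let ?P = "\<lambda>x. \<integral>\<^sup>+y. ennreal (1 / norm (x - y) ^ CARD('n)) * indicator (opposite_side x) y * ennreal (C0 * cmod (f y)) \<partial>lebesgue"
    have "(\<integral>\<^sup>+x. ennreal (cmod (commutator ball_indicator T f x) powr q * power_weight (1 - q / p) x) \<partial>lebesgue) \<le>
      (\<integral>\<^sup>+x. epowr (?P x) q * ennreal (power_weight (1 - q / p) x) \<partial>lebesgue)"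
    proof (rule nn_integral_mono_AE)
      show "AE x in lebesgue. ennreal (cmod (commutator ball_indicator T f x) powr q * power_weight (1 - q / p) x) \<le>
        epowr (?P x) q * ennreal (power_weight (1 - q / p) x)"
        using comm[OF f]
      proof eventually_elim
        case (elim x)
        have "epowr (ennreal (cmod (commutator ball_indicator T f x))) q \<le> epowr (?P x) q"
          using pq by (intro epowr_mono elim) auto
        then show ?case by (simp add: ennreal_mult' mult_right_mono)
      qed
    qed
    also have "\<dots> \<le> C * epowr (\<integral>\<^sup>+y. epowr (ennreal (C0 * cmod (f y))) p \<partial>lebesgue) (q / p)"
      by (intro cross) measurable
    also have "(\<integral>\<^sup>+y. epowr (ennreal (C0 * cmod (f y))) p \<partial>lebesgue) = ennreal (C0 powr p) * (\<integral>\<^sup>+y. ennreal (cmod (f y) powr p * 1) \<partial>lebesgue)"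
    proof (subst nn_integral_cmult[symmetric])
      have "epowr (ennreal (C0 * cmod (f y))) p = ennreal (C0 powr p) * ennreal (cmod (f y) powr p * 1)" for y
        using C0 by (subst epowr_ennreal) (simp_all add: powr_mult ennreal_mult')
      then show "(\<integral>\<^sup>+y. epowr (ennreal (C0 * cmod (f y))) p \<partial>lebesgue) = (\<integral>\<^sup>+y. ennreal (C0 powr p) * ennreal (cmod (f y) powr p * 1) \<partial>lebesgue)"
        by (simp only:)
    qed measurable
    finally have "Lp_norm q (power_weight (1 - q / p)) (commutator ball_indicator T f) \<le>
       epowr (C * epowr (ennreal (C0 powr p) * (\<integral>\<^sup>+y. ennreal (cmod (f y) powr p * 1) \<partial>lebesgue)) (q / p)) (1 / q)"
      unfolding Lp_norm_def using pq by (intro epowr_mono) auto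
    also have "\<dots> = N * Lp_norm p (\<lambda>_. 1) f"
    proof -
      have "epowr (ennreal (C0 powr p)) (1 / p) = ennreal C0" using C0 pq by (simp add: powr_powr)
      then show ?thesis using pq unfolding N_def Lp_norm_def epowr_mult epowr_epowr
        by (simp add: mult.assoc)
    qed
    finally show "Lp_norm q (power_weight (1 - q / p)) (commutator ball_indicator T f) \<le> ennreal N' * Lp_norm p (\<lambda>_. 1) f"
      by (simp add: N')
  qed
  then show ?thesis by (simp add: le_less_trans)
qed

end

theorem theorem5p3:
  fixes T :: "(real ^ 'n \<Rightarrow> complex) \<Rightarrow> real ^ 'n \<Rightarrow> complex"
    and \<omega> :: "real \<Rightarrow> real"
  assumes "modulus_of_continuity \<omega>" and "dini \<omega>" and "cz_operator \<omega> T"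
  shows
    "(\<forall>p q \<mu> \<nu> b. 1 < p \<and> 1 < q \<and> \<mu> \<in> Ap_weights p \<and> \<nu> \<in> Ap_weights q \<and> loc_integrable b \<longrightarrow>
        op_norm Linf_c p \<mu> q \<nu> (commutator b T)
          \<le> (op_norm Linf_c p \<mu> p \<mu> T + op_norm Linf_c q \<nu> q \<nu> T)
             * (INF c::complex. mult_norm p \<mu> q \<nu> (\<lambda>x. b x - c)))
     \<and>
     (\<forall>p q. 1 < q \<and> q < p \<longrightarrow>
        (\<exists>\<mu>\<in>Ap_weights p. \<exists>\<nu>\<in>Ap_weights q. \<exists>b. loc_integrable b \<and>
           (INF c::complex. mult_norm p \<mu> q \<nu> (\<lambda>x. b x - c)) = \<infinity> \<and>
           op_norm Linf_c p \<mu> q \<nu> (commutator b T) < \<infinity>))"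
proof -
  from assms(3) obtain s K where s: "1 < s" "bounded_on_Ls s T" and K: "cz_kernel \<omega> K"
    "\<And>f. f \<in> Linf_c \<Longrightarrow> AE x in lebesgue. x \<notin> closure {y. f y \<noteq> 0} \<longrightarrow> T f x = (\<integral>y. K x y * f y \<partial>lebesgue)"
    unfolding cz_operator_def by blast
  interpret dini_cz_operator T \<omega> K s
    using assms(1,2) s K by unfold_locales
  show ?thesis
  proof (intro conjI allI impI)
    fix p q and \<mu> \<nu> :: "real ^ 'n \<Rightarrow> real" and b :: "real ^ 'n \<Rightarrow> complex"
    assume *: "1 < p \<and> 1 < q \<and> \<mu> \<in> Ap_weights p \<and> \<nu> \<in> Ap_weights q \<and> loc_integrable b"
    then have "weight \<mu>" "weight \<nu>" by (auto simp: Ap_weights_def)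
    with * show "op_norm Linf_c p \<mu> q \<nu> (commutator b T)
          \<le> (op_norm Linf_c p \<mu> p \<mu> T + op_norm Linf_c q \<nu> q \<nu> T) * (INF c::complex. mult_norm p \<mu> q \<nu> (\<lambda>x. b x - c))"
      by (intro commutator_op_norm_le) auto
  next
    fix p q :: real assume pq: "1 < q \<and> q < p"
    have \<mu>: "(\<lambda>_ :: real ^ 'n. 1) \<in> Ap_weights p" using pq by (intro weight_1_Ap) auto
    have \<nu>: "(power_weight (1 - q / p) :: real ^ 'n \<Rightarrow> real) \<in> Ap_weights q"
      using pq by (intro power_weight_Ap) (auto simp: field_simps)
    have inf: "(INF c::complex. mult_norm p (\<lambda>_ :: real ^ 'n. 1) q (power_weight (1 - q / p)) (\<lambda>x. ball_indicator x - c)) = \<infinity>"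
      using pq by (simp add: mult_norm_ball_indicator)
    show "\<exists>\<mu>\<in>Ap_weights p. \<exists>\<nu>\<in>Ap_weights q. \<exists>b. loc_integrable b \<and>
           (INF c::complex. mult_norm p \<mu> q \<nu> (\<lambda>x. b x - c)) = \<infinity> \<and>
           op_norm Linf_c p \<mu> q \<nu> (commutator b T) < \<infinity>"
      using pq by (intro bexI[OF _ \<mu>] bexI[OF _ \<nu>] exI[of _ ball_indicator] conjI
        loc_integrable_ball_indicator inf commutator_ball_indicator_bounded) auto
  qed
qed

end
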